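(* Let $\kappa>3$, $\delta>0$, $u_0\in H$, and let $u(t)$ be the solution of $$\frac{du}{dt}+\mu e^{2\sigma A^{1/2}}u+B(u,u)=0,\qquad u(0)=u_0 .$$ Let $L,U>0$ be the typical length scale and velocity of the initial data. Then for any $t>0$ the function $u(t)$ is an entire function in the space variable and its spatial Fourier coefficients $\hat u(k,t)$ tend to zero in the following faster-than-exponential way: there exists a constant $\Lambda>0$ such that, for any $0<\varepsilon<1$, $$|\hat u(k,t)|\le e^{-\frac{\sigma(1-\varepsilon)}{\beta_{\kappa,\delta}}|k|\ln|k|}\quad\text{for all } k\in\mathbb Z^3\setminus\{0\}\text{ with } |k|\ge\left(\sqrt{\frac{\Lambda L}{Ut}}\right)^{\frac{\beta_{\kappa,\delta}}{\varepsilon\sigma}},$$ where $$\beta_{\kappa,\delta}=\ln\left((1+\delta)\frac{4\kappa-5}{2\kappa-5}\right).$$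
   Context: Let $\Omega=[0,2\pi]^3$ with periodic boundary conditions, and let $\mu>0$, $\sigma>0$ be fixed. $H=\{\varphi\in (L^2(\Omega))^3:\ \varphi \text{ periodic},\ \int_\Omega\varphi\,dx=0,\ \nabla\cdot\varphi=0\}$. $A=-\nabla^2$; for real $\lambda$, $e^{\lambda A^{1/2}}$ is the operator with Fourier symbol $e^{\lambda|k|}$, $k\in\mathbb Z^3\setminus\{0\}$. $B(u,u)=P\big((u\cdot\nabla)u\big)$, where $P$ is the Leray ($L^2$-orthogonal) projector onto mean-zero divergence-free periodic fields; thus the equation is the abstract form of the unforced 3D periodic incompressible Navier–Stokes equations $\partial_t u+u\cdot\nabla u=-\nabla p-\mu\mathcal D u$, $\nabla\cdot u=0$, where $\mathcal D$ has Fourier symbol $e^{2\sigma|k|}$. "Solution" means the weak solution with $u\in C([0,T];H)$ and $e^{\sigma A^{1/2}}u\in L^2(0,T;H)$ for every $T>0$, obtained e.g. as the limit of Galerkin approximations. Fourier coefficients are defined by $u(x,t)=\sum_k e^{ik\cdot x}\hat u(k,t)$. "Entire" means that the function of $x\in\mathbb R^3$ extends to a holomorphic function on $\mathbb C^3$. The numbers $L$ and $U$ are fixed positive reference scales (a length and a velocity) attached to the initial data. *)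

theory Defs
  imports "HOL-Analysis.Analysis"
begin

text \<open>Functions on the torus are represented by functions on all of \<open>\<real>\<^sup>3\<close> that are
  \<open>2\<pi>\<close>-periodic in each variable; equality in \<open>L\<^sup>2\<close> is equality almost everywhere.\<close>

definition Omega :: "(real^3) set" where
  "Omega = cbox 0 (\<chi> i. 2 * pi)"

definition wavevec :: "int^3 \<Rightarrow> real^3" where
  "wavevec k = (\<chi> j. real_of_int (k $ j))"

definition periodic :: "(real^3 \<Rightarrow> 'b) \<Rightarrow> bool" where
  "periodic f \<longleftrightarrow> (\<forall>x k. f (x + (2 * pi) *\<^sub>R wavevec k) = f x)"

definition L2_per :: "(real^3 \<Rightarrow> 'b::euclidean_space) set" where
  "L2_per = {f. periodic f \<and> f \<in> borel_measurable lebesgue \<and>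
     set_integrable lebesgue Omega (\<lambda>x. (norm (f x))\<^sup>2)}"

definition L2_inner :: "(real^3 \<Rightarrow> real^3) \<Rightarrow> (real^3 \<Rightarrow> real^3) \<Rightarrow> real" where
  "L2_inner f g = (LINT x:Omega|lebesgue. f x \<bullet> g x)"

definition L2_norm :: "(real^3 \<Rightarrow> real^3) \<Rightarrow> real" where
  "L2_norm f = sqrt (LINT x:Omega|lebesgue. (norm (f x))\<^sup>2)"

text \<open>Periodic \<open>C\<^sup>1\<close> scalar test functions \<open>\<psi>\<close> with gradient \<open>D\<close>, used to define weak
  derivatives.\<close>

definition test_function :: "(real^3 \<Rightarrow> real) \<Rightarrow> (real^3 \<Rightarrow> real^3) \<Rightarrow> bool" where
  "test_function \<psi> D \<longleftrightarrow>
     periodic \<psi> \<and> (\<forall>x. GDERIV \<psi> x :> D x) \<and> continuous_on UNIV D"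

definition weak_div_free :: "(real^3 \<Rightarrow> real^3) \<Rightarrow> bool" where
  "weak_div_free f \<longleftrightarrow>
     (\<forall>\<psi> D. test_function \<psi> D \<longrightarrow> (LINT x:Omega|lebesgue. f x \<bullet> D x) = 0)"

definition H :: "(real^3 \<Rightarrow> real^3) set" where
  "H = {f \<in> L2_per. (LINT x:Omega|lebesgue. f x) = 0 \<and> weak_div_free f}"

definition fourier_coeff :: "(real^3 \<Rightarrow> real^3) \<Rightarrow> int^3 \<Rightarrow> complex^3" where
  "fourier_coeff f k = (\<chi> j. complex_of_real (1 / (2 * pi) ^ 3) *
     (LINT x:Omega|lebesgue. exp (- \<i> * complex_of_real (wavevec k \<bullet> x)) * complex_of_real (f x $ j)))"

text \<open>The operator \<open>exp (a A\<^sup>1\<^sup>/\<^sup>2)\<close> is unbounded for \<open>a > 0\<close>, so it is given by its graph: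
  \<open>f\<close> lies in its domain iff some \<open>g\<close> is related to \<open>f\<close>, and such a \<open>g\<close> is unique a.e.\<close>

definition exp_sqrtA :: "real \<Rightarrow> (real^3 \<Rightarrow> real^3) \<Rightarrow> (real^3 \<Rightarrow> real^3) \<Rightarrow> bool" where
  "exp_sqrtA a f g \<longleftrightarrow> f \<in> H \<and> g \<in> H \<and>
     (\<forall>k. k \<noteq> 0 \<longrightarrow>
        fourier_coeff g k = exp (a * norm (wavevec k)) *\<^sub>R fourier_coeff f k)"

text \<open>\<open>g\<close> is the \<open>L\<^sup>2\<close>-orthogonal projection of \<open>f\<close> onto \<open>H\<close>.\<close>

definition leray :: "(real^3 \<Rightarrow> real^3) \<Rightarrow> (real^3 \<Rightarrow> real^3) \<Rightarrow> bool" where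
  "leray f g \<longleftrightarrow> f \<in> L2_per \<and> g \<in> H \<and> (\<forall>h\<in>H. L2_inner (\<lambda>x. f x - g x) h = 0)"

text \<open>\<open>G\<close> is the weak Jacobian of \<open>v\<close>; row \<open>i\<close> of \<open>G x\<close> is the weak gradient of the \<open>i\<close>-th
  component of \<open>v\<close>, so that \<open>(u \<cdot> \<nabla>) v\<close> is the matrix-vector product \<open>G *v u\<close>.\<close>

definition weak_jacobian :: "(real^3 \<Rightarrow> real^3) \<Rightarrow> (real^3 \<Rightarrow> real^3^3) \<Rightarrow> bool" where
  "weak_jacobian v G \<longleftrightarrow> G \<in> L2_per \<and>
     (\<forall>\<psi> D i. test_function \<psi> D \<longrightarrow>
        (LINT x:Omega|lebesgue. (v x $ i) *\<^sub>R D x) = - (LINT x:Omega|lebesgue. \<psi> x *\<^sub>R (G x $ i)))"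

text \<open>\<open>bilinear_B u v b\<close> says that \<open>B (u, v) = P ((u \<cdot> \<nabla>) v)\<close> is defined and equals \<open>b\<close>.\<close>

definition bilinear_B ::
  "(real^3 \<Rightarrow> real^3) \<Rightarrow> (real^3 \<Rightarrow> real^3) \<Rightarrow> (real^3 \<Rightarrow> real^3) \<Rightarrow> bool" where
  "bilinear_B u v b \<longleftrightarrow> (\<exists>G. weak_jacobian v G \<and> leray (\<lambda>x. G x *v u x) b)"

definition continuous_in_H :: "real \<Rightarrow> (real \<Rightarrow> real^3 \<Rightarrow> real^3) \<Rightarrow> bool" where
  "continuous_in_H T u \<longleftrightarrow> (\<forall>t\<in>{0..T}. u t \<in> H \<and>
     ((\<lambda>s. L2_norm (\<lambda>x. u s x - u t x)) \<longlongrightarrow> 0) (at t within {0..T}))"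

text \<open>\<open>L\<^sup>2(0,T;H)\<close>. Since \<open>H\<close> is separable, weak measurability is the same as Bochner
  measurability (Pettis).\<close>

definition square_integrable_in_H :: "real \<Rightarrow> (real \<Rightarrow> real^3 \<Rightarrow> real^3) \<Rightarrow> bool" where
  "square_integrable_in_H T w \<longleftrightarrow>
     (AE s in lebesgue. s \<in> {0..T} \<longrightarrow> w s \<in> H) \<and>
     (\<forall>h\<in>H. (\<lambda>s. L2_inner (w s) h) \<in> borel_measurable (lebesgue_on {0..T})) \<and>
     set_integrable lebesgue {0..T} (\<lambda>s. (L2_norm (w s))\<^sup>2)"

text \<open>Weak solutions of \<open>du/dt + \<mu> exp (2 \<sigma> A\<^sup>1\<^sup>/\<^sup>2) u + B (u, u) = 0\<close>, \<open>u(0) = u0\<close>. Here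
  \<open>w s\<close> is \<open>exp (\<sigma> A\<^sup>1\<^sup>/\<^sup>2) u(s)\<close> and \<open>b s\<close> is \<open>B (u(s), u(s))\<close>; the equation is tested with
  every \<open>\<phi>\<close> in the domain of \<open>exp (\<sigma> A\<^sup>1\<^sup>/\<^sup>2)\<close>, with \<open>\<psi>\<close> equal to \<open>exp (\<sigma> A\<^sup>1\<^sup>/\<^sup>2) \<phi>\<close>, and
  integrated in time. By self-adjointness the dissipation tested with \<open>\<phi>\<close> is
  \<open>\<mu> \<langle>w s, \<psi>\<rangle>\<close>, which makes sense although \<open>exp (2 \<sigma> A\<^sup>1\<^sup>/\<^sup>2) u(s)\<close> itself need not lie in
  \<open>L\<^sup>2\<close>. The required integrability in time is automatic from the regularity of \<open>u\<close>; it is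
  recorded because the integral would otherwise be \<open>0\<close> by convention.\<close>

definition weak_solution ::
  "real \<Rightarrow> real \<Rightarrow> (real^3 \<Rightarrow> real^3) \<Rightarrow> (real \<Rightarrow> real^3 \<Rightarrow> real^3) \<Rightarrow> bool" where
  "weak_solution \<mu> \<sigma> u0 u \<longleftrightarrow>
     (\<forall>T>0. continuous_in_H T u) \<and>
     (AE x in lebesgue. u 0 x = u0 x) \<and>
     (\<exists>w b.
        (\<forall>T>0. square_integrable_in_H T w) \<and>
        (AE s in lebesgue. s > 0 \<longrightarrow> exp_sqrtA \<sigma> (u s) (w s) \<and> bilinear_B (u s) (u s) (b s)) \<and>
        (\<forall>\<phi> \<psi>. exp_sqrtA \<sigma> \<phi> \<psi> \<longrightarrow>
           (\<forall>t\<ge>0.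
              set_integrable lebesgue {0..t} (\<lambda>s. \<mu> * L2_inner (w s) \<psi> + L2_inner (b s) \<phi>) \<and>
              L2_inner (u t) \<phi> +
                (LINT s:{0..t}|lebesgue. \<mu> * L2_inner (w s) \<psi> + L2_inner (b s) \<phi>)
              = L2_inner u0 \<phi>)))"

definition entire3 :: "(complex^3 \<Rightarrow> complex^3) \<Rightarrow> bool" where
  "entire3 F \<longleftrightarrow>
     (\<forall>z. \<exists>D. (F has_derivative D) (at z) \<and> (\<forall>c v. D (c *s v) = c *s D v))"

text \<open>As elements of \<open>H\<close> are only determined almost everywhere, being entire means having an
  entire representative.\<close>

definition extends_to_entire :: "(real^3 \<Rightarrow> real^3) \<Rightarrow> bool" where
  "extends_to_entire f \<longleftrightarrow> (\<exists>F. entire3 F \<and>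
     (AE x in lebesgue. F (\<chi> i. complex_of_real (x $ i)) = (\<chi> j. complex_of_real (f x $ j))))"

definition beta :: "real \<Rightarrow> real \<Rightarrow> real" where
  "beta \<kappa> \<delta> = ln ((1 + \<delta>) * ((4 * \<kappa> - 5) / (2 * \<kappa> - 5)))"

end

theory Submission
  imports Defs
begin

text \<open>
  The theorem is proved on the Fourier side. For \<open>k \<noteq> 0\<close> and \<open>v\<close> perpendicular to \<open>k\<close>, testing the
  weak equation with the divergence-free fields \<open>cos (k \<bullet> x) v\<close> and \<open>sin (k \<bullet> x) v\<close> yields an ordinary
  differential equation for the component of the Fourier coefficient along \<open>v\<close>, with damping rate
  \<open>\<mu> exp (2 \<sigma> |k|)\<close> and a forcing that is a convolution of the coefficients
  (\<open>weak_solution_mode_system\<close>). To identify this forcing one must know that a velocity with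
  summable coefficients equals its Fourier series, which is the uniqueness theorem
  \<open>fourier_uniqueness\<close>; it is derived from the Stone-Weierstrass theorem on the torus.

  The decay comes from an iteration (\<open>gevrey_iteration\<close>). If the coefficients are bounded by
  \<open>C exp (- r |k|)\<close> from some time on, then because of \<open>|k| \<le> |p| + |k - p|\<close> the quadratic forcing is
  bounded by \<open>C\<^sup>2 exp (- r |k|)\<close> up to a small loss in the rate, and division by the damping rate
  gains a factor \<open>exp (- 2 \<sigma> |k|)\<close>. After a short waiting time the coefficients are therefore bounded
  by a multiple of \<open>C\<^sup>2 exp (- (r + \<sigma>) |k|)\<close>, if \<open>C \<ge> 1\<close>. After \<open>n\<close> steps that fit into the time \<open>t\<close> the bound is
  \<open>(Z / t) ^ (2 ^ n) exp (- n \<sigma> |k|)\<close>. The number of steps is free; for \<open>2 ^ n\<close> between \<open>|k| / 4\<close> and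
  \<open>|k| / 2\<close> one obtains \<open>(Z' / t) powr (|k| / 2) * exp (- \<sigma> / ln 2 * |k| * ln |k|)\<close>
  (\<open>superexponential_decay\<close>). The first factor explains the square root in the threshold for \<open>|k|\<close>:
  beyond the threshold it is at most the fraction \<open>\<epsilon>\<close> of the decay.

  As soon as \<open>t \<ge> \<Lambda> L / U\<close> the threshold admits all \<open>k \<noteq> 0\<close>, and no constant may be
  lost. Since \<open>beta \<kappa> \<delta>\<close> is strictly larger than \<open>ln 2\<close>, constants are harmless for large \<open>|k|\<close>;
  the finitely many remaining modes are small because the energy decays like \<open>exp (- 2 \<mu> t)\<close>
  (\<open>energy_decay\<close>), which also provides the uniform bound that starts the iteration. The energy
  estimate rests on the antisymmetry of the triad interactions.

  Finally, coefficients that decay faster than every exponential are those of an entire function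
  (\<open>entire_fourier_series\<close>).
\<close>

section \<open>Integration by parts on the torus\<close>

text \<open>Only translations along one axis by at most a period are needed: then the translated box
  sticks out of \<open>Omega\<close> through one face, and the part that sticks out is the part missing at the
  opposite face, moved by one period.\<close>

lemma integral_translate_axis:
  fixes F :: "real^3 \<Rightarrow> 'b::euclidean_space"
  assumes per: "periodic F" and cont: "continuous_on UNIV F" and s: "0 \<le> s" "s \<le> 2 * pi"
  shows "integral Omega (\<lambda>x. F (x + s *\<^sub>R axis j 1)) = integral Omega F"
proof -
  define e :: "real^3" where "e = axis j 1"
  define c :: "real^3" where "c = (\<chi> i. 2 * pi)"
  have e[simp]: "e $ i = (if i = j then 1 else 0)" for i by (simp add: e_def axis_def)
  have xe[simp]: "x \<bullet> e = x $ j" for x by (simp add: e_def inner_axis)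
  have cc[simp]: "c $ i = 2 * pi" for i by (simp add: c_def)
  have eB: "e \<in> Basis" by (auto simp: e_def Basis_vec_def)
  have int: "F integrable_on cbox a b" for a b
    by (rule integrable_continuous) (use cont continuous_on_subset in blast)
  have shift: "F (x + (2 * pi) *\<^sub>R e) = F x" for x
  proof -
    have "e = wavevec (axis j 1)" by (auto simp: wavevec_def vec_eq_iff axis_def)
    then show ?thesis using per unfolding periodic_def by metis
  qed
  \<comment> \<open>both boxes are cut by hyperplanes perpendicular to the axis \<open>e\<close>; one pair of pieces coincides, the
    other differs by a period\<close>
  have "integral (cbox 0 c) (\<lambda>x. F (x + s *\<^sub>R e)) = integral (cbox (s *\<^sub>R e) (c + s *\<^sub>R e)) F"
    using integral_shift_cbox[of "s *\<^sub>R e" "s *\<^sub>R e" "c + s *\<^sub>R e" F] by simp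
  also have "\<dots> = integral (cbox (s *\<^sub>R e) (c + s *\<^sub>R e) \<inter> {x. x \<bullet> e \<le> 2 * pi}) F +
                  integral (cbox (s *\<^sub>R e) (c + s *\<^sub>R e) \<inter> {x. 2 * pi \<le> x \<bullet> e}) F"
    by (rule integral_split[OF int eB])
  also have "cbox (s *\<^sub>R e) (c + s *\<^sub>R e) \<inter> {x. x \<bullet> e \<le> 2 * pi} = cbox 0 c \<inter> {x. s \<le> x \<bullet> e}"
    using s by (auto simp: mem_box_cart split: if_splits) (smt (verit))+
  also have "cbox (s *\<^sub>R e) (c + s *\<^sub>R e) \<inter> {x. 2 * pi \<le> x \<bullet> e} = cbox ((2 * pi) *\<^sub>R e) (c + s *\<^sub>R e)"
    using s by (auto simp: mem_box_cart split: if_splits) (smt (verit))+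
  also have "integral (cbox ((2 * pi) *\<^sub>R e) (c + s *\<^sub>R e)) F
             = integral (cbox 0 (c + s *\<^sub>R e - (2 * pi) *\<^sub>R e)) F"
    using integral_shift_cbox[of "(2 * pi) *\<^sub>R e" "(2 * pi) *\<^sub>R e" "c + s *\<^sub>R e" F]
    by (simp add: shift)
  also have "cbox 0 (c + s *\<^sub>R e - (2 * pi) *\<^sub>R e) = cbox 0 c \<inter> {x. x \<bullet> e \<le> s}"
    using s by (auto simp: mem_box_cart split: if_splits) (smt (verit))+
  also have "integral (cbox 0 c \<inter> {x. s \<le> x \<bullet> e}) F + integral (cbox 0 c \<inter> {x. x \<bullet> e \<le> s}) F
             = integral (cbox 0 c) F"
    using integral_split[OF int eB, of 0 c s] by simp
  finally show ?thesis by (simp add: Omega_def c_def e_def)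
qed

text \<open>The derivative at \<open>0\<close> of the mean over translates along an axis, which does not depend on the
  translation. This is the integration by parts behind all statements about weak derivatives below.\<close>

lemma integral_gradient_eq_0:
  assumes "test_function \<psi> D"
  shows "integral Omega (\<lambda>x. D x $ j) = 0"
proof -
  have per: "periodic \<psi>" and gd: "\<And>x. GDERIV \<psi> x :> D x" and cD: "continuous_on UNIV D"
    using assms by (auto simp: test_function_def)
  define c :: "real^3" where "c = (\<chi> i. 2 * pi)"
  have Om: "Omega = cbox 0 c" by (simp add: Omega_def c_def)
  have cpsi: "continuous_on UNIV \<psi>"
    using gd unfolding gderiv_def
    by (meson continuous_at_imp_continuous_on has_derivative_continuous)
  let ?e = "axis j 1 :: real^3"
  let ?U = "{0..2 * pi}"
  let ?\<phi> = "\<lambda>s. integral (cbox 0 c) (\<lambda>x. \<psi> (x + s *\<^sub>R ?e))"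
  have "(?\<phi> has_vector_derivative integral (cbox 0 c) (\<lambda>x. D (x + 0 *\<^sub>R ?e) $ j)) (at 0 within ?U)"
  proof (rule leibniz_rule_vector_derivative[where fx = "\<lambda>s x. D (x + s *\<^sub>R ?e) $ j"])
    fix s x assume "s \<in> ?U"
    have "((\<lambda>s. \<psi> (x + s *\<^sub>R ?e)) has_derivative (\<lambda>h. (h *\<^sub>R ?e) \<bullet> D (x + s *\<^sub>R ?e))) (at s within ?U)"
      by (rule has_derivative_compose[where f = "\<lambda>s. x + s *\<^sub>R ?e" and f' = "\<lambda>h. h *\<^sub>R ?e"])
         (use gd in \<open>auto simp: gderiv_def intro!: derivative_eq_intros\<close>)
    then show "((\<lambda>s. \<psi> (x + s *\<^sub>R ?e)) has_vector_derivative D (x + s *\<^sub>R ?e) $ j) (at s within ?U)"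
      by (simp add: has_vector_derivative_def inner_axis' )
  next
    fix s :: real
    show "(\<lambda>x. \<psi> (x + s *\<^sub>R ?e)) integrable_on cbox 0 c"
      by (intro integrable_continuous continuous_on_compose2[OF cpsi] continuous_intros) auto
  next
    show "continuous_on (?U \<times> cbox 0 c) (\<lambda>(s, x). D (x + s *\<^sub>R ?e) $ j)"
      unfolding case_prod_beta
      by (intro continuous_intros continuous_on_compose2[OF cD]) auto
  qed (use pi_ge_zero in auto)
  moreover have "(?\<phi> has_vector_derivative 0) (at 0 within ?U)"
  proof -
    have "?\<phi> s = ?\<phi> 0" if "s \<in> ?U" for s
      using integral_translate_axis[OF per cpsi, of s j] that by (simp add: Om)
    then show ?thesis
      by (intro has_vector_derivative_transform[of 0 ?U "?\<phi>" "\<lambda>_. ?\<phi> 0"])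
         (auto simp: has_vector_derivative_const)
  qed
  ultimately show ?thesis
    by (simp add: Om) (metis cbox_interval has_vector_derivative_def pi_gt_zero mult_pos_pos
        vector_derivative_unique_within_closed_interval atLeastAtMost_iff le_less zero_less_numeral)
qed

section \<open>Plane waves\<close>

definition wave :: "int^3 \<Rightarrow> real^3 \<Rightarrow> complex" where
  "wave k x = cis (wavevec k \<bullet> x)"

abbreviation torus :: "(real^3) measure" where
  "torus \<equiv> lebesgue_on Omega"

definition fcoeff :: "(real^3 \<Rightarrow> complex) \<Rightarrow> int^3 \<Rightarrow> complex" where
  "fcoeff g k = complex_of_real (1 / (2 * pi) ^ 3) * (LINT x|torus. wave (- k) x * g x)"

lemma wavevec_simps [simp]:
  "wavevec 0 = 0" "wavevec (k + l) = wavevec k + wavevec l"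
  "wavevec (k - l) = wavevec k - wavevec l" "wavevec (- k) = - wavevec k"
  by (auto simp: wavevec_def vec_eq_iff)

lemma wavevec_nth [simp]: "wavevec k $ j = real_of_int (k $ j)"
  by (simp add: wavevec_def)

lemma wavevec_eq_0_iff [simp]: "wavevec k = 0 \<longleftrightarrow> k = 0"
  by (auto simp: vec_eq_iff)

lemma wave_0 [simp]: "wave 0 x = 1"
  and wave_add: "wave (k + l) x = wave k x * wave l x"
  and wave_diff: "wave (k - l) x = wave k x * wave (- l) x"
  and cnj_wave: "cnj (wave k x) = wave (- k) x"
  and norm_wave [simp]: "norm (wave k x) = 1"
  by (simp_all add: wave_def inner_add_left inner_diff_left cis_mult cis_cnj)

lemma continuous_on_wave [continuous_intros]:
  "continuous_on S f \<Longrightarrow> continuous_on S (\<lambda>x. wave k (f x))"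
  unfolding wave_def cis_conv_exp by (intro continuous_intros)

lemma wave_measurable [measurable]: "wave k \<in> borel_measurable lebesgue"
  using continuous_on_wave[OF continuous_on_id, of UNIV k]
  by (intro measurable_completion) (simp add: borel_measurable_continuous_onI)

lemma inner_wavevec_Ints: "wavevec k \<bullet> wavevec m \<in> \<int>"
  by (auto simp: inner_vec_def intro!: Ints_sum Ints_mult)

lemma periodic_inner_wavevec:
  assumes "\<And>t n. g (t + 2 * pi * of_int n) = g t"
  shows "periodic (\<lambda>x. g (wavevec k \<bullet> x))"
  unfolding periodic_def
proof (intro allI)
  fix x m
  obtain n where "wavevec k \<bullet> wavevec m = of_int n"
    using inner_wavevec_Ints Ints_cases by metis
  then show "g (wavevec k \<bullet> (x + (2 * pi) *\<^sub>R wavevec m)) = g (wavevec k \<bullet> x)"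
    using assms[of "wavevec k \<bullet> x" n] by (simp add: inner_add_right mult.commute mult.left_commute)
qed

lemma periodic_wave: "periodic (wave k)"
  unfolding wave_def
  by (rule periodic_inner_wavevec) (simp add: cis_mult[symmetric] cis_multiple_2pi)

lemma
  shows sin_periodic_int: "sin (t + 2 * pi * of_int n) = sin t"
    and cos_periodic_int: "cos (t + 2 * pi * of_int n) = cos (t::real)"
  by (simp_all add: sin_add cos_add)

lemma test_function_cos:
  "test_function (\<lambda>x. cos (wavevec k \<bullet> x)) (\<lambda>x. - sin (wavevec k \<bullet> x) *\<^sub>R wavevec k)"
  unfolding test_function_def gderiv_def
  by (auto intro!: periodic_inner_wavevec[of cos] derivative_eq_intros continuous_intros cos_periodic_int
           simp: inner_commute[of _ "wavevec k"])

lemma test_function_sin: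
  "test_function (\<lambda>x. sin (wavevec k \<bullet> x)) (\<lambda>x. cos (wavevec k \<bullet> x) *\<^sub>R wavevec k)"
  unfolding test_function_def gderiv_def
  by (auto intro!: periodic_inner_wavevec[of sin] derivative_eq_intros continuous_intros sin_periodic_int
           simp: inner_commute[of _ "wavevec k"])

lemma Omega_sets [measurable, simp]: "Omega \<in> sets lebesgue" and compact_Omega: "compact Omega"
  by (simp_all add: Omega_def compact_cbox)

lemma emeasure_Omega: "emeasure lebesgue Omega = ennreal ((2 * pi) ^ 3)"
proof -
  have "measure lborel (cbox 0 (\<chi> i. 2 * pi) :: (real^3) set) = (2 * pi) ^ 3"
    using content_cbox_cart[of "0::real^3" "\<chi> i. 2 * pi"] mem_box_cart(2)[of "0::real^3" 0 "\<chi> i. 2 * pi"]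
    by auto
  then show ?thesis
    by (simp add: Omega_def emeasure_eq_measure2)
qed

lemma finite_measure_torus: "finite_measure torus"
  by (rule finite_measureI) (simp add: emeasure_restrict_space emeasure_Omega space_restrict_space)

interpretation torus: finite_measure torus
  by (rule finite_measure_torus)

lemma set_integrable_torus:
  fixes f :: "real^3 \<Rightarrow> 'b::euclidean_space"
  shows "set_integrable lebesgue Omega f \<longleftrightarrow> integrable torus f"
  by (simp add: set_integrable_def integrable_restrict_space[of Omega lebesgue])

lemma set_integral_torus:
  fixes f :: "real^3 \<Rightarrow> 'b::euclidean_space"
  shows "(LINT x:Omega|lebesgue. f x) = (LINT x|torus. f x)"
  by (simp add: set_lebesgue_integral_def integral_restrict_space[of Omega lebesgue])

lemma measurable_torus:
  "f \<in> borel_measurable lebesgue \<Longrightarrow> f \<in> borel_measurable torus"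
  by (rule measurable_restrict_space1)

lemma integrable_torus_continuous:
  fixes f :: "real^3 \<Rightarrow> 'b::euclidean_space"
  assumes "continuous_on UNIV f"
  shows "integrable torus f"
  unfolding set_integrable_torus[symmetric]
  unfolding Omega_def
  by (rule absolutely_integrable_continuous) (use assms continuous_on_subset in blast)

lemma integral_torus_continuous:
  fixes f :: "real^3 \<Rightarrow> 'b::euclidean_space"
  assumes "continuous_on UNIV f"
  shows "(LINT x|torus. f x) = integral Omega f"
  unfolding set_integral_torus[symmetric]
  using set_lebesgue_integral_eq_integral(2) integrable_torus_continuous[OF assms]
    set_integrable_torus by blast

lemma integral_torus_gradient:
  assumes "test_function \<psi> D"
  shows "(LINT x|torus. D x \<bullet> v) = 0"
proof -
  have cD: "continuous_on UNIV D" using assms by (simp add: test_function_def)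
  have "(LINT x|torus. D x) $ j = 0" for j
  proof -
    have "(LINT x|torus. D x) $ j = (LINT x|torus. D x $ j)"
      using integral_bounded_linear[OF bounded_linear_vec_nth integrable_torus_continuous[OF cD]] by metis
    also have "\<dots> = 0"
      using integral_gradient_eq_0[OF assms] integral_torus_continuous[of "\<lambda>x. D x $ j"] cD
      by (simp add: continuous_intros)
    finally show ?thesis .
  qed
  then have "(LINT x|torus. D x) = 0" by (simp add: vec_eq_iff)
  then show ?thesis
    using integral_inner_left[of v torus D] integrable_torus_continuous[OF cD] by simp
qed

text \<open>A nonconstant wave is, up to a nonzero factor, a derivative of a wave, so its mean vanishes.\<close>

lemma integral_wave: "(LINT x|torus. wave k x) = (if k = 0 then complex_of_real ((2 * pi) ^ 3) else 0)"
proof (cases "k = 0")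
  case True
  have "measure torus (space torus) = (2 * pi) ^ 3"
    by (simp add: measure_def emeasure_restrict_space emeasure_Omega space_restrict_space)
  then show ?thesis using True by (simp add: scaleR_conv_of_real)
next
  case False
  then have k2: "wavevec k \<bullet> wavevec k \<noteq> 0" by simp
  have "(LINT x|torus. cos (wavevec k \<bullet> x) * (wavevec k \<bullet> wavevec k)) = 0"
       "(LINT x|torus. - sin (wavevec k \<bullet> x) * (wavevec k \<bullet> wavevec k)) = 0"
    using integral_torus_gradient[OF test_function_sin[of k], of "wavevec k"]
          integral_torus_gradient[OF test_function_cos[of k], of "wavevec k"] by simp_all
  then have "(LINT x|torus. cos (wavevec k \<bullet> x)) = 0" "(LINT x|torus. sin (wavevec k \<bullet> x)) = 0"
    using k2 by auto
  moreover have "integrable torus (wave k)"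
    by (intro integrable_torus_continuous) (simp add: continuous_on_wave)
  then have "Re (LINT x|torus. wave k x) = (LINT x|torus. Re (wave k x))"
    "Im (LINT x|torus. wave k x) = (LINT x|torus. Im (wave k x))"
    by simp_all
  ultimately show ?thesis
    using False by (simp only: complex_eq_iff) (simp add: wave_def)
qed

section \<open>Square integrable functions and Bessel's inequality\<close>

lemma L2_perD:
  fixes f :: "real^3 \<Rightarrow> 'b::euclidean_space"
  assumes "f \<in> L2_per"
  shows "periodic f" "f \<in> borel_measurable lebesgue" "f \<in> borel_measurable torus"
    "integrable torus (\<lambda>x. (norm (f x))\<^sup>2)"
proof -
  show "periodic f" using assms unfolding L2_per_def by blast
  show m: "f \<in> borel_measurable lebesgue" using assms unfolding L2_per_def by blast
  show "f \<in> borel_measurable torus" by (rule measurable_torus[OF m])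
  show "integrable torus (\<lambda>x. (norm (f x))\<^sup>2)"
    using assms unfolding L2_per_def set_integrable_torus by blast
qed

lemma continuous_periodic_L2:
  fixes f :: "real^3 \<Rightarrow> 'b::euclidean_space"
  assumes "continuous_on UNIV f" "periodic f"
  shows "f \<in> L2_per"
  unfolding L2_per_def set_integrable_torus using assms
  by (auto intro!: integrable_torus_continuous continuous_intros measurable_completion
        borel_measurable_continuous_onI)

text \<open>Instantiated with multiplication, scaling and the inner product.\<close>

lemma L2_bilinear_integrable:
  fixes f :: "real^3 \<Rightarrow> 'a::euclidean_space" and g :: "real^3 \<Rightarrow> 'b::euclidean_space"
    and prod :: "'a \<Rightarrow> 'b \<Rightarrow> 'c::euclidean_space"
  assumes "bounded_bilinear prod" "f \<in> L2_per" "g \<in> L2_per"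
  shows "integrable torus (\<lambda>x. prod (f x) (g x))"
proof -
  interpret bounded_bilinear prod by fact
  obtain K where K: "K > 0" "\<And>a b. norm (prod a b) \<le> norm a * norm b * K"
    using pos_bounded by blast
  note f = L2_perD[OF assms(2)] and g = L2_perD[OF assms(3)]
  show ?thesis
  proof (rule Bochner_Integration.integrable_bound)
    show "integrable torus (\<lambda>x. K * ((norm (f x))\<^sup>2 + (norm (g x))\<^sup>2))"
      by (intro Bochner_Integration.integrable_mult_right Bochner_Integration.integrable_add f g)
    have "continuous_on UNIV (\<lambda>x. prod (fst x) (snd x))"
      by (intro continuous_on continuous_intros)
    then show "(\<lambda>x. prod (f x) (g x)) \<in> borel_measurable torus"
      by (rule borel_measurable_continuous_Pair[OF f(3) g(3)])
    have "norm (prod (f x) (g x)) \<le> K * ((norm (f x))\<^sup>2 + (norm (g x))\<^sup>2)" for x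
    proof -
      have "0 \<le> norm (f x) * norm (g x)" by simp
      then have "norm (f x) * norm (g x) \<le> (norm (f x))\<^sup>2 + (norm (g x))\<^sup>2"
        using sum_squares_bound[of "norm (f x)" "norm (g x)"] by linarith
      then have "K * (norm (f x) * norm (g x)) \<le> K * ((norm (f x))\<^sup>2 + (norm (g x))\<^sup>2)"
        using K(1) by (intro mult_left_mono) auto
      then show ?thesis using K(2)[of "f x" "g x"] by (simp add: mult_ac)
    qed
    then show "AE x in torus. norm (prod (f x) (g x)) \<le> norm (K * ((norm (f x))\<^sup>2 + (norm (g x))\<^sup>2))"
      by (intro AE_I2) (metis abs_ge_self order_trans real_norm_def)
  qed
qed

lemma L2_per_const: "(\<lambda>_. c :: 'b::euclidean_space) \<in> L2_per"
  by (rule continuous_periodic_L2) (auto simp: periodic_def)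

lemma L2_integrable:
  fixes f :: "real^3 \<Rightarrow> 'b::euclidean_space"
  shows "f \<in> L2_per \<Longrightarrow> integrable torus f"
  using L2_bilinear_integrable[OF bounded_bilinear_scaleR L2_per_const[of "1::real"]] by simp

lemma L2_bounded_linear:
  fixes f :: "real^3 \<Rightarrow> 'b::euclidean_space" and T :: "'b \<Rightarrow> 'c::euclidean_space"
  assumes "f \<in> L2_per" "bounded_linear T"
  shows "(\<lambda>x. T (f x)) \<in> L2_per"
proof -
  note f = L2_perD[OF assms(1)]
  obtain K where K: "K > 0" "\<And>a. norm (T a) \<le> norm a * K"
    using bounded_linear.pos_bounded[OF assms(2)] by blast
  have T: "T \<in> borel_measurable borel"
    using assms(2) by (intro borel_measurable_continuous_onI linear_continuous_on)
  have m: "(\<lambda>x. T (f x)) \<in> borel_measurable lebesgue"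
    using measurable_compose[OF f(2) T] .
  have "integrable torus (\<lambda>x. (norm (T (f x)))\<^sup>2)"
  proof (rule Bochner_Integration.integrable_bound)
    show "integrable torus (\<lambda>x. K\<^sup>2 * (norm (f x))\<^sup>2)" by (intro integrable_mult_right f)
    show "(\<lambda>x. (norm (T (f x)))\<^sup>2) \<in> borel_measurable torus"
      using measurable_torus[OF m] by measurable
    show "AE x in torus. norm ((norm (T (f x)))\<^sup>2) \<le> norm (K\<^sup>2 * (norm (f x))\<^sup>2)"
      using K(2) by (auto simp flip: power_mult_distrib simp: mult.commute intro!: power_mono)
  qed
  moreover have "periodic (\<lambda>x. T (f x))" using f(1) by (simp add: periodic_def)
  ultimately show ?thesis using m by (simp add: L2_per_def set_integrable_torus)
qed

lemma L2_diff:
  fixes f g :: "real^3 \<Rightarrow> 'b::euclidean_space"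
  assumes "f \<in> L2_per" "g \<in> L2_per"
  shows "(\<lambda>x. f x - g x) \<in> L2_per"
proof -
  note f = L2_perD[OF assms(1)] and g = L2_perD[OF assms(2)]
  have "integrable torus (\<lambda>x. (norm (f x - g x))\<^sup>2)"
  proof (rule Bochner_Integration.integrable_bound)
    show "integrable torus (\<lambda>x. 2 * (norm (f x))\<^sup>2 + 2 * (norm (g x))\<^sup>2)"
      by (intro Bochner_Integration.integrable_mult_right Bochner_Integration.integrable_add f g)
    show "(\<lambda>x. (norm (f x - g x))\<^sup>2) \<in> borel_measurable torus" using f(3) g(3) by measurable
    have "(norm (f x - g x))\<^sup>2 \<le> 2 * (norm (f x))\<^sup>2 + 2 * (norm (g x))\<^sup>2" for x
    proof -
      have "(norm (f x - g x))\<^sup>2 \<le> (norm (f x) + norm (g x))\<^sup>2"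
        by (intro power_mono norm_triangle_ineq4) auto
      also have "\<dots> \<le> 2 * (norm (f x))\<^sup>2 + 2 * (norm (g x))\<^sup>2"
        using sum_squares_bound[of "norm (f x)" "norm (g x)"] by (simp add: power2_sum)
      finally show ?thesis .
    qed
    then show "AE x in torus. norm ((norm (f x - g x))\<^sup>2) \<le> norm (2 * (norm (f x))\<^sup>2 + 2 * (norm (g x))\<^sup>2)"
      by auto
  qed
  then show ?thesis using f g by (simp add: L2_per_def set_integrable_torus periodic_def)
qed

lemma bounded_linear_complex_nth: "bounded_linear (\<lambda>v::real^3. complex_of_real (v $ j))"
  using bounded_linear_compose[OF bounded_linear_of_real bounded_linear_vec_nth] .

lemma fourier_coeff_nth:
  "fourier_coeff f k $ j = fcoeff (\<lambda>x. complex_of_real (f x $ j)) k"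
proof -
  have "exp (- \<i> * complex_of_real (wavevec k \<bullet> x)) = wave (- k) x" for x
    by (simp add: wave_def cis_conv_exp)
  then show ?thesis by (simp add: fourier_coeff_def fcoeff_def set_integral_torus)
qed

lemma wave_L2: "wave k \<in> L2_per"
  by (intro continuous_periodic_L2 periodic_wave) (simp add: continuous_on_wave)

lemma integrable_wave_times:
  assumes "integrable torus g"
  shows "integrable torus (\<lambda>x. wave k x * g x)"
  by (rule Bochner_Integration.integrable_bound[OF assms])
     (use assms in \<open>auto simp: norm_mult intro!: borel_measurable_times measurable_torus[OF wave_measurable]\<close>)

text \<open>The usual expansion of the squared distance of \<open>g\<close> to its partial Fourier sum \<open>S\<close>.\<close>

lemma bessel_inequality:
  assumes g: "g \<in> L2_per" and F: "finite F"
  shows "(\<Sum>k\<in>F. (norm (fcoeff g k))\<^sup>2) \<le> (LINT x|torus. (norm (g x))\<^sup>2) / (2 * pi) ^ 3"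
proof -
  define c where "c = fcoeff g"
  define V where "V = (2 * pi) ^ 3"
  have V: "V > 0" by (simp add: V_def)
  define S where "S x = (\<Sum>k\<in>F. c k * wave k x)" for x
  have ig: "integrable torus g" and ig2: "integrable torus (\<lambda>x. (norm (g x))\<^sup>2)"
    by (fact L2_integrable[OF g], fact L2_perD(4)[OF g])
  have icg: "integrable torus (\<lambda>x. cnj (g x))" using ig by simp
  have cg: "(LINT x|torus. wave (- k) x * g x) = V * c k" for k
    unfolding c_def fcoeff_def V_def[symmetric] using V by simp
  have cg': "(LINT x|torus. wave k x * cnj (g x)) = V * cnj (c k)" for k
  proof -
    have "(LINT x|torus. wave k x * cnj (g x)) = (LINT x|torus. cnj (wave (- k) x * g x))"
      unfolding complex_cnj_mult cnj_wave by simp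
    also have "\<dots> = cnj (V * c k)" by (subst integral_bounded_linear[OF bounded_linear_cnj integrable_wave_times[OF ig]])
         (simp only: cg)
    finally show ?thesis by simp
  qed
  have expand: "complex_of_real ((norm (g x - S x))\<^sup>2) = complex_of_real ((norm (g x))\<^sup>2)
      - (\<Sum>k\<in>F. cnj (c k) * (wave (- k) x * g x)) - (\<Sum>k\<in>F. c k * (wave k x * cnj (g x)))
      + (\<Sum>k\<in>F. \<Sum>l\<in>F. c k * cnj (c l) * wave (k - l) x)" for x
  proof -
    have "complex_of_real ((norm (g x - S x))\<^sup>2) = (g x - S x) * (cnj (g x) - cnj (S x))"
      by (simp only: complex_norm_square complex_cnj_diff)
    also have "\<dots> = g x * cnj (g x) - cnj (S x) * g x - S x * cnj (g x) + S x * cnj (S x)"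
      by (simp add: algebra_simps)
    also have "cnj (S x) = (\<Sum>k\<in>F. cnj (c k) * wave (- k) x)"
      by (simp add: S_def cnj_wave)
    also have "S x * (\<Sum>k\<in>F. cnj (c k) * wave (- k) x)
        = (\<Sum>k\<in>F. \<Sum>l\<in>F. c k * cnj (c l) * wave (k - l) x)"
      unfolding S_def sum_product wave_diff by (simp only: mult_ac)
    finally show ?thesis
      unfolding S_def sum_distrib_right mult.assoc complex_norm_square .
  qed
  have iw: "integrable torus (wave k)" for k by (rule L2_integrable[OF wave_L2])
  define A where "A x = complex_of_real ((norm (g x))\<^sup>2)" for x
  define B1 where "B1 x = (\<Sum>k\<in>F. cnj (c k) * (wave (- k) x * g x))" for x
  define B2 where "B2 x = (\<Sum>k\<in>F. c k * (wave k x * cnj (g x)))" for x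
  define B3 where "B3 x = (\<Sum>k\<in>F. \<Sum>l\<in>F. c k * cnj (c l) * wave (k - l) x)" for x
  have int: "integrable torus A" "integrable torus B1" "integrable torus B2" "integrable torus B3"
    unfolding A_def[abs_def] B1_def[abs_def] B2_def[abs_def] B3_def[abs_def]
    by (intro integrable_of_real ig2 Bochner_Integration.integrable_sum
        Bochner_Integration.integrable_mult_right integrable_wave_times ig icg iw)+
  have B1: "(LINT x|torus. B1 x) = (\<Sum>k\<in>F. cnj (c k) * (V * c k))"
    unfolding B1_def by (subst Bochner_Integration.integral_sum)
      (auto simp: cg intro!: Bochner_Integration.integrable_mult_right integrable_wave_times ig)
  have B2: "(LINT x|torus. B2 x) = (\<Sum>k\<in>F. c k * (V * cnj (c k)))"
    unfolding B2_def by (subst Bochner_Integration.integral_sum)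
      (auto simp: cg' intro!: Bochner_Integration.integrable_mult_right integrable_wave_times icg)
  have w: "(LINT x|torus. wave (k - l) x) = (if k = l then V else 0)" for k l
    unfolding integral_wave V_def by auto
  have B3: "(LINT x|torus. B3 x) = (\<Sum>k\<in>F. \<Sum>l\<in>F. c k * cnj (c l) * (if k = l then V else 0))"
    unfolding B3_def by (subst Bochner_Integration.integral_sum, intro Bochner_Integration.integrable_sum
        Bochner_Integration.integrable_mult_right iw, subst Bochner_Integration.integral_sum)
      (auto simp: w iw)
  have s1: "(\<Sum>k\<in>F. cnj (c k) * (V * c k)) = (\<Sum>k\<in>F. V * (c k * cnj (c k)))"
    and s2: "(\<Sum>k\<in>F. c k * (V * cnj (c k))) = (\<Sum>k\<in>F. V * (c k * cnj (c k)))"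
    by (simp_all only: mult_ac)
  have "complex_of_real (LINT x|torus. (norm (g x - S x))\<^sup>2)
     = (LINT x|torus. complex_of_real ((norm (g x - S x))\<^sup>2))"
    by (rule integral_complex_of_real[symmetric])
  also have "\<dots> = (LINT x|torus. A x - B1 x - B2 x + B3 x)"
    unfolding expand A_def B1_def B2_def B3_def ..
  also have "\<dots> = (LINT x|torus. A x) - (LINT x|torus. B1 x) - (LINT x|torus. B2 x) + (LINT x|torus. B3 x)"
    using int by (simp only: Bochner_Integration.integral_diff Bochner_Integration.integral_add
         Bochner_Integration.integrable_diff Bochner_Integration.integrable_add)
  also have "(LINT x|torus. A x) = complex_of_real (LINT x|torus. (norm (g x))\<^sup>2)"
    unfolding A_def by (rule integral_complex_of_real)
  also note B1 also note B2 also note B3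
  also have "(\<Sum>k\<in>F. \<Sum>l\<in>F. c k * cnj (c l) * (if k = l then V else 0)) = (\<Sum>k\<in>F. c k * (V * cnj (c k)))"
    using F by (simp add: if_distrib mult_ac cong: if_cong)
  finally have "complex_of_real (LINT x|torus. (norm (g x - S x))\<^sup>2)
     = complex_of_real (LINT x|torus. (norm (g x))\<^sup>2) - (\<Sum>k\<in>F. V * (c k * cnj (c k)))"
    unfolding s1 s2 diff_add_cancel .
  also have "\<dots> = complex_of_real ((LINT x|torus. (norm (g x))\<^sup>2) - V * (\<Sum>k\<in>F. (norm (c k))\<^sup>2))"
    unfolding of_real_mult of_real_sum complex_norm_square sum_distrib_left of_real_diff ..
  finally have "(LINT x|torus. (norm (g x - S x))\<^sup>2) = (LINT x|torus. (norm (g x))\<^sup>2) - V * (\<Sum>k\<in>F. (norm (c k))\<^sup>2)"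
    by (simp only: of_real_eq_iff)
  moreover have "(LINT x|torus. (norm (g x - S x))\<^sup>2) \<ge> 0" by simp
  ultimately have "(\<Sum>k\<in>F. (norm (c k))\<^sup>2) * V \<le> (LINT x|torus. (norm (g x))\<^sup>2)"
    by (simp add: mult.commute)
  then show ?thesis unfolding c_def V_def[symmetric] pos_le_divide_eq[OF V] .
qed

section \<open>Uniqueness of Fourier coefficients\<close>

text \<open>The set where \<open>h\<close> is positive is, up to a null set, a countable union of compact sets, and each
  of these must be null. The open set \<open>U\<close> will be the open period box: on it, points of the torus
  have unique representatives.\<close>

lemma AE_le_0_if_integral_compact_0:
  fixes h :: "real^3 \<Rightarrow> real"
  assumes int: "integrable torus h" and U: "open U" "U \<subseteq> Omega" "Omega - U \<in> null_sets lebesgue"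
    and C0: "\<And>C. compact C \<Longrightarrow> C \<subseteq> U \<Longrightarrow> (LINT x|torus. indicator C x * h x) = 0"
  shows "AE x in torus. h x \<le> 0"
proof -
  define S where "S = {x \<in> Omega. h x > 0} \<inter> U"
  have "{x \<in> space torus. h x > 0} \<in> sets torus" using int by measurable
  then have "{x \<in> Omega. h x > 0} \<in> sets lebesgue"
    by (simp add: space_restrict_space sets_restrict_space_iff)
  moreover have "U \<in> sets lebesgue" using U(1) by (simp add: borel_open sets_completionI_sets)
  ultimately have S: "S \<in> sets lebesgue" by (simp add: S_def)
  obtain C T where CT: "fsigma C" "T \<in> null_sets lebesgue" "C \<union> T = S" "disjnt C T"
    by (rule lebesgue_set_almost_fsigma[OF S])
  obtain K :: "nat \<Rightarrow> (real^3) set" where K: "\<And>n. closed (K n)" "C = (\<Union>n. K n)"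
    using CT(1) by (auto elim!: fsigma.cases)
  have "K n \<in> null_sets lebesgue" for n
  proof -
    have KS: "K n \<subseteq> S" using K CT by auto
    then have KU: "K n \<subseteq> U" "K n \<subseteq> Omega" using U by (auto simp: S_def)
    have cK: "compact (K n)"
      using K(1) KU(2) compact_Omega by (meson bounded_subset compact_eq_bounded_closed)
    have Km: "K n \<in> sets lebesgue" using K(1) by (simp add: borel_closed sets_completionI_sets)
    then have Kt: "K n \<in> sets torus" using KU by (auto simp: sets_restrict_space_iff)
    have "integrable torus (\<lambda>x. indicator (K n) x * h x)"
      using integrable_mult_indicator[OF Kt int] by simp
    moreover have "AE x in torus. 0 \<le> indicator (K n) x * h x"
      using KS by (intro AE_I2) (auto simp: S_def indicator_def)
    ultimately have "AE x in torus. indicator (K n) x * h x = 0"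
      using integral_nonneg_eq_0_iff_AE C0[OF cK KU(1)] by blast
    then have "AE x in torus. x \<notin> K n"
      by eventually_elim (use KS in \<open>auto simp: S_def indicator_def\<close>)
    then have "K n \<in> null_sets torus" using Kt AE_iff_null_sets by blast
    then show ?thesis using KU Km by (auto simp: null_sets_def emeasure_restrict_space Int_absorb2)
  qed
  then have "C \<in> null_sets lebesgue" unfolding K(2) by (rule null_sets_UN)
  then have "S \<in> null_sets lebesgue" using CT by auto
  then have "AE x in lebesgue. x \<notin> S \<and> x \<notin> Omega - U"
    using U(3) by (auto dest: AE_not_in)
  then have "AE x in lebesgue. x \<in> Omega \<longrightarrow> h x \<le> 0"
    by eventually_elim (auto simp: S_def)
  then show ?thesis by (simp add: AE_restrict_space_iff)
qed

text \<open>The quotient map of the torus, realized as a compact subset of \<open>complex^3\<close>. Polynomials in the real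
  and imaginary parts of these coordinates pull back to trigonometric polynomials, which makes the
  Stone-Weierstrass theorem applicable.\<close>

definition torus_point :: "real^3 \<Rightarrow> complex^3" where
  "torus_point x = (\<chi> j. cis (x $ j))"

lemma continuous_torus_point: "continuous_on S torus_point"
proof -
  have "torus_point = (\<lambda>x. \<chi> j. exp (\<i> * complex_of_real (x $ j)))"
    by (simp add: torus_point_def cis_conv_exp fun_eq_iff)
  moreover have "continuous_on S (\<lambda>x::real^3. \<chi> j. exp (\<i> * complex_of_real (x $ j)))"
    by (intro continuous_on_vec_lambda continuous_intros)
  ultimately show ?thesis by (simp only:)
qed

definition orthogonal_to_waves :: "(real^3 \<Rightarrow> complex) \<Rightarrow> bool" where
  "orthogonal_to_waves f \<longleftrightarrow> integrable torus f \<and> (\<forall>k. (LINT x|torus. wave k x * f x) = 0)"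

lemma orthogonal_to_waves_add:
  assumes "orthogonal_to_waves f" "orthogonal_to_waves g"
  shows "orthogonal_to_waves (\<lambda>x. f x + g x)"
proof -
  have i: "integrable torus f" "integrable torus g" using assms by (simp_all add: orthogonal_to_waves_def)
  have "(LINT x|torus. wave k x * (f x + g x)) = 0" for k
    unfolding distrib_left
    by (subst Bochner_Integration.integral_add)
       (use assms integrable_wave_times[OF i(1)] integrable_wave_times[OF i(2)] in
         \<open>simp_all add: orthogonal_to_waves_def\<close>)
  then show ?thesis using i by (simp add: orthogonal_to_waves_def)
qed

lemma orthogonal_to_waves_cmult:
  "orthogonal_to_waves f \<Longrightarrow> orthogonal_to_waves (\<lambda>x. c * f x)"
  by (simp add: orthogonal_to_waves_def mult.left_commute[of _ c])

lemma orthogonal_to_waves_wave: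
  assumes "orthogonal_to_waves f" shows "orthogonal_to_waves (\<lambda>x. wave k x * f x)"
proof -
  have "(LINT x|torus. wave l x * (wave k x * f x)) = (LINT x|torus. wave (l + k) x * f x)" for l
    by (simp only: wave_add mult.assoc)
  then show ?thesis using assms integrable_wave_times by (simp add: orthogonal_to_waves_def)
qed

lemma orthogonal_to_waves_sum:
  assumes "\<And>i. i \<in> I \<Longrightarrow> orthogonal_to_waves (g i)"
  shows "orthogonal_to_waves (\<lambda>x. \<Sum>i\<in>I. g i x)"
  using assms
  by (induction I rule: infinite_finite_induct)
     (auto intro: orthogonal_to_waves_add simp: orthogonal_to_waves_def[of "\<lambda>x. 0"])

lemma linear_on_torus:
  assumes p: "bounded_linear (p :: complex^3 \<Rightarrow> real)"
  obtains c where "\<And>x. complex_of_real (p (torus_point x)) =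
      (\<Sum>j\<in>UNIV. c j * wave (axis j 1) x + cnj (c j) * wave (- axis j 1) x)"
proof -
  interpret bounded_linear p by fact
  \<comment> \<open>the coefficients that turn \<open>p\<close> applied to \<open>cis\<close> in coordinate \<open>j\<close> into \<open>c\<close> times the wave plus
    the conjugate\<close>
  define c where "c j = (p (axis j 1) - \<i> * p (axis j \<i>)) / 2" for j
  have "complex_of_real (p (torus_point x)) =
      (\<Sum>j\<in>UNIV. c j * wave (axis j 1) x + cnj (c j) * wave (- axis j 1) x)" for x
  proof -
    have "torus_point x = (\<Sum>j\<in>UNIV. cos (x $ j) *\<^sub>R axis j 1 + sin (x $ j) *\<^sub>R axis j \<i>)"
      by (simp add: torus_point_def vec_eq_iff axis_def if_distrib[of "scaleR _"] sum.distrib cong: if_cong)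
         (simp add: complex_eq_iff)
    then have "p (torus_point x) = (\<Sum>j\<in>UNIV. cos (x $ j) * p (axis j 1) + sin (x $ j) * p (axis j \<i>))"
      by (simp add: sum add scaleR)
    moreover have "complex_of_real (cos (x $ j) * p (axis j 1) + sin (x $ j) * p (axis j \<i>))
        = c j * wave (axis j 1) x + cnj (c j) * wave (- axis j 1) x" for j
    proof -
      have "wavevec (axis j 1) \<bullet> x = x $ j"
      proof -
        have "wavevec (axis j 1) = axis j 1" by (simp add: vec_eq_iff axis_def)
        then show ?thesis by (simp add: inner_axis')
      qed
      then have "wave (axis j 1) x = Complex (cos (x $ j)) (sin (x $ j))"
        "wave (- axis j 1) x = Complex (cos (x $ j)) (- sin (x $ j))"
        by (simp_all add: wave_def complex_eq_iff)
      then show ?thesis by (simp add: c_def complex_eq_iff field_simps)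
    qed
    ultimately show ?thesis by simp
  qed
  then show ?thesis using that by blast
qed

text \<open>The class of functions orthogonal to all waves is stable under multiplication by waves, hence by
  real linear forms of the torus coordinates. Quantifying over all \<open>f\<close> of the class makes the
  product case of the induction immediate.\<close>

lemma orthogonal_to_waves_polynomial:
  assumes "real_polynomial_function p" "orthogonal_to_waves f"
  shows "orthogonal_to_waves (\<lambda>x. complex_of_real (p (torus_point x)) * f x)"
  using assms
proof (induction arbitrary: f)
  case (linear p)
  obtain c where c: "\<And>x. complex_of_real (p (torus_point x)) =
      (\<Sum>j\<in>UNIV. c j * wave (axis j 1) x + cnj (c j) * wave (- axis j 1) x)"
    using linear_on_torus[OF linear(1)] by blast
  show ?case unfolding c sum_distrib_right distrib_right mult.assoc
    by (intro orthogonal_to_waves_sum orthogonal_to_waves_add orthogonal_to_waves_cmult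
        orthogonal_to_waves_wave linear)
next
  case (const c)
  then show ?case by (rule orthogonal_to_waves_cmult)
next
  case (add p q)
  then show ?case by (simp add: distrib_right orthogonal_to_waves_add)
next
  case (mult p q)
  have "orthogonal_to_waves (\<lambda>x. complex_of_real (p (torus_point x)) * (complex_of_real (q (torus_point x)) * f x))"
    using mult by blast
  then show ?case by (simp add: mult.assoc)
qed

lemma orthogonal_to_waves_continuous:
  assumes f: "orthogonal_to_waves f" and g: "continuous_on UNIV (g :: complex^3 \<Rightarrow> real)"
  shows "integrable torus (\<lambda>x. complex_of_real (g (torus_point x)) * f x)"
    and "(LINT x|torus. complex_of_real (g (torus_point x)) * f x) = 0"
proof -
  have intf: "integrable torus f" using f by (simp add: orthogonal_to_waves_def)
  let ?K = "torus_point ` Omega"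
  have K: "compact ?K" by (intro compact_continuous_image continuous_torus_point compact_Omega)
  have cg: "continuous_on UNIV (\<lambda>x. complex_of_real (g (torus_point x)))"
    by (intro continuous_intros continuous_on_compose2[OF g continuous_torus_point]) auto
  have mg: "(\<lambda>x. complex_of_real (g (torus_point x))) \<in> borel_measurable torus"
    by (rule borel_measurable_integrable[OF integrable_torus_continuous[OF cg]])
  obtain M where M: "\<And>x. x \<in> ?K \<Longrightarrow> \<bar>g x\<bar> \<le> M"
    using compact_imp_bounded[OF compact_continuous_image[OF continuous_on_subset[OF g] K]]
    unfolding bounded_iff by auto
  show int: "integrable torus (\<lambda>x. complex_of_real (g (torus_point x)) * f x)"
  proof (rule Bochner_Integration.integrable_bound)
    show "integrable torus (\<lambda>x. M *\<^sub>R f x)" using intf by (rule integrable_scaleR_right)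
    show "(\<lambda>x. complex_of_real (g (torus_point x)) * f x) \<in> borel_measurable torus"
      using borel_measurable_times[OF mg borel_measurable_integrable[OF intf]] .
    show "AE x in torus. norm (complex_of_real (g (torus_point x)) * f x) \<le> norm (M *\<^sub>R f x)"
    proof (rule AE_I2)
      fix x assume "x \<in> space torus"
      then have "\<bar>g (torus_point x)\<bar> \<le> \<bar>M\<bar>" using M by (fastforce simp: space_restrict_space)
      then show "norm (complex_of_real (g (torus_point x)) * f x) \<le> norm (M *\<^sub>R f x)"
        by (simp add: norm_mult mult_right_mono)
    qed
  qed
  define B where "B = (LINT x|torus. norm (f x))"
  have B0: "B \<ge> 0" by (simp add: B_def)
  let ?I = "LINT x|torus. complex_of_real (g (torus_point x)) * f x"
  have "norm ?I \<le> e * (B + 1)" if e: "e > 0" for e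
  proof -
    obtain p where p: "real_polynomial_function p" "\<And>z. z \<in> ?K \<Longrightarrow> \<bar>g z - p z\<bar> < e"
      using Stone_Weierstrass_real_polynomial_function[OF K continuous_on_subset[OF g subset_UNIV] e] by blast
    have op: "orthogonal_to_waves (\<lambda>x. complex_of_real (p (torus_point x)) * f x)"
      by (rule orthogonal_to_waves_polynomial[OF p(1) f])
    then have ip: "integrable torus (\<lambda>x. complex_of_real (p (torus_point x)) * f x)"
      by (simp add: orthogonal_to_waves_def)
    have "(LINT x|torus. wave 0 x * (complex_of_real (p (torus_point x)) * f x)) = 0"
      using op unfolding orthogonal_to_waves_def by blast
    then have "?I = ?I - (LINT x|torus. complex_of_real (p (torus_point x)) * f x)" by simp
    also have "\<dots> = (LINT x|torus. complex_of_real (g (torus_point x)) * f x - complex_of_real (p (torus_point x)) * f x)"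
      by (rule Bochner_Integration.integral_diff[symmetric, OF int ip])
    also have "norm \<dots> \<le> (LINT x|torus. norm (complex_of_real (g (torus_point x)) * f x - complex_of_real (p (torus_point x)) * f x))"
      by (rule integral_norm_bound)
    also have "\<dots> \<le> (LINT x|torus. e * norm (f x))"
    proof (rule integral_mono)
      fix x assume "x \<in> space torus"
      then have "\<bar>g (torus_point x) - p (torus_point x)\<bar> \<le> e"
        using p(2)[of "torus_point x"] by (force simp: space_restrict_space)
      then have "norm (complex_of_real (g (torus_point x) - p (torus_point x)) * f x) \<le> e * norm (f x)"
        by (simp only: norm_mult norm_of_real mult_right_mono norm_ge_zero)
      then show "norm (complex_of_real (g (torus_point x)) * f x - complex_of_real (p (torus_point x)) * f x) \<le> e * norm (f x)"
        by (simp add: left_diff_distrib)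
    qed (intro integrable_norm Bochner_Integration.integrable_diff int ip integrable_mult_right intf)+
    also have "\<dots> = e * B" by (simp add: B_def)
    also have "\<dots> \<le> e * (B + 1)" using that by simp
    finally show ?thesis .
  qed
  note bound = this
  have "norm ?I \<le> e" if "e > 0" for e
  proof -
    have "norm ?I \<le> e / (B + 1) * (B + 1)" using bound[of "e / (B + 1)"] that B0 by simp
    then show ?thesis using B0 by simp
  qed
  then have "norm ?I \<le> 0" by (rule field_le_epsilon[of _ 0, simplified])
  then show "?I = 0" by simp
qed

lemma torus_point_inj:
  assumes "x \<in> box 0 (\<chi> i. 2 * pi)" "y \<in> box 0 (\<chi> i. 2 * pi)" "torus_point x = torus_point y"
  shows "x = y"
proof -
  have "x $ j = y $ j" for j
  proof -
    have "cis (x $ j) = cis (y $ j)" using assms(3) by (auto simp: torus_point_def vec_eq_iff)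
    then have "cos (x $ j) = cos (y $ j) \<and> sin (x $ j) = sin (y $ j)" by (simp add: complex_eq_iff)
    then obtain n where n: "x $ j = y $ j + 2 * pi * of_int n"
      using sin_cos_eq_iff by metis
    have "0 < x $ j" "x $ j < 2 * pi" "0 < y $ j" "y $ j < 2 * pi"
      using assms by (auto simp: mem_box_cart)
    then have "2 * pi * of_int n < 2 * pi * 1" "2 * pi * (-1) < 2 * pi * of_int n" using n by linarith+
    then have "real_of_int n < 1" "-1 < real_of_int n"
      using mult_less_cancel_left_pos[of "2 * pi" "real_of_int n" 1]
        mult_less_cancel_left_pos[of "2 * pi" "-1" "real_of_int n"] pi_gt_zero by linarith+
    then have "n = 0" by linarith
    then show ?thesis using n by simp
  qed
  then show ?thesis by (simp add: vec_eq_iff)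
qed

text \<open>The indicator of a compact set is the bounded limit of continuous functions of the torus point,
  and \<open>f\<close> is orthogonal to all of these.\<close>

lemma orthogonal_to_waves_compact:
  assumes f: "orthogonal_to_waves f" and C: "compact C" "C \<subseteq> box 0 (\<chi> i. 2 * pi)"
  shows "(LINT x|torus. indicator C x * f x) = 0"
proof (cases "C = {}")
  case False
  let ?U = "box 0 (\<chi> i. 2 * pi) :: (real^3) set"
  have intf: "integrable torus f" using f by (simp add: orthogonal_to_waves_def)
  let ?K = "torus_point ` C"
  have K: "compact ?K" "?K \<noteq> {}"
    using False C by (auto intro: compact_continuous_image continuous_torus_point)
  \<comment> \<open>equal to \<open>1\<close> on \<open>?K\<close> and to \<open>0\<close> at distance more than \<open>1 / n\<close>\<close>
  define g where "g n z = max 0 (1 - real n * infdist z ?K)" for n z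
  have cg: "continuous_on UNIV (g n)" for n
    unfolding g_def by (intro continuous_intros)
  have lim: "(\<lambda>n. g n z) \<longlonglongrightarrow> (if z \<in> ?K then 1 else 0)" for z
  proof (cases "z \<in> ?K")
    case False
    then have d: "infdist z ?K > 0"
      using K compact_imp_closed in_closed_iff_infdist_zero[of ?K z] infdist_nonneg[of z ?K] by force
    obtain N where N: "real N * infdist z ?K > 1" using reals_Archimedean3[OF d] by blast
    have "g n z = 0" if "n \<ge> N" for n
    proof -
      have "real N * infdist z ?K \<le> real n * infdist z ?K" using that d by (simp add: mult_right_mono)
      then show ?thesis using N by (simp add: g_def)
    qed
    then have "\<forall>\<^sub>F n in sequentially. g n z = 0" by (auto simp: eventually_sequentially)
    then show ?thesis using False by (simp add: tendsto_eventually)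
  qed (simp add: g_def)
  have g01: "0 \<le> g n z" "g n z \<le> 1" for n z
    by (auto simp: g_def infdist_nonneg)
  have box: "AE x in torus. x \<in> ?U"
  proof -
    have "negligible (Omega - ?U)"
      using negligible_frontier_interval[of 0 "\<chi> i. 2 * pi :: real^3"] by (simp add: Omega_def)
    then have "AE x in lebesgue. x \<notin> Omega - ?U"
      by (intro AE_not_in) (simp add: negligible_iff_null_sets)
    then have "AE x in lebesgue. x \<in> Omega \<longrightarrow> x \<in> ?U" by eventually_elim auto
    then show ?thesis by (simp add: AE_restrict_space_iff)
  qed
  have "(\<lambda>n. LINT x|torus. complex_of_real (g n (torus_point x)) * f x) \<longlonglongrightarrow> (LINT x|torus. indicator C x * f x)"
  proof (rule integral_dominated_convergence[where w = "\<lambda>x. norm (f x)"])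
    have Cm: "C \<in> sets torus"
      using C compact_imp_closed[OF C(1)] box_subset_cbox
      by (subst sets_restrict_space_iff) (auto simp: Omega_def borel_closed sets_completionI_sets)
    show "(\<lambda>x. indicator C x * f x) \<in> borel_measurable torus"
      using Cm intf by measurable
    show "(\<lambda>x. complex_of_real (g n (torus_point x)) * f x) \<in> borel_measurable torus" for n
      using orthogonal_to_waves_continuous(1)[OF f cg] by (rule borel_measurable_integrable)
    show "integrable torus (\<lambda>x. norm (f x))" using intf by simp
    show "AE x in torus. (\<lambda>n. complex_of_real (g n (torus_point x)) * f x) \<longlonglongrightarrow> indicator C x * f x"
      using box
    proof eventually_elim
      case (elim x)
      have "torus_point x \<in> ?K \<longleftrightarrow> x \<in> C" using torus_point_inj elim C(2) by blast
      then have "complex_of_real (if torus_point x \<in> ?K then 1 else 0) = indicator C x" by simp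
      then show ?case
        using tendsto_mult[OF tendsto_of_real[OF lim[of "torus_point x"], where 'a = complex] tendsto_const[of "f x"]] by simp
    qed
    show "AE x in torus. norm (complex_of_real (g n (torus_point x)) * f x) \<le> norm (f x)" for n
      using g01 by (intro AE_I2) (simp add: norm_mult mult_left_le_one_le)
  qed
  then have "(\<lambda>n. 0::complex) \<longlonglongrightarrow> (LINT x|torus. indicator C x * f x)"
    unfolding orthogonal_to_waves_continuous(2)[OF f cg] .
  then show ?thesis using LIMSEQ_unique tendsto_const by blast
qed simp

text \<open>A function orthogonal to all waves has vanishing integral over every compact subset of the open
  period box; applying this to its real and imaginary parts and their negatives gives the claim.\<close>

theorem fourier_uniqueness:
  assumes int: "integrable torus f" and 0: "\<And>k. fcoeff f k = 0"
  shows "AE x in torus. f x = 0"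
proof -
  let ?U = "box 0 (\<chi> i. 2 * pi) :: (real^3) set"
  have f: "orthogonal_to_waves f"
    unfolding orthogonal_to_waves_def
  proof (intro conjI allI int)
    fix k
    show "(LINT x|torus. wave k x * f x) = 0"
      using 0[of "- k"] by (simp add: fcoeff_def)
  qed
  have U: "open ?U" "?U \<subseteq> Omega" "Omega - ?U \<in> null_sets lebesgue"
    using box_subset_cbox negligible_frontier_interval[of 0 "\<chi> i. 2 * pi :: real^3"]
    by (auto simp: Omega_def open_box negligible_iff_null_sets)
  have *: "AE x in torus. T (f x) \<le> 0" if T: "bounded_linear T" for T :: "complex \<Rightarrow> real"
  proof (rule AE_le_0_if_integral_compact_0[OF _ U])
    show "integrable torus (\<lambda>x. T (f x))" by (rule integrable_bounded_linear[OF T int])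
    fix C assume C: "compact C" "C \<subseteq> ?U"
    have Cm: "C \<in> sets torus"
      using C compact_imp_closed[OF C(1)] box_subset_cbox
      by (subst sets_restrict_space_iff) (auto simp: Omega_def borel_closed sets_completionI_sets)
    have i: "integrable torus (\<lambda>x. indicator C x *\<^sub>R f x)" by (rule integrable_mult_indicator[OF Cm int])
    have "(LINT x|torus. indicator C x * T (f x)) = (LINT x|torus. T (indicator C x *\<^sub>R f x))"
      by (simp add: linear_cmul[OF bounded_linear.linear[OF T]])
    also have "\<dots> = T (LINT x|torus. indicator C x *\<^sub>R f x)"
      by (rule integral_bounded_linear[OF T i])
    also have "(LINT x|torus. indicator C x *\<^sub>R f x) = (LINT x|torus. indicator C x * f x)"
      by (intro Bochner_Integration.integral_cong) (auto simp: indicator_def)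
    also have "\<dots> = 0" by (rule orthogonal_to_waves_compact[OF f C])
    finally show "(LINT x|torus. indicator C x * T (f x)) = 0"
      by (simp add: linear_0[OF bounded_linear.linear[OF T]])
  qed
  have "AE x in torus. Re (f x) \<le> 0" "AE x in torus. - Re (f x) \<le> 0"
    "AE x in torus. Im (f x) \<le> 0" "AE x in torus. - Im (f x) \<le> 0"
    by (intro *  bounded_linear_Re bounded_linear_Im bounded_linear_minus)+
  then show ?thesis
    by eventually_elim (simp add: complex_eq_iff)
qed

section \<open>Fourier coefficients of vector fields\<close>

text \<open>The complex bilinear pairing with a real vector, without conjugation, so that it is also complex
  linear in \<open>z\<close> and \<open>cdot (wavevec k)\<close> extends the phase \<open>k \<bullet> x\<close> to complex \<open>x\<close>.\<close>

definition cdot :: "real^3 \<Rightarrow> complex^3 \<Rightarrow> complex" where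
  "cdot v z = (\<Sum>j\<in>UNIV. complex_of_real (v $ j) * z $ j)"

lemma cdot_linear:
  "cdot (v + w) z = cdot v z + cdot w z" "cdot (v - w) z = cdot v z - cdot w z"
  "cdot (- v) z = - cdot v z" "cdot (r *\<^sub>R v) z = complex_of_real r * cdot v z" "cdot 0 z = 0"
  "cdot v (y + z) = cdot v y + cdot v z" "cdot v (y - z) = cdot v y - cdot v z"
  "cdot v (r *\<^sub>R z) = complex_of_real r * cdot v z" "cdot v 0 = 0"
  by (simp_all add: cdot_def sum.distrib sum_subtractf sum_negf algebra_simps sum_distrib_left
      scaleR_conv_of_real[where 'a = complex])

lemma cdot_axis [simp]: "cdot (axis j 1) z = z $ j"
proof -
  have "complex_of_real (axis j 1 $ i) * z $ i = (if i = j then z $ i else 0)" for i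
    by (simp add: axis_def)
  then show ?thesis by (simp add: cdot_def)
qed

lemma norm_cdot_le: "norm (cdot v z) \<le> norm v * norm z"
proof -
  have "norm (cdot v z) \<le> (\<Sum>j\<in>UNIV. norm (v $ j) * norm (z $ j))"
    unfolding cdot_def by (rule order_trans[OF norm_sum]) (simp add: norm_mult)
  also have "\<dots> = (\<chi> j. norm (v $ j)) \<bullet> (\<chi> j. norm (z $ j))" by (simp add: inner_vec_def)
  also have "\<dots> \<le> norm (\<chi> j. norm (v $ j)) * norm (\<chi> j. norm (z $ j))" by (rule norm_cauchy_schwarz)
  also have "\<dots> = norm v * norm z" by (simp add: norm_vec_def)
  finally show ?thesis .
qed

lemma integrable_cos_sin:
  fixes g :: "real^3 \<Rightarrow> real"
  assumes "integrable torus g"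
  shows "integrable torus (\<lambda>x. cos (wavevec k \<bullet> x) * g x)"
    and "integrable torus (\<lambda>x. sin (wavevec k \<bullet> x) * g x)"
proof -
  have i: "integrable torus (\<lambda>x. wave k x * complex_of_real (g x))"
    by (rule integrable_wave_times) (use assms in \<open>simp add: integrable_of_real\<close>)
  show "integrable torus (\<lambda>x. cos (wavevec k \<bullet> x) * g x)"
    using integrable_Re[OF i] by (simp add: wave_def)
  show "integrable torus (\<lambda>x. sin (wavevec k \<bullet> x) * g x)"
    using integrable_Im[OF i] by (simp add: wave_def)
qed

lemma fcoeff_real:
  fixes g :: "real^3 \<Rightarrow> real"
  assumes "integrable torus g"
  shows "(LINT x|torus. cos (wavevec k \<bullet> x) * g x) = (2 * pi) ^ 3 * Re (fcoeff (\<lambda>x. complex_of_real (g x)) k)"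
    and "(LINT x|torus. sin (wavevec k \<bullet> x) * g x) = - ((2 * pi) ^ 3) * Im (fcoeff (\<lambda>x. complex_of_real (g x)) k)"
proof -
  define V :: real where "V = (2 * pi) ^ 3"
  have V: "V > 0" by (simp add: V_def)
  have i: "integrable torus (\<lambda>x. wave (- k) x * complex_of_real (g x))"
    by (rule integrable_wave_times) (use assms in \<open>simp add: integrable_of_real\<close>)
  have e: "complex_of_real V * fcoeff (\<lambda>x. complex_of_real (g x)) k = (LINT x|torus. wave (- k) x * complex_of_real (g x))"
    unfolding fcoeff_def V_def[symmetric] using V by simp
  have "V * Re (fcoeff (\<lambda>x. complex_of_real (g x)) k) = Re (LINT x|torus. wave (- k) x * complex_of_real (g x))"
    unfolding e[symmetric] by simp
  also have "\<dots> = (LINT x|torus. Re (wave (- k) x * complex_of_real (g x)))"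
    by (rule integral_Re[OF i, symmetric])
  finally show "(LINT x|torus. cos (wavevec k \<bullet> x) * g x) = (2 * pi) ^ 3 * Re (fcoeff (\<lambda>x. complex_of_real (g x)) k)"
    unfolding V_def[symmetric] by (simp add: wave_def)
  have "V * Im (fcoeff (\<lambda>x. complex_of_real (g x)) k) = Im (LINT x|torus. wave (- k) x * complex_of_real (g x))"
    unfolding e[symmetric] by simp
  also have "\<dots> = (LINT x|torus. Im (wave (- k) x * complex_of_real (g x)))"
    by (rule integral_Im[OF i, symmetric])
  finally show "(LINT x|torus. sin (wavevec k \<bullet> x) * g x) = - ((2 * pi) ^ 3) * Im (fcoeff (\<lambda>x. complex_of_real (g x)) k)"
    unfolding V_def[symmetric] by (simp add: wave_def)
qed

lemma fcoeff_add:
  assumes "integrable torus f" "integrable torus g"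
  shows "fcoeff (\<lambda>x. f x + g x) k = fcoeff f k + fcoeff g k"
  unfolding fcoeff_def distrib_left
  by (subst Bochner_Integration.integral_add[OF integrable_wave_times[OF assms(1)] integrable_wave_times[OF assms(2)]])
     (simp only: distrib_left)

lemma fcoeff_diff:
  assumes "integrable torus f" "integrable torus g"
  shows "fcoeff (\<lambda>x. f x - g x) k = fcoeff f k - fcoeff g k"
  unfolding fcoeff_def right_diff_distrib
  by (subst Bochner_Integration.integral_diff[OF integrable_wave_times[OF assms(1)] integrable_wave_times[OF assms(2)]])
     (simp only: right_diff_distrib)

lemma fcoeff_cmult: "fcoeff (\<lambda>x. c * f x) k = c * fcoeff f k"
  by (simp add: fcoeff_def mult.left_commute[of _ c])

lemma fcoeff_sum:
  assumes "\<And>i. i \<in> I \<Longrightarrow> integrable torus (f i)"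
  shows "fcoeff (\<lambda>x. \<Sum>i\<in>I. f i x) k = (\<Sum>i\<in>I. fcoeff (f i) k)"
  using assms
  by (induction I rule: infinite_finite_induct)
     (simp_all add: fcoeff_add Bochner_Integration.integrable_sum fcoeff_def[of "\<lambda>x. 0"])

lemma fcoeff_wave: "fcoeff (wave l) k = (if k = l then 1 else 0)"
proof -
  have "(LINT x|torus. wave (- k) x * wave l x) = (LINT x|torus. wave (l - k) x)"
    by (simp only: wave_diff mult.commute)
  then show ?thesis by (simp add: fcoeff_def integral_wave)
qed

lemma L2_component:
  "f \<in> L2_per \<Longrightarrow> (\<lambda>x. complex_of_real ((f x :: real^3) $ j)) \<in> L2_per"
  by (rule L2_bounded_linear[OF _ bounded_linear_complex_nth])

lemma L2_inner_right: "f \<in> L2_per \<Longrightarrow> (\<lambda>x. (f x :: real^3) \<bullet> v) \<in> L2_per"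
  by (rule L2_bounded_linear[OF _ bounded_linear_inner_left])

lemma fcoeff_inner:
  assumes "f \<in> L2_per"
  shows "fcoeff (\<lambda>x. complex_of_real (f x \<bullet> v)) k = cdot v (fourier_coeff f k)"
proof -
  have "fcoeff (\<lambda>x. complex_of_real (f x \<bullet> v)) k
      = fcoeff (\<lambda>x. \<Sum>j\<in>UNIV. complex_of_real (v $ j) * complex_of_real (f x $ j)) k"
    by (simp add: inner_vec_def mult.commute)
  also have "\<dots> = cdot v (fourier_coeff f k)"
    using L2_integrable[OF L2_component[OF assms]]
    by (subst fcoeff_sum) (auto simp: fcoeff_cmult cdot_def fourier_coeff_nth simp del: of_real_mult)
  finally show ?thesis .
qed

lemma L2_inner_torus: "L2_inner f g = (LINT x|torus. f x \<bullet> g x)"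
  by (simp add: L2_inner_def set_integral_torus)

lemma L2_inner_mode:
  assumes "f \<in> L2_per"
  shows "L2_inner f (\<lambda>x. cos (wavevec k \<bullet> x) *\<^sub>R v) = (2 * pi) ^ 3 * Re (cdot v (fourier_coeff f k))"
    and "L2_inner f (\<lambda>x. sin (wavevec k \<bullet> x) *\<^sub>R v) = - ((2 * pi) ^ 3) * Im (cdot v (fourier_coeff f k))"
  using fcoeff_real[OF L2_integrable[OF L2_inner_right[OF assms, of v]], of k]
  by (simp_all add: L2_inner_torus fcoeff_inner[OF assms])

lemma H_L2: "f \<in> H \<Longrightarrow> f \<in> L2_per" by (simp add: H_def)

lemma fourier_coeff_div_free:
  assumes "f \<in> H"
  shows "cdot (wavevec k) (fourier_coeff f k) = 0"
proof -
  note L2 = H_L2[OF assms]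
  note i = L2_integrable[OF L2_inner_right[OF L2, of "wavevec k"]]
  have w: "(LINT x|torus. f x \<bullet> D x) = 0" if "test_function \<psi> D" for \<psi> D
    using assms that by (auto simp: H_def weak_div_free_def set_integral_torus)
  have "(LINT x|torus. cos (wavevec k \<bullet> x) * (f x \<bullet> wavevec k)) = 0"
    "(LINT x|torus. sin (wavevec k \<bullet> x) * (f x \<bullet> wavevec k)) = 0"
    using w[OF test_function_sin[of k]] w[OF test_function_cos[of k]] by simp_all
  then show ?thesis
    unfolding fcoeff_real[OF i] fcoeff_inner[OF L2] by (simp add: complex_eq_iff)
qed

lemma fourier_coeff_0:
  assumes "f \<in> H"
  shows "fourier_coeff f 0 = 0"
proof -
  note L2 = H_L2[OF assms]
  have m: "(LINT x|torus. f x) = 0"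
    using assms by (simp add: H_def set_integral_torus)
  have "fourier_coeff f 0 $ j = 0" for j
  proof -
    have "(LINT x|torus. complex_of_real (f x $ j)) = complex_of_real ((LINT x|torus. f x) $ j)"
      by (rule integral_bounded_linear[OF bounded_linear_complex_nth L2_integrable[OF L2]])
    then show ?thesis unfolding fourier_coeff_nth fcoeff_def by (simp add: m)
  qed
  then show ?thesis by (simp add: vec_eq_iff)
qed

lemma fcoeff_uminus_real: "fcoeff (\<lambda>x. complex_of_real (g x)) (- k) = cnj (fcoeff (\<lambda>x. complex_of_real (g x)) k)"
proof (cases "integrable torus g")
  case True
  have i: "integrable torus (\<lambda>x. wave (- k) x * complex_of_real (g x))"
    by (rule integrable_wave_times) (use True in \<open>simp add: integrable_of_real\<close>)
  have "cnj (LINT x|torus. wave (- k) x * complex_of_real (g x))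
      = (LINT x|torus. cnj (wave (- k) x * complex_of_real (g x)))"
    by (rule integral_bounded_linear[OF bounded_linear_cnj i, symmetric])
  then show ?thesis by (simp add: fcoeff_def cnj_wave)
next
  case False
  have "\<not> integrable torus (\<lambda>x. wave k x * complex_of_real (g x))" for k
  proof
    assume "integrable torus (\<lambda>x. wave k x * complex_of_real (g x))"
    from integrable_wave_times[OF this, of "- k"]
    have "integrable torus (\<lambda>x. complex_of_real (g x))"
      by (simp add: mult.assoc[symmetric] wave_add[symmetric])
    then show False using False integrable_Re by fastforce
  qed
  then show ?thesis by (simp add: fcoeff_def not_integrable_integral_eq)
qed

lemma fourier_coeff_uminus: "fourier_coeff f (- k) $ j = cnj (fourier_coeff f k $ j)"
  by (simp add: fourier_coeff_nth fcoeff_uminus_real)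

lemma bessel_vector:
  assumes f: "f \<in> L2_per" and F: "finite F"
  shows "(\<Sum>k\<in>F. (norm (fourier_coeff f k))\<^sup>2) \<le> (L2_norm f)\<^sup>2 / (2 * pi) ^ 3"
proof -
  have n: "(norm z)\<^sup>2 = (\<Sum>j\<in>UNIV. (norm (z $ j))\<^sup>2)" for z :: "'a::real_normed_vector ^ 3"
    by (simp add: norm_vec_def L2_set_def sum_nonneg)
  have "(\<Sum>k\<in>F. (norm (fourier_coeff f k))\<^sup>2)
      = (\<Sum>j\<in>UNIV. \<Sum>k\<in>F. (norm (fcoeff (\<lambda>x. complex_of_real (f x $ j)) k))\<^sup>2)"
    unfolding n fourier_coeff_nth by (rule sum.swap)
  also have "\<dots> \<le> (\<Sum>j\<in>UNIV. (LINT x|torus. (norm (complex_of_real (f x $ j)))\<^sup>2) / (2 * pi) ^ 3)"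
    by (intro sum_mono bessel_inequality L2_component f F)
  also have "\<dots> = (\<Sum>j\<in>UNIV. LINT x|torus. (norm (f x $ j))\<^sup>2) / (2 * pi) ^ 3"
    by (simp add: sum_divide_distrib)
  also have "(\<Sum>j\<in>UNIV. LINT x|torus. (norm (f x $ j))\<^sup>2) = (LINT x|torus. (norm (f x))\<^sup>2)"
    unfolding n using L2_perD(4)[OF L2_component[OF f]]
    by (subst Bochner_Integration.integral_sum) auto
  also have "\<dots> = (L2_norm f)\<^sup>2"
    by (simp add: L2_norm_def set_integral_torus)
  finally show ?thesis .
qed

lemma fourier_coeff_diff:
  assumes "f \<in> L2_per" "g \<in> L2_per"
  shows "fourier_coeff (\<lambda>x. f x - g x) k = fourier_coeff f k - fourier_coeff g k"
  using L2_integrable[OF L2_component[OF assms(1)]] L2_integrable[OF L2_component[OF assms(2)]]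
  by (simp add: vec_eq_iff fourier_coeff_nth fcoeff_diff)

section \<open>Transverse modes and weak derivatives\<close>

lemma test_function_mult:
  assumes "test_function \<psi> D" "test_function \<eta> E"
  shows "test_function (\<lambda>x. \<psi> x * \<eta> x) (\<lambda>x. \<eta> x *\<^sub>R D x + \<psi> x *\<^sub>R E x)"
proof -
  have c: "continuous_on UNIV \<phi>" if "test_function \<phi> F" for \<phi> F
    using that unfolding test_function_def gderiv_def
    by (meson continuous_at_imp_continuous_on has_derivative_continuous)
  have "GDERIV (\<lambda>x. \<psi> x * \<eta> x) x :> \<eta> x *\<^sub>R D x + \<psi> x *\<^sub>R E x" for x
    using assms unfolding test_function_def gderiv_def
    by (auto intro!: derivative_eq_intros simp: inner_add_right algebra_simps)
  moreover have "continuous_on UNIV (\<lambda>x. \<eta> x *\<^sub>R D x + \<psi> x *\<^sub>R E x)"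
    using assms c[OF assms(1)] c[OF assms(2)] unfolding test_function_def
    by (intro continuous_intros) auto
  ultimately show ?thesis using assms by (simp add: test_function_def periodic_def)
qed

text \<open>A plane wave with polarization \<open>v\<close> perpendicular to its wave vector is divergence free: for a
  test function \<open>\<psi>\<close> the product \<open>\<phi> (v \<bullet> \<nabla>\<psi>)\<close> is the derivative of \<open>\<psi> \<phi>\<close> along \<open>v\<close>, since \<open>\<phi>\<close> is
  constant in that direction.\<close>

lemma transverse_mode_in_H:
  assumes \<phi>: "test_function \<phi> (\<lambda>x. d x *\<^sub>R wavevec k)" and mean: "(LINT x|torus. \<phi> x) = 0"
    and v: "wavevec k \<bullet> v = 0"
  shows "(\<lambda>x. \<phi> x *\<^sub>R v) \<in> H"
proof -
  have cont: "continuous_on UNIV \<phi>"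
    using \<phi> unfolding test_function_def gderiv_def
    by (meson continuous_at_imp_continuous_on has_derivative_continuous)
  have L2: "(\<lambda>x. \<phi> x *\<^sub>R v) \<in> L2_per"
    using cont \<phi> by (intro continuous_periodic_L2 continuous_intros) (auto simp: periodic_def test_function_def)
  have "(LINT x|torus. (\<phi> x *\<^sub>R v) \<bullet> D x) = 0" if "test_function \<psi> D" for \<psi> D
    using integral_torus_gradient[OF test_function_mult[OF that \<phi>], of v] v
    by (simp add: inner_add_left inner_add_right inner_commute)
  moreover have "(LINT x|torus. \<phi> x *\<^sub>R v) = 0"
    using mean integrable_torus_continuous[OF cont] by simp
  ultimately show ?thesis
    using L2 by (simp add: H_def weak_div_free_def set_integral_torus)
qed

lemma
  assumes k: "k \<noteq> 0" and v: "wavevec k \<bullet> v = 0"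
  shows cos_mode_in_H: "(\<lambda>x. cos (wavevec k \<bullet> x) *\<^sub>R v) \<in> H"
    and sin_mode_in_H: "(\<lambda>x. sin (wavevec k \<bullet> x) *\<^sub>R v) \<in> H"
proof -
  have i: "integrable torus (wave k)" by (rule L2_integrable[OF wave_L2])
  have "(LINT x|torus. Re (wave k x)) = 0" "(LINT x|torus. Im (wave k x)) = 0"
    unfolding integral_Re[OF i] integral_Im[OF i] integral_wave using k by simp_all
  then have "(LINT x|torus. cos (wavevec k \<bullet> x)) = 0" "(LINT x|torus. sin (wavevec k \<bullet> x)) = 0"
    by (simp_all add: wave_def)
  then show "(\<lambda>x. cos (wavevec k \<bullet> x) *\<^sub>R v) \<in> H" "(\<lambda>x. sin (wavevec k \<bullet> x) *\<^sub>R v) \<in> H"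
    using transverse_mode_in_H[OF test_function_cos _ v] transverse_mode_in_H[OF test_function_sin _ v]
    by auto
qed

text \<open>A field with all its frequencies on one sphere is an eigenvector of \<open>exp (a A\<^sup>1\<^sup>/\<^sup>2)\<close>. The sine
  and cosine modes are of this kind, with the two frequencies \<open>k\<close> and \<open>- k\<close>, and so they are
  admissible test fields in the weak equation.\<close>

lemma exp_sqrtA_eigenmode:
  assumes "f \<in> H" "\<And>m. m \<noteq> 0 \<Longrightarrow> norm (wavevec m) \<noteq> r \<Longrightarrow> fourier_coeff f m = 0"
  shows "exp_sqrtA a f (\<lambda>x. exp (a * r) *\<^sub>R f x)"
proof -
  have L2: "(\<lambda>x. c *\<^sub>R f x) \<in> L2_per" for c
    by (rule L2_bounded_linear[OF H_L2[OF assms(1)] bounded_linear_scaleR_right])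
  have "(\<lambda>x. c *\<^sub>R f x) \<in> H" for c
    using assms(1) L2[of c] by (simp add: H_def weak_div_free_def set_integral_torus)
  moreover have "fourier_coeff (\<lambda>x. c *\<^sub>R f x) m = c *\<^sub>R fourier_coeff f m" for c m
    by (simp add: vec_eq_iff fourier_coeff_nth fcoeff_cmult scaleR_conv_of_real[where 'a = complex])
  moreover have "exp (a * r) *\<^sub>R fourier_coeff f m = exp (a * norm (wavevec m)) *\<^sub>R fourier_coeff f m"
    if "m \<noteq> 0" for m
    using assms(2)[OF that] by (cases "norm (wavevec m) = r") auto
  ultimately show ?thesis using assms(1) by (simp add: exp_sqrtA_def)
qed

lemma
  assumes "norm (wavevec m) \<noteq> norm (wavevec k)"
  shows fourier_coeff_cos_mode: "fourier_coeff (\<lambda>x. cos (wavevec k \<bullet> x) *\<^sub>R v) m = 0"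
    and fourier_coeff_sin_mode: "fourier_coeff (\<lambda>x. sin (wavevec k \<bullet> x) *\<^sub>R v) m = 0"
proof -
  have i: "integrable torus (wave l)" for l by (rule L2_integrable[OF wave_L2])
  have "m \<noteq> k" "m \<noteq> - k" using assms by auto
  then have z: "fcoeff (\<lambda>x. c * wave k x + d * wave (- k) x) m = 0" for c d
    by (subst fcoeff_add) (auto simp: i fcoeff_cmult fcoeff_wave)
  have c: "complex_of_real (cos (wavevec k \<bullet> x) * r) = complex_of_real r / 2 * wave k x + complex_of_real r / 2 * wave (- k) x"
    and s: "complex_of_real (sin (wavevec k \<bullet> x) * r) = - \<i> * complex_of_real r / 2 * wave k x + \<i> * complex_of_real r / 2 * wave (- k) x" for x r
    by (simp_all add: wave_def complex_eq_iff)
  show "fourier_coeff (\<lambda>x. cos (wavevec k \<bullet> x) *\<^sub>R v) m = 0"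
    "fourier_coeff (\<lambda>x. sin (wavevec k \<bullet> x) *\<^sub>R v) m = 0"
    by (simp_all only: vec_eq_iff fourier_coeff_nth vector_scaleR_component real_scaleR_def c s z zero_index simp_thms)
qed

text \<open>Weak differentiation is multiplication by \<open>\<i> q\<close> on the Fourier side; the definition of the weak
  Jacobian is tested with the cosine and the sine of \<open>q \<bullet> x\<close>.\<close>

lemma fcoeff_weak_jacobian:
  assumes u: "u \<in> L2_per" and G: "weak_jacobian u G"
  shows "fcoeff (\<lambda>x. complex_of_real (G x $ i $ j)) q
    = \<i> * complex_of_real (wavevec q $ j) * fourier_coeff u q $ i"
proof -
  define V :: real where "V = (2 * pi) ^ 3"
  have V: "V > 0" by (simp add: V_def)
  have GL: "G \<in> L2_per" using G by (simp add: weak_jacobian_def)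
  have iGi: "integrable torus (\<lambda>x. G x $ i)"
    by (rule integrable_bounded_linear[OF bounded_linear_vec_nth L2_integrable[OF GL]])
  have iG: "integrable torus (\<lambda>x. G x $ i $ j)"
    by (rule integrable_bounded_linear[OF bounded_linear_vec_nth iGi])
  have iu: "integrable torus (\<lambda>x. u x $ i)"
    by (rule integrable_bounded_linear[OF bounded_linear_vec_nth L2_integrable[OF u]])
  have comp: "(LINT x|torus. f x) $ j = (LINT x|torus. f x $ j)" if "integrable torus f" for f :: "real^3 \<Rightarrow> real^3"
    by (rule integral_bounded_linear[OF bounded_linear_vec_nth that, symmetric])
  have w: "(LINT x|torus. u x $ i *\<^sub>R D x) = - (LINT x|torus. \<psi> x *\<^sub>R (G x $ i))"
    if "test_function \<psi> D" for \<psi> D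
    using G that by (simp add: weak_jacobian_def set_integral_torus)
  have bd: "integrable torus (\<lambda>x. a x *\<^sub>R (G x $ i))"
    if a: "continuous_on UNIV a" "\<And>x. \<bar>a x\<bar> \<le> 1" for a :: "real^3 \<Rightarrow> real"
  proof (rule Bochner_Integration.integrable_bound[OF iGi])
    show "(\<lambda>x. a x *\<^sub>R (G x $ i)) \<in> borel_measurable torus"
      by (intro borel_measurable_scaleR borel_measurable_integrable[OF integrable_torus_continuous[OF a(1)]]
          borel_measurable_integrable[OF iGi])
    show "AE x in torus. norm (a x *\<^sub>R (G x $ i)) \<le> norm (G x $ i)"
      using a(2) by (intro AE_I2) (simp add: mult_left_le_one_le)
  qed
  have cs: "integrable torus (\<lambda>x. cos (wavevec q \<bullet> x) *\<^sub>R (G x $ i))" "integrable torus (\<lambda>x. sin (wavevec q \<bullet> x) *\<^sub>R (G x $ i))"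
    by (rule bd; auto intro!: continuous_intros)+
  have uc: "integrable torus (\<lambda>x. (u x $ i * cos (wavevec q \<bullet> x)) *\<^sub>R wavevec q)" "integrable torus (\<lambda>x. (u x $ i * - sin (wavevec q \<bullet> x)) *\<^sub>R wavevec q)"
    using integrable_cos_sin[OF iu, of q] by (auto simp: mult.commute)
  have r: "u x $ i * a * b = b * (a * u x $ i)" for x a b by simp
  have "(LINT x|torus. (u x $ i * - sin (wavevec q \<bullet> x)) *\<^sub>R wavevec q) $ j = - (LINT x|torus. cos (wavevec q \<bullet> x) *\<^sub>R (G x $ i)) $ j"
    using w[OF test_function_cos[of q]] by simp
  then have c: "(LINT x|torus. cos (wavevec q \<bullet> x) * G x $ i $ j) = wavevec q $ j * (LINT x|torus. sin (wavevec q \<bullet> x) * u x $ i)"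
    unfolding comp[OF cs(1)] comp[OF uc(2)] by (simp add: r)
  have "(LINT x|torus. (u x $ i * cos (wavevec q \<bullet> x)) *\<^sub>R wavevec q) $ j = - (LINT x|torus. sin (wavevec q \<bullet> x) *\<^sub>R (G x $ i)) $ j"
    using w[OF test_function_sin[of q]] by simp
  then have s: "(LINT x|torus. sin (wavevec q \<bullet> x) * G x $ i $ j) = - wavevec q $ j * (LINT x|torus. cos (wavevec q \<bullet> x) * u x $ i)"
    unfolding comp[OF cs(2)] comp[OF uc(1)] by (simp add: r)
  have "V * Re (fcoeff (\<lambda>x. complex_of_real (G x $ i $ j)) q) = V * (- wavevec q $ j * Im (fourier_coeff u q $ i))"
    "V * Im (fcoeff (\<lambda>x. complex_of_real (G x $ i $ j)) q) = V * (wavevec q $ j * Re (fourier_coeff u q $ i))"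
    using c s unfolding fcoeff_real[OF iG] fcoeff_real[OF iu] fourier_coeff_nth V_def[symmetric] by simp_all
  then show ?thesis using V unfolding mult_cancel_left by (auto simp: complex_eq_iff)
qed

section \<open>Absolutely convergent Fourier series\<close>

text \<open>Multiplication by an absolutely convergent Fourier series is convolution on the Fourier side.
  Uniform convergence of the series allows the integration term by term.\<close>

lemma
  assumes c: "(\<lambda>p. norm (c p)) summable_on UNIV"
  shows fcoeff_mult_series: "integrable torus g \<Longrightarrow>
       ((\<lambda>p. c p * fcoeff g (k - p)) has_sum fcoeff (\<lambda>x. (\<Sum>\<^sub>\<infinity>p. c p * wave p x) * g x) k) UNIV"
    and integrable_mult_series: "integrable torus g \<Longrightarrow> integrable torus (\<lambda>x. (\<Sum>\<^sub>\<infinity>p. c p * wave p x) * g x)"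
proof -
  define S where "S x = (\<Sum>\<^sub>\<infinity>p. c p * wave p x)" for x
  have unif: "uniform_limit T (\<lambda>F x. \<Sum>p\<in>F. c p * wave p x) S (finite_subsets_at_top UNIV)" for T
    unfolding S_def by (rule Weierstrass_m_test_general[where M = "\<lambda>p. norm (c p)"]) (use c in \<open>auto simp: norm_mult\<close>)
  have "continuous_on UNIV S"
    by (rule uniform_limit_theorem[OF _ unif])
       (auto intro!: always_eventually continuous_intros)
  note cont = this
  have bound: "norm (S x) \<le> (\<Sum>\<^sub>\<infinity>p. norm (c p))" for x
    unfolding S_def
    using norm_infsum_bound[of "\<lambda>p. c p * wave p x" UNIV] c by (simp add: norm_mult)
  assume g: "integrable torus g"
  have mS: "S \<in> borel_measurable torus"
    by (rule borel_measurable_integrable[OF integrable_torus_continuous[OF cont]])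
  have b0: "0 \<le> (\<Sum>\<^sub>\<infinity>p. norm (c p))" by (rule infsum_nonneg) simp
  show int: "integrable torus (\<lambda>x. S x * g x)"
  proof (rule Bochner_Integration.integrable_bound)
    show "integrable torus (\<lambda>x. (\<Sum>\<^sub>\<infinity>p. norm (c p)) *\<^sub>R g x)" using g by (rule integrable_scaleR_right)
    show "(\<lambda>x. S x * g x) \<in> borel_measurable torus"
      using mS borel_measurable_integrable[OF g] by (rule borel_measurable_times)
    show "AE x in torus. norm (S x * g x) \<le> norm ((\<Sum>\<^sub>\<infinity>p. norm (c p)) *\<^sub>R g x)"
      using bound b0 by (auto simp: norm_mult mult_right_mono)
  qed
  define B where "B = (LINT x|torus. norm (g x))"
  have B: "B \<ge> 0" by (simp add: B_def)
  have "((\<lambda>F. fcoeff (\<lambda>x. (\<Sum>p\<in>F. c p * wave p x) * g x) k) \<longlongrightarrow> fcoeff (\<lambda>x. S x * g x) k) (finite_subsets_at_top UNIV)"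
  proof (rule tendstoI)
    fix e :: real assume e: "e > 0"
    define d where "d = e / (B + 1)"
    have d: "d > 0" using e B by (simp add: d_def)
    have "\<forall>\<^sub>F F in finite_subsets_at_top UNIV. finite (F :: (int^3) set)"
      by (rule eventually_finite_subsets_at_top_weakI)
    with uniform_limitD[OF unif[of UNIV] d]
    show "\<forall>\<^sub>F F in finite_subsets_at_top UNIV. dist (fcoeff (\<lambda>x. (\<Sum>p\<in>F. c p * wave p x) * g x) k) (fcoeff (\<lambda>x. S x * g x) k) < e"
    proof eventually_elim
      case (elim F)
      define h where "h x = (\<Sum>p\<in>F. c p * wave p x) * g x - S x * g x" for x
      have iF: "integrable torus (\<lambda>x. (\<Sum>p\<in>F. c p * wave p x) * g x)"
        unfolding sum_distrib_right mult.assoc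
        by (intro Bochner_Integration.integrable_sum Bochner_Integration.integrable_mult_right integrable_wave_times g)
      have ih: "integrable torus h" unfolding h_def by (intro Bochner_Integration.integrable_diff iF int)
      have "dist (fcoeff (\<lambda>x. (\<Sum>p\<in>F. c p * wave p x) * g x) k) (fcoeff (\<lambda>x. S x * g x) k) = norm (fcoeff h k)"
        unfolding dist_norm fcoeff_diff[OF iF int, symmetric] h_def ..
      also have "\<dots> \<le> norm (LINT x|torus. wave (- k) x * h x)"
      proof -
        have "(1::real) \<le> (2 * pi) ^ 3" using pi_ge_two by (intro one_le_power) linarith
        then have "1 / (2 * pi) ^ 3 \<le> 1" by simp
        then show ?thesis
          unfolding fcoeff_def norm_mult norm_of_real by (intro mult_left_le_one_le) auto
      qed
      also have "\<dots> \<le> (LINT x|torus. norm (wave (- k) x * h x))" by (rule integral_norm_bound)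
      also have "\<dots> \<le> (LINT x|torus. d * norm (g x))"
      proof (rule integral_mono)
        show "norm (wave (- k) x * h x) \<le> d * norm (g x)" for x
        proof -
          have "norm ((\<Sum>p\<in>F. c p * wave p x) - S x) \<le> d" using bspec[OF elim(1) UNIV_I, of x] by (simp add: dist_norm)
          then show ?thesis
            unfolding h_def left_diff_distrib[symmetric] norm_mult by (simp add: mult_right_mono)
        qed
      qed (intro integrable_norm integrable_wave_times ih integrable_mult_right g)+
      also have "\<dots> = d * B" by (simp add: B_def)
      also have "\<dots> < e" using e B unfolding d_def by (simp add: field_simps)
      finally show ?case .
    qed
  qed
  moreover have "fcoeff (\<lambda>x. (\<Sum>p\<in>F. c p * wave p x) * g x) k = (\<Sum>p\<in>F. c p * fcoeff g (k - p))" for F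
  proof -
    have "fcoeff (\<lambda>x. wave p x * g x) k = fcoeff g (k - p)" for p
    proof -
      have w: "wave (- k) x * (wave p x * g x) = wave (- (k - p)) x * g x" for x
        by (simp add: mult.assoc[symmetric] wave_add[symmetric])
      show ?thesis unfolding fcoeff_def by (simp only: w)
    qed
    then show ?thesis
      unfolding sum_distrib_right mult.assoc
      by (subst fcoeff_sum) (auto intro!: integrable_wave_times g simp: fcoeff_cmult)
  qed
  ultimately show "((\<lambda>p. c p * fcoeff g (k - p)) has_sum fcoeff (\<lambda>x. (\<Sum>\<^sub>\<infinity>p. c p * wave p x) * g x) k) UNIV"
    unfolding has_sum_def S_def by simp
qed

text \<open>The sum of the series has the same Fourier coefficients as \<open>f\<close>.\<close>

lemma fourier_series_AE:
  assumes int: "integrable torus f" and sum: "(\<lambda>p. norm (fcoeff f p)) summable_on UNIV"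
  shows "AE x in torus. f x = (\<Sum>\<^sub>\<infinity>p. fcoeff f p * wave p x)"
proof -
  let ?S = "\<lambda>x. \<Sum>\<^sub>\<infinity>p. fcoeff f p * wave p x"
  have i1: "integrable torus (\<lambda>x. 1 :: complex)" by simp
  have iS: "integrable torus ?S"
    using integrable_mult_series[OF sum i1] by simp
  have "fcoeff ?S k = fcoeff f k" for k
  proof -
    have "((\<lambda>p. fcoeff f p * fcoeff (\<lambda>x. 1) (k - p)) has_sum fcoeff ?S k) UNIV"
      using fcoeff_mult_series[OF sum i1] by simp
    moreover have "fcoeff f p * fcoeff (\<lambda>x. 1) (k - p) = (if p = k then fcoeff f k else 0)" for p
    proof -
      have "wave 0 = (\<lambda>x. 1)" by (simp add: fun_eq_iff)
      then show ?thesis using fcoeff_wave[of 0 "k - p"] by simp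
    qed
    ultimately have "((\<lambda>p. if p = k then fcoeff f k else 0) has_sum fcoeff ?S k) UNIV" by simp
    moreover have "((\<lambda>p. if p = k then fcoeff f k else 0) has_sum fcoeff f k) UNIV"
      by (rule has_sum_finite_neutralI[of "{k}"]) auto
    ultimately show ?thesis using has_sum_unique by blast
  qed
  then have "AE x in torus. f x - ?S x = 0"
    by (intro fourier_uniqueness Bochner_Integration.integrable_diff int iS) (simp add: fcoeff_diff int iS)
  then show ?thesis by eventually_elim simp
qed

section \<open>Sequences on the lattice and the quadratic term\<close>

text \<open>The exponential is dominated by a product of three geometric factors, one for each coordinate.\<close>

lemma summable_lattice_exp:
  fixes s :: real
  assumes s: "s > 0"
  shows "(\<lambda>k. exp (- s * norm (wavevec k))) summable_on UNIV"
proof -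
  \<comment> \<open>the sum of the absolute values of the coordinates is at most three times the norm\<close>
  define r where "r = exp (- s / 3)"
  have r: "0 < r" "r < 1" using s by (auto simp: r_def)
  define f where "f n = r ^ nat \<bar>n\<bar>" for n :: int
  have f0: "f n \<ge> 0" for n using r by (simp add: f_def)
  have 1: "(\<Sum>n\<in>{- int N..int N}. f n) \<le> 2 / (1 - r)" for N
  proof -
    have "(\<Sum>n\<in>{- int N..int N}. f n) \<le> (\<Sum>n\<in>int ` {..N} \<union> (\<lambda>m. - int m) ` {..N}. f n)"
    proof (intro sum_mono2)
      show "{- int N..int N} \<subseteq> int ` {..N} \<union> (\<lambda>m. - int m) ` {..N}"
      proof
        fix n assume "n \<in> {- int N..int N}"
        then have "n = int (nat n) \<and> nat n \<le> N \<or> n = - int (nat (- n)) \<and> nat (- n) \<le> N" by auto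
        then show "n \<in> int ` {..N} \<union> (\<lambda>m. - int m) ` {..N}" by blast
      qed
    qed (use f0 in auto)
    also have "\<dots> \<le> (\<Sum>n\<in>int ` {..N}. f n) + (\<Sum>n\<in>(\<lambda>m. - int m) ` {..N}. f n)"
      by (subst sum_Un) (auto intro!: sum_nonneg f0)
    also have "\<dots> = 2 * (\<Sum>m\<le>N. r ^ m)"
      by (subst (1 2) sum.reindex) (auto simp: inj_on_def f_def)
    also have "(\<Sum>m\<le>N. r ^ m) \<le> 1 / (1 - r)"
      using r sum_le_suminf[of "\<lambda>m. r ^ m" "{..N}"] suminf_geometric[of r] summable_geometric[of r] by auto
    finally show ?thesis by simp
  qed
  have le: "exp (- s * norm (wavevec k)) \<le> (\<Prod>j\<in>UNIV. f (k $ j))" for k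
  proof -
    have "(\<Sum>j\<in>UNIV. \<bar>wavevec k $ j\<bar>) \<le> (\<Sum>j\<in>(UNIV::3 set). norm (wavevec k))"
      by (intro sum_mono component_le_norm_cart)
    then have "(\<Sum>j\<in>UNIV. real (nat \<bar>k $ j\<bar>)) \<le> 3 * norm (wavevec k)" by simp
    then have "- s * norm (wavevec k) \<le> (\<Sum>j\<in>UNIV. - s / 3 * real (nat \<bar>k $ j\<bar>))"
    proof -
      have "s * (\<Sum>j\<in>UNIV. real (nat \<bar>k $ j\<bar>)) \<le> s * (3 * norm (wavevec k))"
        using \<open>(\<Sum>j\<in>UNIV. real (nat \<bar>k $ j\<bar>)) \<le> 3 * norm (wavevec k)\<close> s by (intro mult_left_mono) auto
      moreover have "(\<Sum>j\<in>UNIV. - s / 3 * real (nat \<bar>k $ j\<bar>)) = - s / 3 * (\<Sum>j\<in>UNIV. real (nat \<bar>k $ j\<bar>))"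
        by (rule sum_distrib_left[symmetric])
      ultimately show ?thesis by linarith
    qed
    then have "exp (- s * norm (wavevec k)) \<le> exp (\<Sum>j\<in>UNIV. - s / 3 * real (nat \<bar>k $ j\<bar>))" by simp
    also have "\<dots> = (\<Prod>j\<in>UNIV. exp (- s / 3 * real (nat \<bar>k $ j\<bar>)))" by (rule exp_sum) simp
    also have "\<dots> = (\<Prod>j\<in>UNIV. f (k $ j))"
      unfolding f_def r_def exp_of_nat2_mult[symmetric] by (simp add: mult.commute)
    finally show ?thesis .
  qed
  show ?thesis
  proof (rule nonneg_bdd_above_summable_on)
    show "bdd_above (sum (\<lambda>k. exp (- s * norm (wavevec k))) ` {F. F \<subseteq> UNIV \<and> finite F})"
    proof (rule bdd_aboveI2[where M = "(2 / (1 - r)) ^ 3"])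
      fix F :: "(int^3) set" assume "F \<in> {F. F \<subseteq> UNIV \<and> finite F}"
      then have F: "finite F" by simp
      define N where "N = Max (insert 0 ((\<lambda>(k, j). nat \<bar>k $ j\<bar>) ` (F \<times> UNIV)))"
      have N: "nat \<bar>k $ j\<bar> \<le> N" if "k \<in> F" for k j
        unfolding N_def using that F by (intro Max_ge) auto
      let ?P = "PiE UNIV (\<lambda>_::3. {- int N..int N})"
      have "(\<Sum>k\<in>F. exp (- s * norm (wavevec k))) \<le> (\<Sum>k\<in>F. \<Prod>j\<in>UNIV. f (k $ j))"
        by (intro sum_mono le)
      also have "\<dots> = (\<Sum>g\<in>vec_nth ` F. \<Prod>j\<in>UNIV. f (g j))"
        by (subst sum.reindex) (auto simp: inj_on_def vec_nth_inject)
      also have "\<dots> \<le> (\<Sum>g\<in>?P. \<Prod>j\<in>UNIV. f (g j))"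
      proof (intro sum_mono2)
        show "finite ?P" by (intro finite_PiE) auto
        show "vec_nth ` F \<subseteq> ?P"
        proof (intro image_subsetI PiE_I)
          fix k j assume "k \<in> F"
          then show "k $ j \<in> {- int N..int N}" using N[of k j] by auto
        qed auto
      qed (auto intro!: prod_nonneg f0)
      also have "\<dots> = (\<Prod>j\<in>(UNIV::3 set). \<Sum>n\<in>{- int N..int N}. f n)"
        by (rule prod_sum_PiE[symmetric]) auto
      also have "\<dots> \<le> (\<Prod>j\<in>(UNIV::3 set). 2 / (1 - r))"
        by (intro prod_mono conjI sum_nonneg f0 1)
      also have "\<dots> = (2 / (1 - r)) ^ 3" by simp
      finally show "(\<Sum>k\<in>F. exp (- s * norm (wavevec k))) \<le> (2 / (1 - r)) ^ 3" .
    qed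
  qed simp
qed

lemma infsum_Cauchy_Schwarz:
  fixes x y :: "'a \<Rightarrow> real"
  assumes x: "(\<lambda>i. (x i)\<^sup>2) summable_on A" and y: "(\<lambda>i. (y i)\<^sup>2) summable_on A"
  shows "(\<lambda>i. \<bar>x i\<bar> * \<bar>y i\<bar>) summable_on A"
    and "(\<Sum>\<^sub>\<infinity>i\<in>A. \<bar>x i\<bar> * \<bar>y i\<bar>) \<le> sqrt (\<Sum>\<^sub>\<infinity>i\<in>A. (x i)\<^sup>2) * sqrt (\<Sum>\<^sub>\<infinity>i\<in>A. (y i)\<^sup>2)"
proof -
  have fin: "(\<Sum>i\<in>F. \<bar>x i\<bar> * \<bar>y i\<bar>) \<le> sqrt (\<Sum>\<^sub>\<infinity>i\<in>A. (x i)\<^sup>2) * sqrt (\<Sum>\<^sub>\<infinity>i\<in>A. (y i)\<^sup>2)"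
    if "finite F" "F \<subseteq> A" for F
  proof -
    have "(\<Sum>i\<in>F. \<bar>x i\<bar> * \<bar>y i\<bar>) \<le> L2_set x F * L2_set y F" by (rule L2_set_mult_ineq)
    also have "\<dots> \<le> sqrt (\<Sum>\<^sub>\<infinity>i\<in>A. (x i)\<^sup>2) * sqrt (\<Sum>\<^sub>\<infinity>i\<in>A. (y i)\<^sup>2)"
      unfolding L2_set_def using that x y
      by (intro mult_mono real_sqrt_le_mono finite_sum_le_infsum) (auto intro!: real_sqrt_ge_zero infsum_nonneg sum_nonneg)
    finally show ?thesis .
  qed
  show s: "(\<lambda>i. \<bar>x i\<bar> * \<bar>y i\<bar>) summable_on A"
  proof (rule nonneg_bdd_above_summable_on)
    show "bdd_above (sum (\<lambda>i. \<bar>x i\<bar> * \<bar>y i\<bar>) ` {F. F \<subseteq> A \<and> finite F})"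
      by (rule bdd_aboveI2[where M = "sqrt (\<Sum>\<^sub>\<infinity>i\<in>A. (x i)\<^sup>2) * sqrt (\<Sum>\<^sub>\<infinity>i\<in>A. (y i)\<^sup>2)"])
         (use fin in auto)
  qed simp
  show "(\<Sum>\<^sub>\<infinity>i\<in>A. \<bar>x i\<bar> * \<bar>y i\<bar>) \<le> sqrt (\<Sum>\<^sub>\<infinity>i\<in>A. (x i)\<^sup>2) * sqrt (\<Sum>\<^sub>\<infinity>i\<in>A. (y i)\<^sup>2)"
    by (rule infsum_le_finite_sums[OF s fin])
qed

definition square_summable :: "(int^3 \<Rightarrow> complex^3) \<Rightarrow> bool" where
  "square_summable a \<longleftrightarrow> (\<lambda>k. (norm (a k))\<^sup>2) summable_on UNIV"

definition l2norm :: "(int^3 \<Rightarrow> complex^3) \<Rightarrow> real" where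
  "l2norm a = sqrt (\<Sum>\<^sub>\<infinity>k. (norm (a k))\<^sup>2)"

lemma l2norm_nonneg [simp]: "0 \<le> l2norm a"
  by (simp add: l2norm_def infsum_nonneg)

lemma bij_reflect: "bij (\<lambda>p::int^3. k - p)"
  by (rule involuntory_imp_bij) simp

lemma convolution_bound:
  assumes a: "square_summable a" and b: "square_summable b"
  shows "(\<lambda>p. norm (a p) * norm (b (k - p))) summable_on UNIV"
    and "(\<Sum>\<^sub>\<infinity>p. norm (a p) * norm (b (k - p))) \<le> l2norm a * l2norm b"
proof -
  have s: "(\<lambda>p. (norm (b (k - p)))\<^sup>2) summable_on UNIV"
    using summable_on_reindex_bij_betw[OF bij_reflect, of "\<lambda>p. (norm (b p))\<^sup>2" k] b
    by (simp add: square_summable_def)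
  have e: "(\<Sum>\<^sub>\<infinity>p. (norm (b (k - p)))\<^sup>2) = (\<Sum>\<^sub>\<infinity>p. (norm (b p))\<^sup>2)"
    using infsum_reindex_bij_betw[OF bij_reflect, of "\<lambda>p. (norm (b p))\<^sup>2" k] by simp
  show "(\<lambda>p. norm (a p) * norm (b (k - p))) summable_on UNIV"
    "(\<Sum>\<^sub>\<infinity>p. norm (a p) * norm (b (k - p))) \<le> l2norm a * l2norm b"
    using infsum_Cauchy_Schwarz[OF a[unfolded square_summable_def] s]
    by (simp_all add: e l2norm_def)
qed

lemma
  assumes a: "square_summable a" and b: "square_summable b"
  shows square_summable_diff: "square_summable (\<lambda>k. a k - b k)"
proof -
  have "(\<lambda>k. 2 * (norm (a k))\<^sup>2 + 2 * (norm (b k))\<^sup>2) summable_on UNIV"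
    using a b by (intro summable_on_add summable_on_cmult_right) (auto simp: square_summable_def)
  then show ?thesis unfolding square_summable_def
  proof (rule summable_on_comparison_test)
    fix k
    have "(norm (a k - b k))\<^sup>2 \<le> (norm (a k) + norm (b k))\<^sup>2"
      by (intro power_mono norm_triangle_ineq4) auto
    also have "\<dots> \<le> 2 * (norm (a k))\<^sup>2 + 2 * (norm (b k))\<^sup>2"
      using sum_squares_bound[of "norm (a k)" "norm (b k)"] by (simp add: power2_sum)
    finally show "(norm (a k - b k))\<^sup>2 \<le> 2 * (norm (a k))\<^sup>2 + 2 * (norm (b k))\<^sup>2" .
  qed simp
qed

lemma l2norm_le_add:
  assumes a: "square_summable a" and b: "square_summable b"
  shows "l2norm a \<le> l2norm b + l2norm (\<lambda>k. a k - b k)"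
proof -
  have d: "square_summable (\<lambda>k. a k - b k)" by (rule square_summable_diff[OF a b])
  have "(\<Sum>\<^sub>\<infinity>k. (norm (a k))\<^sup>2) \<le> (l2norm b + l2norm (\<lambda>k. a k - b k))\<^sup>2"
  proof (rule infsum_le_finite_sums)
    show "(\<lambda>k. (norm (a k))\<^sup>2) summable_on UNIV" using a by (simp add: square_summable_def)
    fix F :: "(int^3) set" assume F: "finite F"
    have fin: "L2_set (\<lambda>k. norm (c k)) F \<le> l2norm c" if "square_summable c" for c
      unfolding L2_set_def l2norm_def using that F
      by (intro real_sqrt_le_mono finite_sum_le_infsum) (auto simp: square_summable_def)
    have "L2_set (\<lambda>k. norm (a k)) F \<le> L2_set (\<lambda>k. norm (b k) + norm (a k - b k)) F"
      by (intro L2_set_mono norm_ge_zero) (metis add.commute diff_add_cancel norm_triangle_ineq)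
    also have "\<dots> \<le> L2_set (\<lambda>k. norm (b k)) F + L2_set (\<lambda>k. norm (a k - b k)) F"
      by (rule L2_set_triangle_ineq)
    also have "\<dots> \<le> l2norm b + l2norm (\<lambda>k. a k - b k)"
      using fin[OF b] fin[OF d] by simp
    finally have "(L2_set (\<lambda>k. norm (a k)) F)\<^sup>2 \<le> (l2norm b + l2norm (\<lambda>k. a k - b k))\<^sup>2"
      by (intro power_mono L2_set_nonneg)
    then show "(\<Sum>k\<in>F. (norm (a k))\<^sup>2) \<le> (l2norm b + l2norm (\<lambda>k. a k - b k))\<^sup>2"
      by (simp add: L2_set_def sum_nonneg)
  qed
  then show ?thesis unfolding l2norm_def[of a]
    by (intro real_le_lsqrt) (auto simp: infsum_nonneg)
qed

lemma norm_le_l2norm: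
  assumes "square_summable a" shows "norm (a k) \<le> l2norm a"
  using finite_sum_le_infsum[of "\<lambda>k. (norm (a k))\<^sup>2" UNIV "{k}"] assms
  unfolding l2norm_def square_summable_def by (intro real_le_rsqrt) auto

text \<open>The component along \<open>v\<close> of the Fourier coefficient at \<open>k\<close> of \<open>(u \<bullet> \<nabla>) u\<close>, if \<open>u\<close> is divergence
  free with coefficients \<open>a\<close>: the factor \<open>k - p\<close> coming from the gradient may then be replaced by
  \<open>k\<close>. For \<open>v\<close> perpendicular to \<open>k\<close> the Leray projection does not change this component.\<close>

definition advection :: "(int^3 \<Rightarrow> complex^3) \<Rightarrow> int^3 \<Rightarrow> real^3 \<Rightarrow> complex" where
  "advection a k v = (\<Sum>\<^sub>\<infinity>p. \<i> * cdot (wavevec k) (a p) * cdot v (a (k - p)))"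

lemma norm_convolution_term_le:
  "norm (\<i> * cdot w y * cdot v z) \<le> norm w * norm v * (norm y * norm z)"
proof -
  have "norm (cdot w y) * norm (cdot v z) \<le> (norm w * norm y) * (norm v * norm z)"
    by (rule mult_mono[OF norm_cdot_le norm_cdot_le]) simp_all
  also have "\<dots> = norm w * norm v * (norm y * norm z)" by (simp only: mult_ac)
  finally show ?thesis by (simp only: norm_mult norm_ii mult_1_left)
qed

lemma convolution_summable:
  assumes "(\<lambda>p. norm (a p) * norm (b (k - p))) summable_on UNIV"
  shows "(\<lambda>p. \<i> * cdot w (a p) * cdot v (b (k - p))) summable_on UNIV"
    and "norm (\<Sum>\<^sub>\<infinity>p. \<i> * cdot w (a p) * cdot v (b (k - p)))
        \<le> norm w * norm v * (\<Sum>\<^sub>\<infinity>p. norm (a p) * norm (b (k - p)))"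
proof -
  let ?f = "\<lambda>p. \<i> * cdot w (a p) * cdot v (b (k - p))"
  let ?g = "\<lambda>p. norm w * norm v * (norm (a p) * norm (b (k - p)))"
  have s: "?g summable_on UNIV"
    using assms by (rule summable_on_cmult_right)
  then have n: "(\<lambda>p. norm (?f p)) summable_on UNIV"
    by (rule summable_on_comparison_test) (rule norm_convolution_term_le, rule norm_ge_zero)
  then show "?f summable_on UNIV"
    by (rule abs_summable_summable)
  have "norm (infsum ?f UNIV) \<le> infsum ?g UNIV"
    by (rule norm_infsum_le[OF has_sum_infsum has_sum_infsum norm_convolution_term_le])
       (fact abs_summable_summable[OF n], fact s)
  also have "\<dots> = norm w * norm v * (\<Sum>\<^sub>\<infinity>p. norm (a p) * norm (b (k - p)))"
    by (rule infsum_cmult_right[OF assms])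
  finally show "norm (infsum ?f UNIV) \<le> norm w * norm v * (\<Sum>\<^sub>\<infinity>p. norm (a p) * norm (b (k - p)))" .
qed

text \<open>Continuity of the quadratic term in the \<open>l2\<close> norm, by bilinearity.\<close>

lemma advection_diff_bound:
  assumes a: "square_summable a" and b: "square_summable b"
  shows "norm (advection a k v - advection b k v)
    \<le> norm (wavevec k) * norm v * l2norm (\<lambda>k. a k - b k) * (l2norm a + l2norm b)"
proof -
  define d where "d k = a k - b k" for k
  have d: "square_summable d" unfolding d_def by (rule square_summable_diff[OF a b])
  note s = convolution_summable(1)[OF convolution_bound(1)]
  let ?B = "\<lambda>x y. \<Sum>\<^sub>\<infinity>p. \<i> * cdot (wavevec k) (x p) * cdot v (y (k - p))"
  have r: "\<i> * x * y + - (\<i> * z * w) = \<i> * (x - z) * y + \<i> * z * (y - w)" for x y z w :: complex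
    by (simp add: left_diff_distrib right_diff_distrib)
  define A where "A p = \<i> * cdot (wavevec k) (a p) * cdot v (a (k - p))" for p
  define B where "B p = \<i> * cdot (wavevec k) (b p) * cdot v (b (k - p))" for p
  have AB: "A summable_on UNIV" "(\<lambda>p. - B p) summable_on UNIV"
    unfolding A_def[abs_def] B_def[abs_def] summable_on_uminus by (rule s[OF a a], rule s[OF b b])
  have "advection a k v - advection b k v = (\<Sum>\<^sub>\<infinity>p. A p + - B p)"
  proof -
    have "advection a k v = infsum A UNIV" "advection b k v = infsum B UNIV"
      unfolding advection_def A_def[abs_def] B_def[abs_def] by (rule refl)+
    moreover have "(\<Sum>\<^sub>\<infinity>p. A p + - B p) = infsum A UNIV + (\<Sum>\<^sub>\<infinity>p. - B p)"
      by (rule infsum_add[OF AB])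
    ultimately show ?thesis by (simp only: infsum_uminus diff_conv_add_uminus)
  qed
  also have "\<dots> = (\<Sum>\<^sub>\<infinity>p. \<i> * cdot (wavevec k) (d p) * cdot v (a (k - p)) + \<i> * cdot (wavevec k) (b p) * cdot v (d (k - p)))"
    unfolding A_def B_def d_def cdot_linear(7) r ..
  also have "\<dots> = ?B d a + ?B b d"
    by (rule infsum_add) (intro s a b d)+
  also have "norm \<dots> \<le> norm (wavevec k) * norm v * (l2norm d * l2norm a) + norm (wavevec k) * norm v * (l2norm b * l2norm d)"
  proof (intro order_trans[OF norm_triangle_ineq] add_mono)
    show "norm (?B d a) \<le> norm (wavevec k) * norm v * (l2norm d * l2norm a)"
      by (rule order_trans[OF convolution_summable(2)[OF convolution_bound(1)[OF d a]]])
         (intro mult_left_mono convolution_bound d a, simp)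
    show "norm (?B b d) \<le> norm (wavevec k) * norm v * (l2norm b * l2norm d)"
      by (rule order_trans[OF convolution_summable(2)[OF convolution_bound(1)[OF b d]]])
         (intro mult_left_mono convolution_bound b d, simp)
  qed
  also have "\<dots> = norm (wavevec k) * norm v * l2norm d * (l2norm a + l2norm b)"
    by (simp add: algebra_simps)
  finally show ?thesis unfolding d_def[abs_def] .
qed

section \<open>The mode equations of a weak solution\<close>

lemma has_sum_sum_finite:
  fixes f :: "'i \<Rightarrow> 'a \<Rightarrow> 'b::topological_comm_monoid_add"
  assumes "finite I" "\<And>i. i \<in> I \<Longrightarrow> (f i has_sum s i) A"
  shows "((\<lambda>x. \<Sum>i\<in>I. f i x) has_sum (\<Sum>i\<in>I. s i)) A"
  using assms by (induction I rule: finite_induct) (auto intro: has_sum_add)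

lemma fourier_coeff_square_summable:
  assumes "f \<in> L2_per"
  shows "square_summable (fourier_coeff f)" and "l2norm (fourier_coeff f) \<le> L2_norm f"
proof -
  have V: "(1::real) \<le> (2 * pi) ^ 3" using pi_ge_two by (intro one_le_power) linarith
  have L0: "0 \<le> L2_norm f"
    unfolding L2_norm_def set_integral_torus by (intro real_sqrt_ge_zero Bochner_Integration.integral_nonneg) simp
  have b: "(\<Sum>k\<in>F. (norm (fourier_coeff f k))\<^sup>2) \<le> (L2_norm f)\<^sup>2" if "finite F" for F
  proof -
    have "(L2_norm f)\<^sup>2 * 1 \<le> (L2_norm f)\<^sup>2 * (2 * pi) ^ 3" using V by (intro mult_left_mono) auto
    then have "(L2_norm f)\<^sup>2 / (2 * pi) ^ 3 \<le> (L2_norm f)\<^sup>2" by (subst pos_divide_le_eq) auto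
    then show ?thesis using bessel_vector[OF assms that] by linarith
  qed
  show s: "square_summable (fourier_coeff f)"
    unfolding square_summable_def
    by (intro nonneg_bdd_above_summable_on bdd_aboveI2[where M = "(L2_norm f)\<^sup>2"]) (use b in auto)
  have "(\<Sum>\<^sub>\<infinity>k. (norm (fourier_coeff f k))\<^sup>2) \<le> (L2_norm f)\<^sup>2"
    by (rule infsum_le_finite_sums) (use s b in \<open>auto simp: square_summable_def\<close>)
  then show "l2norm (fourier_coeff f) \<le> L2_norm f"
    unfolding l2norm_def using L0 by (intro real_le_lsqrt) (auto simp: infsum_nonneg)
qed

lemma fcoeff_cong_AE:
  assumes "integrable torus f" "integrable torus g" "AE x in torus. f x = g x"
  shows "fcoeff f k = fcoeff g k"
proof -
  have "(LINT x|torus. wave (- k) x * f x) = (LINT x|torus. wave (- k) x * g x)"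
  proof (rule integral_cong_AE)
    show "AE x in torus. wave (- k) x * f x = wave (- k) x * g x"
      using assms(3) by eventually_elim simp
  qed (intro borel_measurable_integrable integrable_wave_times assms)+
  then show ?thesis by (simp only: fcoeff_def)
qed

text \<open>Absolute summability of the coefficients lets the product \<open>G u\<close> be computed by convolution, and
  incompressibility turns the factor \<open>k - p\<close> into \<open>k\<close>.\<close>

lemma fcoeff_nonlinear:
  assumes u: "u \<in> H" and sm: "(\<lambda>p. norm (fourier_coeff u p)) summable_on UNIV"
    and G: "weak_jacobian u G"
  shows "fcoeff (\<lambda>x. complex_of_real ((G x *v u x) \<bullet> v)) k = advection (fourier_coeff u) k v"
proof -
  define c where "c = fourier_coeff u"
  have uL: "u \<in> L2_per" by (rule H_L2[OF u])
  have GL: "G \<in> L2_per" using G by (simp add: weak_jacobian_def)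
  have iGr: "integrable torus (\<lambda>x. G x $ i $ j)" for i j
    by (intro integrable_bounded_linear[OF bounded_linear_vec_nth] L2_integrable[OF GL])
  have iG: "integrable torus (\<lambda>x. complex_of_real (G x $ i $ j))" for i j
    by (rule integrable_of_real[OF iGr])
  have smj: "(\<lambda>p. norm (c p $ j)) summable_on UNIV" for j
    using sm by (rule summable_on_comparison_test) (auto simp: c_def Finite_Cartesian_Product.norm_nth_le)
  have Gij: "(\<lambda>x. G x $ i $ j) \<in> L2_per" for i j
    by (rule L2_bounded_linear[OF L2_bounded_linear[OF GL bounded_linear_vec_nth] bounded_linear_vec_nth])
  have uj: "(\<lambda>x. u x $ j) \<in> L2_per" for j
    by (rule L2_bounded_linear[OF uL bounded_linear_vec_nth])
  have iuGr: "integrable torus (\<lambda>x. u x $ j * G x $ i $ j)" for i j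
    by (rule L2_bilinear_integrable[OF bounded_bilinear_mult uj Gij])
  have iuG: "integrable torus (\<lambda>x. complex_of_real (u x $ j * G x $ i $ j))" for i j
    by (rule integrable_of_real[OF iuGr])
  have ae: "AE x in torus. complex_of_real (u x $ j) = (\<Sum>\<^sub>\<infinity>p. c p $ j * wave p x)" for j
    using fourier_series_AE[OF L2_integrable[OF L2_component[OF uL]]] smj[of j]
    by (simp add: c_def fourier_coeff_nth)
  have hs: "((\<lambda>p. c p $ j * fcoeff (\<lambda>x. complex_of_real (G x $ i $ j)) (k - p)) has_sum
      fcoeff (\<lambda>x. complex_of_real (u x $ j * G x $ i $ j)) k) UNIV" for i j
  proof -
    have "fcoeff (\<lambda>x. (\<Sum>\<^sub>\<infinity>p. c p $ j * wave p x) * complex_of_real (G x $ i $ j)) k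
      = fcoeff (\<lambda>x. complex_of_real (u x $ j * G x $ i $ j)) k"
    proof (rule fcoeff_cong_AE[OF integrable_mult_series[OF smj iG] iuG])
      show "AE x in torus. (\<Sum>\<^sub>\<infinity>p. c p $ j * wave p x) * complex_of_real (G x $ i $ j) = complex_of_real (u x $ j * G x $ i $ j)"
        using ae[of j] by eventually_elim (simp only: of_real_mult)
    qed
    then show ?thesis using fcoeff_mult_series[OF smj[of j] iG[of i j], of k] by simp
  qed
  have "fcoeff (\<lambda>x. complex_of_real ((G x *v u x) \<bullet> v)) k
      = fcoeff (\<lambda>x. \<Sum>i\<in>UNIV. \<Sum>j\<in>UNIV. complex_of_real (v $ i) * complex_of_real (u x $ j * G x $ i $ j)) k"
    by (simp add: inner_vec_def matrix_vector_mult_def sum_distrib_left mult_ac)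
  also have "\<dots> = (\<Sum>i\<in>UNIV. \<Sum>j\<in>UNIV. complex_of_real (v $ i) * fcoeff (\<lambda>x. complex_of_real (u x $ j * G x $ i $ j)) k)"
    using iuG by (simp only: fcoeff_sum fcoeff_cmult Bochner_Integration.integrable_sum Bochner_Integration.integrable_mult_right)
  finally have 1: "fcoeff (\<lambda>x. complex_of_real ((G x *v u x) \<bullet> v)) k = \<dots>" .
  have "((\<lambda>p. \<Sum>i\<in>UNIV. \<Sum>j\<in>UNIV. complex_of_real (v $ i) * (c p $ j * fcoeff (\<lambda>x. complex_of_real (G x $ i $ j)) (k - p)))
     has_sum fcoeff (\<lambda>x. complex_of_real ((G x *v u x) \<bullet> v)) k) UNIV"
    unfolding 1 by (intro has_sum_sum_finite has_sum_cmult_right hs) simp_all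
  moreover have "(\<Sum>i\<in>UNIV. \<Sum>j\<in>UNIV. complex_of_real (v $ i) * (c p $ j * fcoeff (\<lambda>x. complex_of_real (G x $ i $ j)) (k - p)))
     = \<i> * cdot (wavevec k) (c p) * cdot v (c (k - p))" for p
  proof -
    have "(\<Sum>i\<in>UNIV. \<Sum>j\<in>UNIV. complex_of_real (v $ i) * (c p $ j * fcoeff (\<lambda>x. complex_of_real (G x $ i $ j)) (k - p)))
      = (\<Sum>i\<in>UNIV. \<Sum>j\<in>UNIV. \<i> * (complex_of_real (wavevec (k - p) $ j) * c p $ j) * (complex_of_real (v $ i) * c (k - p) $ i))"
      unfolding fcoeff_weak_jacobian[OF uL G] c_def[symmetric] by (simp only: mult_ac)
    also have "\<dots> = \<i> * cdot (wavevec (k - p)) (c p) * cdot v (c (k - p))"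
      unfolding cdot_def sum_distrib_left sum_distrib_right by (simp only: mult_ac)
    also have "cdot (wavevec (k - p)) (c p) = cdot (wavevec k) (c p)"
      using fourier_coeff_div_free[OF u, of p] by (simp add: cdot_linear c_def)
    finally show ?thesis .
  qed
  ultimately show ?thesis unfolding advection_def c_def[symmetric] by (simp add: infsumI)
qed

text \<open>The Fourier side of the equation: every transverse component of every mode solves an ordinary
  differential equation with damping rate \<open>\<mu> exp (2 \<sigma> |k|)\<close>. All estimates in time are derived
  from these properties. At \<open>t = 0\<close> the derivative is one-sided.\<close>

locale mode_system =
  fixes \<mu> \<sigma> :: real and a :: "real \<Rightarrow> int^3 \<Rightarrow> complex^3"
  assumes mu: "\<mu> > 0" and sigma: "\<sigma> > 0"
    and zero_mode: "\<And>t. 0 \<le> t \<Longrightarrow> a t 0 = 0"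
    and div_free: "\<And>t k. 0 \<le> t \<Longrightarrow> cdot (wavevec k) (a t k) = 0"
    and reality: "\<And>t k j. a t (- k) $ j = cnj (a t k $ j)"
    and square_summable: "\<And>t. 0 \<le> t \<Longrightarrow> square_summable (a t)"
    and l2_continuous: "\<And>t. 0 \<le> t \<Longrightarrow> ((\<lambda>s. l2norm (\<lambda>k. a s k - a t k)) \<longlongrightarrow> 0) (at t within {0..})"
    and mode_derivative: "\<And>t k v. 0 \<le> t \<Longrightarrow> k \<noteq> 0 \<Longrightarrow> wavevec k \<bullet> v = 0 \<Longrightarrow>
      ((\<lambda>s. cdot v (a s k)) has_vector_derivative
        - (complex_of_real (\<mu> * exp (2 * \<sigma> * norm (wavevec k))) * cdot v (a t k) + advection (a t) k v))
      (at t within {0..})"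

text \<open>All quantities in the mode equations are continuous in time, because the change of
  each is controlled by the \<open>l2\<close> distance of the coefficients.\<close>

lemma
  fixes a :: "real \<Rightarrow> int^3 \<Rightarrow> complex^3"
  assumes ss: "\<And>t. 0 \<le> t \<Longrightarrow> square_summable (a t)"
    and cont: "\<And>t. 0 \<le> t \<Longrightarrow> ((\<lambda>s. l2norm (\<lambda>k. a s k - a t k)) \<longlongrightarrow> 0) (at t within {0..})"
  shows continuous_l2norm: "continuous_on {0..} (\<lambda>t. l2norm (a t))"
    and continuous_cdot: "continuous_on {0..} (\<lambda>t. cdot v (a t k))"
    and continuous_advection: "continuous_on {0..} (\<lambda>t. advection (a t) k v)"
proof -
  let ?d = "\<lambda>t s. l2norm (\<lambda>k. a s k - a t k)"
  have d_sym: "?d s t = ?d t s" for s t by (simp add: l2norm_def norm_minus_commute)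
  have "\<bar>l2norm (a s) - l2norm (a t)\<bar> \<le> ?d t s" if "0 \<le> s" "0 \<le> t" for s t
    using l2norm_le_add[OF ss[OF that(1)] ss[OF that(2)]] l2norm_le_add[OF ss[OF that(2)] ss[OF that(1)]]
      d_sym[of s t] by linarith
  then have ev: "\<forall>\<^sub>F s in at t within {0..}. norm (l2norm (a s) - l2norm (a t)) \<le> ?d t s" if "0 \<le> t" for t
    using that by (auto simp: eventually_at_topological intro!: exI[of _ UNIV])
  have lim: "((\<lambda>s. l2norm (a s)) \<longlongrightarrow> l2norm (a t)) (at t within {0..})" if "0 \<le> t" for t
    by (rule LIM_zero_cancel, rule Lim_null_comparison[OF ev[OF that] cont[OF that]])
  then show "continuous_on {0..} (\<lambda>t. l2norm (a t))" by (auto simp: continuous_on_def)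
  have "((\<lambda>s. cdot v (a s k)) \<longlongrightarrow> cdot v (a t k)) (at t within {0..})" if t: "0 \<le> t" for t
  proof (rule LIM_zero_cancel, rule Lim_null_comparison)
    have "norm (cdot v (a s k) - cdot v (a t k)) \<le> norm v * ?d t s" if s: "0 \<le> s" for s
    proof -
      have "norm (cdot v (a s k - a t k)) \<le> norm v * norm (a s k - a t k)" by (rule norm_cdot_le)
      also have "\<dots> \<le> norm v * ?d t s"
        by (intro mult_left_mono norm_le_l2norm[of "\<lambda>k. a s k - a t k"] square_summable_diff ss s t) simp
      finally show ?thesis by (simp add: cdot_linear)
    qed
    then show "\<forall>\<^sub>F s in at t within {0..}. norm (cdot v (a s k) - cdot v (a t k)) \<le> norm v * ?d t s"
      by (auto simp: eventually_at_topological intro!: exI[of _ UNIV])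
    show "((\<lambda>s. norm v * ?d t s) \<longlongrightarrow> 0) (at t within {0..})"
      using tendsto_mult_left[OF cont[OF t], of "norm v"] by simp
  qed
  then show "continuous_on {0..} (\<lambda>t. cdot v (a t k))" by (auto simp: continuous_on_def)
  have "((\<lambda>s. advection (a s) k v) \<longlongrightarrow> advection (a t) k v) (at t within {0..})" if t: "0 \<le> t" for t
  proof (rule LIM_zero_cancel, rule Lim_null_comparison)
    show "\<forall>\<^sub>F s in at t within {0..}. norm (advection (a s) k v - advection (a t) k v)
        \<le> norm (wavevec k) * norm v * ?d t s * (l2norm (a s) + l2norm (a t))"
      using advection_diff_bound[OF ss ss[OF t]]
      by (auto simp: eventually_at_topological intro!: exI[of _ UNIV])
    have "((\<lambda>s. norm (wavevec k) * norm v * ?d t s * (l2norm (a s) + l2norm (a t)))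
        \<longlongrightarrow> norm (wavevec k) * norm v * 0 * (l2norm (a t) + l2norm (a t))) (at t within {0..})"
      by (intro tendsto_mult tendsto_add tendsto_const cont lim t)
    then show "((\<lambda>s. norm (wavevec k) * norm v * ?d t s * (l2norm (a s) + l2norm (a t))) \<longlongrightarrow> 0) (at t within {0..})"
      by simp
  qed
  then show "continuous_on {0..} (\<lambda>t. advection (a t) k v)" by (auto simp: continuous_on_def)
qed

text \<open>The integrand \<open>F\<close> of the weak equation is only known almost everywhere; as it agrees there with
  a continuous \<open>h\<close>, the fundamental theorem of calculus applies.\<close>

lemma has_vector_derivative_of_integral_equation:
  fixes f h :: "real \<Rightarrow> real"
  assumes eq: "\<And>t. 0 \<le> t \<Longrightarrow> set_integrable lebesgue {0..t} F \<and> f t + (LINT s:{0..t}|lebesgue. F s) = c"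
    and ae: "AE s in lebesgue. s > 0 \<longrightarrow> F s = h s"
    and h: "continuous_on {0..} h" and t: "0 \<le> t"
  shows "(f has_vector_derivative - h t) (at t within {0..})"
proof -
  obtain N where N: "N \<in> null_sets lebesgue" "{s. \<not> (s > 0 \<longrightarrow> F s = h s)} \<subseteq> N"
    using ae by (auto simp: eventually_ae_filter)
  have neg: "negligible (insert 0 N)" using N(1) by (simp add: negligible_iff_null_sets negligible_insert)
  have fs: "f s = c - integral {0..s} h" if "0 \<le> s" for s
  proof -
    have "(LINT s:{0..s}|lebesgue. F s) = integral {0..s} F"
      using eq[OF that] set_lebesgue_integral_eq_integral(2) by blast
    also have "\<dots> = integral {0..s} h"
    proof (rule integral_spike[OF neg])
      fix x assume "x \<in> {0..s} - insert 0 N"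
      then have "x > 0" "x \<notin> N" by auto
      then show "h x = F x" using N(2) by auto
    qed
    finally show ?thesis using eq[OF that] by simp
  qed
  have "((\<lambda>s. integral {0..s} h) has_vector_derivative h t) (at t within {0..t + 1})"
    by (rule integral_has_vector_derivative) (use t continuous_on_subset[OF h] in auto)
  then have "((\<lambda>s. c - integral {0..s} h) has_vector_derivative 0 - h t) (at t within {0..t + 1})"
    by (intro has_vector_derivative_diff has_vector_derivative_const)
  then have "(f has_vector_derivative - h t) (at t within {0..t + 1})"
    by (rule has_vector_derivative_transform[rotated 2, THEN has_vector_derivative_eq_rhs])
       (use t fs in auto)
  moreover have "at t within {0..t + 1} = at t within {0..}"
    by (rule at_within_nhd[of _ "{..<t + 1}"]) auto
  ultimately show ?thesis by simp
qed

lemma L2_inner_diff_left: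
  assumes "f \<in> L2_per" "g \<in> L2_per" "h \<in> L2_per"
  shows "L2_inner (\<lambda>x. f x - g x) h = L2_inner f h - L2_inner g h"
  unfolding L2_inner_torus inner_diff_left
  by (intro Bochner_Integration.integral_diff L2_bilinear_integrable[OF bounded_bilinear_inner] assms)

text \<open>The weak equation is tested with the cosine and sine modes of frequency \<open>k\<close> and polarization
  \<open>v\<close>, which give the real and the imaginary part of the mode equation.\<close>

theorem weak_solution_mode_system:
  assumes mu: "\<mu> > 0" and sigma: "\<sigma> > 0" and sol: "weak_solution \<mu> \<sigma> u0 u"
  shows "mode_system \<mu> \<sigma> (\<lambda>t. fourier_coeff (u t))"
proof -
  define a where "a t = fourier_coeff (u t)" for t
  have cont: "continuous_in_H T u" if "T > 0" for T
    using sol that by (simp add: weak_solution_def)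
  have uH: "u t \<in> H" if "0 \<le> t" for t
    using cont[of "t + 1"] that by (auto simp: continuous_in_H_def)
  have ss: "square_summable (a t)" if "0 \<le> t" for t
    unfolding a_def by (intro fourier_coeff_square_summable H_L2 uH that)
  have l2c: "((\<lambda>s. l2norm (\<lambda>k. a s k - a t k)) \<longlongrightarrow> 0) (at t within {0..})" if t: "0 \<le> t" for t
  proof (rule Lim_null_comparison)
    have "l2norm (\<lambda>k. a s k - a t k) \<le> L2_norm (\<lambda>x. u s x - u t x)" if s: "0 \<le> s" for s
      using fourier_coeff_square_summable(2)[OF L2_diff[OF H_L2[OF uH[OF s]] H_L2[OF uH[OF t]]]]
      unfolding fourier_coeff_diff[OF H_L2[OF uH[OF s]] H_L2[OF uH[OF t]]] a_def by simp
    then show "\<forall>\<^sub>F s in at t within {0..}. norm (l2norm (\<lambda>k. a s k - a t k)) \<le> L2_norm (\<lambda>x. u s x - u t x)"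
      by (auto simp: eventually_at_topological intro!: exI[of _ UNIV])
    have "((\<lambda>s. L2_norm (\<lambda>x. u s x - u t x)) \<longlongrightarrow> 0) (at t within {0..t + 1})"
      using cont[of "t + 1"] t by (simp add: continuous_in_H_def)
    moreover have "at t within {0..t + 1} = at t within {0..}"
      by (rule at_within_nhd[of _ "{..<t + 1}"]) auto
    ultimately show "((\<lambda>s. L2_norm (\<lambda>x. u s x - u t x)) \<longlongrightarrow> 0) (at t within {0..})" by simp
  qed
  obtain w b where ae: "AE s in lebesgue. s > 0 \<longrightarrow> exp_sqrtA \<sigma> (u s) (w s) \<and> bilinear_B (u s) (u s) (b s)"
    and eq: "\<And>\<phi> \<psi> t. exp_sqrtA \<sigma> \<phi> \<psi> \<Longrightarrow> 0 \<le> t \<Longrightarrow>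
       set_integrable lebesgue {0..t} (\<lambda>s. \<mu> * L2_inner (w s) \<psi> + L2_inner (b s) \<phi>) \<and>
       L2_inner (u t) \<phi> + (LINT s:{0..t}|lebesgue. \<mu> * L2_inner (w s) \<psi> + L2_inner (b s) \<phi>) = L2_inner u0 \<phi>"
    using sol unfolding weak_solution_def by blast
  have deriv: "((\<lambda>s. cdot v (a s k)) has_vector_derivative
        - (complex_of_real (\<mu> * exp (2 * \<sigma> * norm (wavevec k))) * cdot v (a t k) + advection (a t) k v))
      (at t within {0..})" if t: "0 \<le> t" and k: "k \<noteq> 0" and v: "wavevec k \<bullet> v = 0" for t k v
  proof -
    define V :: real where "V = (2 * pi) ^ 3"
    have V: "V > 0" by (simp add: V_def)
    define \<nu> where "\<nu> = \<mu> * exp (2 * \<sigma> * norm (wavevec k))"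
    define g where "g s = complex_of_real \<nu> * cdot v (a s k) + advection (a s) k v" for s
    have cg: "continuous_on {0..} g"
      unfolding g_def by (intro continuous_intros continuous_cdot continuous_advection ss l2c)
    define e where "e = exp (\<sigma> * norm (wavevec k))"
    have ee: "\<mu> * (e * e) = \<nu>" by (simp add: e_def \<nu>_def flip: exp_add)
    have key: "AE s in lebesgue. s > 0 \<longrightarrow>
        cdot v (fourier_coeff (w s) k) = e * cdot v (a s k) \<and> w s \<in> H \<and>
        (\<exists>f. f \<in> L2_per \<and> (\<forall>h\<in>H. L2_inner (b s) h = L2_inner f h) \<and>
           cdot v (fourier_coeff f k) = advection (a s) k v)"
      using ae
    proof eventually_elim
      case (elim s)
      show ?case
      proof
        assume "s > 0"
        then have E: "exp_sqrtA \<sigma> (u s) (w s)" and B: "bilinear_B (u s) (u s) (b s)" using elim by auto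
        have us: "u s \<in> H" and wH: "w s \<in> H" using E by (auto simp: exp_sqrtA_def)
        have rel: "fourier_coeff (w s) p = exp (\<sigma> * norm (wavevec p)) *\<^sub>R a s p" if "p \<noteq> 0" for p
          using E that by (simp add: exp_sqrtA_def a_def)
        obtain G where G: "weak_jacobian (u s) G" "leray (\<lambda>x. G x *v u s x) (b s)"
          using B by (auto simp: bilinear_B_def)
        have sw: "square_summable (fourier_coeff (w s))"
          by (rule fourier_coeff_square_summable(1)[OF H_L2[OF wH]])
        have "(\<lambda>p. l2norm (fourier_coeff (w s)) * exp (- \<sigma> * norm (wavevec p))) summable_on UNIV"
          by (rule summable_on_cmult_right[OF summable_lattice_exp[OF sigma]])
        then have sm: "(\<lambda>p. norm (a s p)) summable_on UNIV"
        proof (rule summable_on_comparison_test)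
          fix p :: "int^3"
          show "norm (a s p) \<le> l2norm (fourier_coeff (w s)) * exp (- \<sigma> * norm (wavevec p))"
          proof (cases "p = 0")
            case True
            then show ?thesis using fourier_coeff_0[OF us] by (simp add: a_def)
          next
            case False
            have "a s p = exp (- \<sigma> * norm (wavevec p)) *\<^sub>R fourier_coeff (w s) p"
              unfolding rel[OF False] by (simp flip: exp_add)
            then have "norm (a s p) = exp (- \<sigma> * norm (wavevec p)) * norm (fourier_coeff (w s) p)" by simp
            also have "\<dots> \<le> exp (- \<sigma> * norm (wavevec p)) * l2norm (fourier_coeff (w s))"
              by (intro mult_left_mono norm_le_l2norm sw) simp
            finally show ?thesis by (simp add: mult.commute)
          qed
        qed simp
        have fL: "(\<lambda>x. G x *v u s x) \<in> L2_per" and bH: "b s \<in> H"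
          and orth: "\<And>h. h \<in> H \<Longrightarrow> L2_inner (\<lambda>x. G x *v u s x - b s x) h = 0"
          using G(2) by (auto simp: leray_def)
        have "L2_inner (b s) h = L2_inner (\<lambda>x. G x *v u s x) h" if "h \<in> H" for h
          using orth[OF that] L2_inner_diff_left[OF fL H_L2[OF bH] H_L2[OF that]] by simp
        moreover have "cdot v (fourier_coeff (\<lambda>x. G x *v u s x) k) = advection (a s) k v"
          unfolding fcoeff_inner[OF fL, symmetric] a_def
          by (rule fcoeff_nonlinear[OF us sm[unfolded a_def] G(1)])
        moreover have "cdot v (fourier_coeff (w s) k) = e * cdot v (a s k)"
          unfolding rel[OF k] e_def by (simp only: cdot_linear)
        ultimately show "cdot v (fourier_coeff (w s) k) = e * cdot v (a s k) \<and> w s \<in> H \<and>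
          (\<exists>f. f \<in> L2_per \<and> (\<forall>h\<in>H. L2_inner (b s) h = L2_inner f h) \<and>
           cdot v (fourier_coeff f k) = advection (a s) k v)"
          using wH fL by blast
      qed
    qed
    have scale: "L2_inner f (\<lambda>x. e *\<^sub>R h x) = e * L2_inner f h" for f h
      by (simp add: L2_inner_torus)
    let ?c = "\<lambda>x. cos (wavevec k \<bullet> x) *\<^sub>R v" and ?s = "\<lambda>x. sin (wavevec k \<bullet> x) *\<^sub>R v"
    note cH = cos_mode_in_H[OF k v] and sH = sin_mode_in_H[OF k v]
    have c1: "exp_sqrtA \<sigma> ?c (\<lambda>x. e *\<^sub>R ?c x)" and s1: "exp_sqrtA \<sigma> ?s (\<lambda>x. e *\<^sub>R ?s x)"
      unfolding e_def by (intro exp_sqrtA_eigenmode cH sH fourier_coeff_cos_mode fourier_coeff_sin_mode; assumption)+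
    have "AE s in lebesgue. s > 0 \<longrightarrow>
        \<mu> * L2_inner (w s) (\<lambda>x. e *\<^sub>R ?c x) + L2_inner (b s) ?c = V * Re (g s) \<and>
        \<mu> * L2_inner (w s) (\<lambda>x. e *\<^sub>R ?s x) + L2_inner (b s) ?s = - V * Im (g s)"
      using key
    proof (eventually_elim, intro impI conjI)
      fix s :: real assume A: "s > 0 \<longrightarrow> cdot v (fourier_coeff (w s) k) = e * cdot v (a s k) \<and> w s \<in> H \<and>
        (\<exists>f. f \<in> L2_per \<and> (\<forall>h\<in>H. L2_inner (b s) h = L2_inner f h) \<and>
           cdot v (fourier_coeff f k) = advection (a s) k v)" and "s > 0"
      then obtain f where f: "f \<in> L2_per" "\<And>h. h \<in> H \<Longrightarrow> L2_inner (b s) h = L2_inner f h"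
        "cdot v (fourier_coeff f k) = advection (a s) k v"
        and w: "cdot v (fourier_coeff (w s) k) = e * cdot v (a s k)" "w s \<in> H" by blast
      note m = L2_inner_mode[OF f(1), of k v, folded V_def] L2_inner_mode[OF H_L2[OF w(2)], of k v, folded V_def]
      have "\<mu> * L2_inner (w s) (\<lambda>x. e *\<^sub>R ?c x) + L2_inner (b s) ?c = V * (\<mu> * (e * e) * Re (cdot v (a s k)) + Re (advection (a s) k v))"
        unfolding scale f(2)[OF cH] m f(3) w(1) by (simp add: algebra_simps)
      then show "\<mu> * L2_inner (w s) (\<lambda>x. e *\<^sub>R ?c x) + L2_inner (b s) ?c = V * Re (g s)"
        unfolding ee by (simp add: g_def)
      have "\<mu> * L2_inner (w s) (\<lambda>x. e *\<^sub>R ?s x) + L2_inner (b s) ?s = - V * (\<mu> * (e * e) * Im (cdot v (a s k)) + Im (advection (a s) k v))"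
        unfolding scale f(2)[OF sH] m f(3) w(1) by (simp add: algebra_simps)
      then show "\<mu> * L2_inner (w s) (\<lambda>x. e *\<^sub>R ?s x) + L2_inner (b s) ?s = - V * Im (g s)"
        unfolding ee by (simp add: g_def)
    qed
    then have aec: "AE s in lebesgue. s > 0 \<longrightarrow> \<mu> * L2_inner (w s) (\<lambda>x. e *\<^sub>R ?c x) + L2_inner (b s) ?c = V * Re (g s)"
      and aes: "AE s in lebesgue. s > 0 \<longrightarrow> \<mu> * L2_inner (w s) (\<lambda>x. e *\<^sub>R ?s x) + L2_inner (b s) ?s = - V * Im (g s)"
      by (eventually_elim, blast)+
    have "((\<lambda>t. L2_inner (u t) ?c) has_vector_derivative - (V * Re (g t))) (at t within {0..})"
      by (rule has_vector_derivative_of_integral_equation[OF eq[OF c1] aec])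
         (use cg t in \<open>auto intro!: continuous_intros\<close>)
    then have "((\<lambda>t. V * Re (cdot v (a t k))) has_vector_derivative - (V * Re (g t))) (at t within {0..})"
      by (rule has_vector_derivative_transform[rotated 2])
         (use t L2_inner_mode(1)[OF H_L2[OF uH]] in \<open>auto simp: V_def a_def\<close>)
    from has_vector_derivative_mult_right[OF this, of "1 / V"]
    have R: "((\<lambda>t. Re (cdot v (a t k))) has_vector_derivative Re (- g t)) (at t within {0..})"
      using V by simp
    have "((\<lambda>t. L2_inner (u t) ?s) has_vector_derivative - (- V * Im (g t))) (at t within {0..})"
      by (rule has_vector_derivative_of_integral_equation[OF eq[OF s1] aes])
         (use cg t in \<open>auto intro!: continuous_intros\<close>)
    then have "((\<lambda>t. - V * Im (cdot v (a t k))) has_vector_derivative - (- V * Im (g t))) (at t within {0..})"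
      by (rule has_vector_derivative_transform[rotated 2])
         (use t L2_inner_mode(2)[OF H_L2[OF uH]] in \<open>auto simp: V_def a_def\<close>)
    from has_vector_derivative_mult_right[OF this, of "- 1 / V"]
    have I: "((\<lambda>t. Im (cdot v (a t k))) has_vector_derivative Im (- g t)) (at t within {0..})"
      using V by simp
    have "((\<lambda>t. cdot v (a t k)) has_vector_derivative - g t) (at t within {0..})"
      unfolding has_vector_derivative_complex_iff
      using R I by (simp add: has_real_derivative_iff_has_vector_derivative)
    then show ?thesis by (simp add: g_def \<nu>_def)
  qed
  show ?thesis
    unfolding a_def[abs_def, symmetric]
  proof
    show "a t (- k) $ j = cnj (a t k $ j)" for t k j by (simp add: a_def fourier_coeff_uminus)
  qed (use mu sigma uH ss l2c deriv fourier_coeff_0 fourier_coeff_div_free in \<open>auto simp: a_def\<close>)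
qed

section \<open>Smoothing by the damping\<close>

text \<open>Variation of constants: \<open>exp (\<nu> s) f s\<close> has derivative \<open>- exp (\<nu> s) h s\<close>.\<close>

lemma damped_ode_bound:
  fixes f h :: "real \<Rightarrow> complex"
  assumes nu: "\<nu> > 0" and t: "0 \<le> t1" "t1 \<le> t2"
    and f: "\<And>s. 0 \<le> s \<Longrightarrow> (f has_vector_derivative - (complex_of_real \<nu> * f s + h s)) (at s within {0..})"
    and h: "\<And>s. t1 \<le> s \<Longrightarrow> s \<le> t2 \<Longrightarrow> norm (h s) \<le> Y"
  shows "norm (f t2) \<le> exp (- \<nu> * (t2 - t1)) * norm (f t1) + Y / \<nu>"
proof (cases "t1 = t2")
  case True
  have "0 \<le> Y" using order_trans[OF norm_ge_zero h[of t1]] t by simp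
  then show ?thesis using True nu by simp
next
  case False
  then have t12: "t1 < t2" using t by simp
  have Y: "0 \<le> Y" using order_trans[OF norm_ge_zero h[of t1]] t by simp
  define F where "F s = complex_of_real (exp (\<nu> * s)) * f s" for s
  have cf: "continuous_on {0..} f"
    using f has_vector_derivative_continuous by (fastforce simp: continuous_on_eq_continuous_within)
  have "norm (F t2 - F t1) \<le> Y / \<nu> * exp (\<nu> * t2) - Y / \<nu> * exp (\<nu> * t1)"
  proof (rule differentiable_bound_general[OF t12, where f' = "\<lambda>s. - complex_of_real (exp (\<nu> * s)) * h s"
        and \<phi>' = "\<lambda>s. Y * exp (\<nu> * s)" and \<phi> = "\<lambda>s. Y / \<nu> * exp (\<nu> * s)" and f = F])
    show "continuous_on {t1..t2} F" unfolding F_def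
      by (intro continuous_intros continuous_on_subset[OF cf]) (use t in auto)
    show "continuous_on {t1..t2} (\<lambda>s. Y / \<nu> * exp (\<nu> * s))" by (intro continuous_intros)
  next
    fix s assume s: "t1 < s" "s < t2"
    have "at s within {0..} = at s" using s t by (intro at_within_nhd[of _ "{0<..}"]) auto
    then have fs: "(f has_vector_derivative - (complex_of_real \<nu> * f s + h s)) (at s)"
      using f[of s] s t by simp
    have "((\<lambda>s. exp (\<nu> * s) *\<^sub>R f s) has_vector_derivative
        exp (\<nu> * s) *\<^sub>R (- (complex_of_real \<nu> * f s + h s)) + (exp (\<nu> * s) * \<nu>) *\<^sub>R f s) (at s)"
      by (intro has_vector_derivative_scaleR fs) (auto intro!: derivative_eq_intros)
    then show "(F has_vector_derivative - complex_of_real (exp (\<nu> * s)) * h s) (at s)"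
      unfolding F_def[abs_def] by (simp add: scaleR_conv_of_real algebra_simps)
    show "((\<lambda>s. Y / \<nu> * exp (\<nu> * s)) has_vector_derivative Y * exp (\<nu> * s)) (at s)"
      unfolding has_real_derivative_iff_has_vector_derivative[symmetric]
      using nu by (auto intro!: derivative_eq_intros)
    show "norm (- complex_of_real (exp (\<nu> * s)) * h s) \<le> Y * exp (\<nu> * s)"
      using h[of s] s by (simp add: norm_mult)
  qed
  then have "norm (F t2) \<le> norm (F t1) + Y / \<nu> * exp (\<nu> * t2)"
    using norm_triangle_sub[of "F t2" "F t1"] Y nu
    by (smt (verit) divide_nonneg_pos exp_ge_zero mult_nonneg_nonneg)
  then have "exp (\<nu> * t2) * norm (f t2) \<le> exp (\<nu> * t1) * norm (f t1) + Y / \<nu> * exp (\<nu> * t2)"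
    by (simp add: F_def norm_mult)
  then have exp_le: "exp (- \<nu> * t2) * (exp (\<nu> * t2) * norm (f t2)) \<le> exp (- \<nu> * t2) * (exp (\<nu> * t1) * norm (f t1) + Y / \<nu> * exp (\<nu> * t2))"
    by (intro mult_left_mono) auto
  have "exp (- \<nu> * t2) * exp (\<nu> * t2) = 1" "exp (- \<nu> * t2) * exp (\<nu> * t1) = exp (- \<nu> * (t2 - t1))"
    unfolding mult_exp_exp by (simp_all add: algebra_simps)
  then have "exp (- \<nu> * t2) * (exp (\<nu> * t2) * x) = x" "exp (- \<nu> * t2) * (exp (\<nu> * t1) * x) = exp (- \<nu> * (t2 - t1)) * x" for x
    by (simp_all only: mult.assoc[symmetric] mult_1_left)
  note e = this
  from exp_le have "exp (- \<nu> * t2) * (exp (\<nu> * t2) * norm (f t2))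
      \<le> exp (- \<nu> * t2) * (exp (\<nu> * t1) * norm (f t1)) + exp (- \<nu> * t2) * (exp (\<nu> * t2) * (Y / \<nu>))"
    unfolding distrib_left mult.commute[of "Y / \<nu>" "exp (\<nu> * t2)"] .
  then show ?thesis unfolding e .
qed

text \<open>The projection of the \<open>j\<close>-th unit vector onto the plane perpendicular to \<open>k\<close>. Paired with a
  vector that is itself perpendicular to \<open>k\<close> it returns the \<open>j\<close>-th component.\<close>

definition transverse :: "int^3 \<Rightarrow> 3 \<Rightarrow> real^3" where
  "transverse k j = axis j 1 - (wavevec k $ j / (norm (wavevec k))\<^sup>2) *\<^sub>R wavevec k"

lemma
  assumes "k \<noteq> 0"
  shows inner_transverse: "wavevec k \<bullet> transverse k j = 0"
    and norm_transverse: "norm (transverse k j) \<le> 1"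
proof -
  have n: "wavevec k \<bullet> wavevec k = (norm (wavevec k))\<^sup>2" "norm (wavevec k) \<noteq> 0"
    using assms by (auto simp: power2_norm_eq_inner)
  show o: "wavevec k \<bullet> transverse k j = 0"
    using n by (simp add: transverse_def inner_diff_right inner_axis)
  have "(norm (transverse k j))\<^sup>2 = transverse k j \<bullet> axis j 1"
  proof -
    have "transverse k j \<bullet> transverse k j = transverse k j \<bullet> axis j 1 - wavevec k $ j / (norm (wavevec k))\<^sup>2 * (transverse k j \<bullet> wavevec k)"
      by (subst (2) transverse_def) (simp add: inner_diff_right)
    then show ?thesis using o by (simp add: power2_norm_eq_inner inner_commute)
  qed
  also have "\<dots> = 1 - (wavevec k $ j)\<^sup>2 / (norm (wavevec k))\<^sup>2"
    by (simp add: transverse_def inner_diff_left inner_axis power2_eq_square)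
  also have "\<dots> \<le> 1" by simp
  finally show "norm (transverse k j) \<le> 1" by (simp add: power_le_one_iff)
qed

lemma cdot_transverse:
  assumes "cdot (wavevec k) z = 0"
  shows "cdot (transverse k j) z = z $ j"
  using assms by (simp add: transverse_def cdot_linear)

lemma norm_le_transverse:
  assumes z: "cdot (wavevec k) z = 0" and X: "\<And>j. norm (cdot (transverse k j) z) \<le> X"
  shows "norm z \<le> 3 * X"
proof -
  have "norm z \<le> (\<Sum>j\<in>UNIV. norm (z $ j))" unfolding norm_vec_def by (rule L2_set_le_sum) simp
  also have "\<dots> \<le> (\<Sum>j\<in>(UNIV::3 set). X)"
    using X by (intro sum_mono) (simp add: cdot_transverse[OF z])
  finally show ?thesis by simp
qed

definition conv :: "(int^3 \<Rightarrow> complex^3) \<Rightarrow> int^3 \<Rightarrow> real" where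
  "conv x k = (\<Sum>\<^sub>\<infinity>p. norm (x p) * norm (x (k - p)))"

lemma conv_le: "square_summable x \<Longrightarrow> conv x k \<le> l2norm x * l2norm x"
  unfolding conv_def by (rule convolution_bound(2))

lemma norm_wavevec_ge_1: "k \<noteq> 0 \<Longrightarrow> 1 \<le> norm (wavevec k)"
proof -
  assume "k \<noteq> 0"
  then obtain j where "k $ j \<noteq> 0" by (auto simp: vec_eq_iff)
  then have "1 \<le> \<bar>wavevec k $ j\<bar>" by simp
  also have "\<dots> \<le> norm (wavevec k)" by (rule component_le_norm_cart)
  finally show ?thesis .
qed

lemma mult_exp_minus_le: "c > 0 \<Longrightarrow> x * exp (- c * x) \<le> 1 / (c::real)"
proof -
  assume c: "c > 0"
  have "c * x \<le> exp (c * x)" using exp_ge_add_one_self[of "c * x"] by linarith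
  then have "c * x * exp (- c * x) \<le> exp (c * x) * exp (- c * x)" by (intro mult_right_mono) auto
  then show ?thesis using c by (simp add: mult_exp_exp field_simps)
qed

context mode_system
begin

abbreviation damping :: "int^3 \<Rightarrow> real" where
  "damping k \<equiv> \<mu> * exp (2 * \<sigma> * norm (wavevec k))"

lemma damping_pos: "damping k > 0" using mu by simp

lemma advection_le:
  assumes "0 \<le> s" "norm v \<le> 1"
  shows "norm (advection (a s) k v) \<le> norm (wavevec k) * conv (a s) k"
proof -
  note cs = convolution_bound(1)[OF square_summable square_summable, OF assms(1) assms(1), of k]
  have c0: "0 \<le> conv (a s) k" unfolding conv_def by (intro infsum_nonneg) simp
  have "norm (advection (a s) k v) \<le> norm (wavevec k) * norm v * conv (a s) k"
    unfolding advection_def conv_def by (rule convolution_summable(2)[OF cs])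
  also have "\<dots> \<le> norm (wavevec k) * 1 * conv (a s) k"
    by (intro mult_right_mono mult_left_mono assms c0) simp
  finally show ?thesis by simp
qed

text \<open>The elementary step of the regularity theory: after a waiting time \<open>t2 - t1\<close> both the initial
  value and the forcing are divided by the damping rate. For the initial value this uses
  \<open>exp (- x) \<le> 1 / x\<close>, which gives away most of the decay but keeps the dependence on the waiting
  time algebraic.\<close>

lemma mode_bound:
  assumes k: "k \<noteq> 0" and t: "0 \<le> t1" "t1 < t2"
    and C: "\<And>s. t1 \<le> s \<Longrightarrow> s \<le> t2 \<Longrightarrow> conv (a s) k \<le> C"
  shows "norm (a t2 k) \<le> 3 / damping k * (norm (a t1 k) / (t2 - t1) + norm (wavevec k) * C)"
proof -
  have "norm (cdot (transverse k j) (a t2 k)) \<le> (norm (a t1 k) / (t2 - t1) + norm (wavevec k) * C) / damping k" for j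
  proof -
    let ?v = "transverse k j"
    have "norm (cdot ?v (a t2 k)) \<le> exp (- damping k * (t2 - t1)) * norm (cdot ?v (a t1 k)) + (norm (wavevec k) * C) / damping k"
    proof (rule damped_ode_bound[OF damping_pos])
      fix s assume s: "t1 \<le> s" "s \<le> t2"
      then show "norm (advection (a s) k ?v) \<le> norm (wavevec k) * C"
        using advection_le[of s ?v k] norm_transverse[OF k] t C[OF s]
        by (meson dual_order.trans mult_left_mono norm_ge_zero)
    qed (use t mode_derivative[OF _ k inner_transverse[OF k]] in auto)
    also have "exp (- damping k * (t2 - t1)) * norm (cdot ?v (a t1 k)) \<le> 1 / (damping k * (t2 - t1)) * norm (a t1 k)"
    proof (intro mult_mono)
      have "1 * exp (- (damping k * (t2 - t1)) * 1) \<le> 1 / (damping k * (t2 - t1))"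
        by (rule mult_exp_minus_le) (use t damping_pos in simp)
      then show "exp (- damping k * (t2 - t1)) \<le> 1 / (damping k * (t2 - t1))" by simp
      show "norm (cdot ?v (a t1 k)) \<le> norm (a t1 k)"
        using norm_cdot_le[of ?v "a t1 k"] norm_transverse[OF k, of j]
        by (meson mult_left_le_one_le norm_ge_zero order_trans)
    qed (use t mu in auto)
    also have "1 / (damping k * (t2 - t1)) * norm (a t1 k) + (norm (wavevec k) * C) / damping k
       = (norm (a t1 k) / (t2 - t1) + norm (wavevec k) * C) / damping k"
      by (simp add: add_divide_distrib)
    finally show ?thesis by simp
  qed
  then have "norm (a t2 k) \<le> 3 * ((norm (a t1 k) / (t2 - t1) + norm (wavevec k) * C) / damping k)"
    using t by (intro norm_le_transverse[OF div_free]) auto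
  then show ?thesis by simp
qed

lemma l2norm_continuous: "continuous_on {0..} (\<lambda>t. l2norm (a t))"
  by (rule continuous_l2norm[OF square_summable l2_continuous])

lemma l2norm_bounded_on:
  obtains M where "M > 0" "\<And>s. 0 \<le> s \<Longrightarrow> s \<le> T \<Longrightarrow> l2norm (a s) \<le> M"
proof -
  have "bounded ((\<lambda>t. l2norm (a t)) ` {0..T})"
    by (intro compact_imp_bounded compact_continuous_image continuous_on_subset[OF l2norm_continuous]) auto
  then obtain B where "\<forall>x\<in>(\<lambda>t. l2norm (a t)) ` {0..T}. norm x \<le> B"
    by (auto simp only: bounded_iff)
  then have B: "l2norm (a s) \<le> B" if "s \<in> {0..T}" for s using that by force
  show ?thesis by (rule that[of "max 1 B"]) (use B in force)+
qed

text \<open>One application of the elementary step. The constant depends on \<open>T\<close> because a bound on the energy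
  that is uniform in time is only available after the energy estimate, which needs this lemma.\<close>

lemma decay_on_interval:
  assumes t0: "0 < t0"
  obtains C where "C > 0" "\<And>s k. t0 \<le> s \<Longrightarrow> s \<le> T \<Longrightarrow> norm (a s k) \<le> C * exp (- \<sigma> * norm (wavevec k))"
proof -
  obtain M where M: "M > 0" "\<And>s. 0 \<le> s \<Longrightarrow> s \<le> T \<Longrightarrow> l2norm (a s) \<le> M"
    using l2norm_bounded_on by blast
  define C where "C = 3 / \<mu> * (M / t0 + M * M / \<sigma>)"
  have C: "C > 0" using M(1) t0 mu sigma by (simp add: C_def add_pos_pos)
  have "norm (a s k) \<le> C * exp (- \<sigma> * norm (wavevec k))" if s: "t0 \<le> s" "s \<le> T" for s k
  proof (cases "k = 0")
    case True
    then show ?thesis using zero_mode[of s] s t0 C by simp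
  next
    case False
    let ?K = "norm (wavevec k)"
    have cv: "conv (a r) k \<le> M * M" if "0 \<le> r" "r \<le> s" for r
    proof (rule order_trans[OF conv_le[OF square_summable[OF that(1)]]])
      have "l2norm (a r) \<le> M" using M(2) that s by simp
      then show "l2norm (a r) * l2norm (a r) \<le> M * M" using M(1) by (intro mult_mono) auto
    qed
    have "norm (a s k) \<le> 3 / damping k * (norm (a 0 k) / (s - 0) + ?K * (M * M))"
      by (rule mode_bound[OF False]) (use s t0 cv in auto)
    also have "\<dots> \<le> 3 / damping k * (M / t0 + ?K * (M * M))"
    proof (intro mult_left_mono add_right_mono)
      have "norm (a 0 k) \<le> M" using norm_le_l2norm[OF square_summable, of 0 k] M(2)[of 0] s t0 by linarith
      then show "norm (a 0 k) / (s - 0) \<le> M / t0" using s t0 M(1) by (intro frac_le) auto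
    qed (use mu in simp)
    also have "\<dots> = 3 / \<mu> * (exp (- \<sigma> * ?K) * (M / t0) + ?K * exp (- \<sigma> * ?K) * (M * M)) * exp (- \<sigma> * ?K)"
    proof -
      have e: "exp (- \<sigma> * ?K) * exp (- \<sigma> * ?K) = 1 / exp (2 * \<sigma> * ?K)"
        by (simp add: mult_exp_exp exp_minus[symmetric] inverse_eq_divide[symmetric])
      have "3 / damping k * (M / t0 + ?K * (M * M)) = 3 / \<mu> * (M / t0 + ?K * (M * M)) * (1 / exp (2 * \<sigma> * ?K))"
        by simp
      then show ?thesis unfolding e[symmetric] by (simp only: distrib_left distrib_right mult_ac)
    qed
    also have "\<dots> \<le> 3 / \<mu> * (1 * (M / t0) + 1 / \<sigma> * (M * M)) * exp (- \<sigma> * ?K)"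
      by (intro mult_right_mono mult_left_mono add_mono mult_exp_minus_le sigma)
         (use mu M(1) t0 sigma in auto)
    also have "\<dots> = C * exp (- \<sigma> * ?K)" by (simp add: C_def)
    finally show ?thesis .
  qed
  then show ?thesis using that C by blast
qed

end

section \<open>Decay of the energy\<close>

definition bil :: "complex^3 \<Rightarrow> complex^3 \<Rightarrow> complex" where
  "bil y z = (\<Sum>j\<in>UNIV. y $ j * z $ j)"

lemma bil_commute: "bil y z = bil z y" by (simp add: bil_def mult.commute)

lemma norm_bil_le: "norm (bil y z) \<le> norm y * norm z"
proof -
  have "norm (bil y z) \<le> (\<Sum>j\<in>UNIV. \<bar>norm (y $ j)\<bar> * \<bar>norm (z $ j)\<bar>)"
    unfolding bil_def by (rule order_trans[OF norm_sum]) (simp add: norm_mult)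
  also have "\<dots> \<le> norm y * norm z" unfolding norm_vec_def by (rule L2_set_mult_ineq)
  finally show ?thesis .
qed

context mode_system
begin

text \<open>Minus twice the real part is the contribution of the frequencies \<open>p\<close> and \<open>k - p\<close> to the rate of
  change of the energy of mode \<open>k\<close>. The conjugate of \<open>a s k\<close> is written as \<open>a s (- k)\<close>, which makes
  the antisymmetry below visible.\<close>

definition triad :: "real \<Rightarrow> int^3 \<Rightarrow> int^3 \<Rightarrow> complex" where
  "triad s k p = \<i> * cdot (wavevec k) (a s p) * bil (a s (k - p)) (a s (- k))"

lemma norm_reality: "norm (a s (- k)) = norm (a s k)"
  by (simp add: norm_vec_def reality)

lemma norm_triad_le:
  "norm (triad s k p) \<le> norm (wavevec k) * norm (a s k) * (norm (a s p) * norm (a s (k - p)))"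
proof -
  have "norm (cdot (wavevec k) (a s p)) * norm (bil (a s (k - p)) (a s (- k)))
      \<le> (norm (wavevec k) * norm (a s p)) * (norm (a s (k - p)) * norm (a s (- k)))"
    by (intro mult_mono norm_cdot_le norm_bil_le) auto
  also have "\<dots> = norm (wavevec k) * norm (a s k) * (norm (a s p) * norm (a s (k - p)))"
    unfolding norm_reality by (simp only: mult_ac)
  finally show ?thesis unfolding triad_def norm_mult norm_ii mult_1_left .
qed

text \<open>Energy conservation by the advection term: \<open>p\<close> carries the energy that \<open>p - k\<close> loses to \<open>k\<close>.\<close>

lemma triad_antisymmetric:
  assumes "0 \<le> s" shows "triad s (p - k) p = - triad s k p"
  using div_free[OF assms, of p]
  by (simp add: triad_def cdot_linear bil_commute[of "a s (- k)"])

text \<open>The map that sends \<open>(k, p)\<close> to \<open>(p - k, p)\<close> is an involution which changes the sign of the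
  triad, so the absolutely convergent double sum is its own negative.\<close>

lemma triad_sums:
  assumes s: "0 \<le> s" and m: "(\<lambda>k. norm (wavevec k) * norm (a s k)) summable_on UNIV"
  shows "(\<lambda>k. \<Sum>\<^sub>\<infinity>p. triad s k p) summable_on UNIV"
    and "(\<Sum>\<^sub>\<infinity>k. \<Sum>\<^sub>\<infinity>p. triad s k p) = 0"
    and "norm (\<Sum>\<^sub>\<infinity>p. triad s k p) \<le> norm (wavevec k) * norm (a s k) * (l2norm (a s) * l2norm (a s))"
proof -
  note cs = convolution_bound[OF square_summable square_summable, OF s s]
  have cs': "((\<lambda>p. norm (wavevec k) * norm (a s k) * (norm (a s p) * norm (a s (k - p)))) has_sum
      norm (wavevec k) * norm (a s k) * conv (a s) k) UNIV" for k
    unfolding conv_def by (intro has_sum_cmult_right has_sum_infsum cs)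
  have inner: "(\<lambda>p. norm (triad s k p)) summable_on UNIV" for k
    by (rule summable_on_comparison_test[OF has_sum_imp_summable[OF cs']])
       (rule norm_triad_le, rule norm_ge_zero)
  show b: "norm (\<Sum>\<^sub>\<infinity>p. triad s k p) \<le> norm (wavevec k) * norm (a s k) * (l2norm (a s) * l2norm (a s))" for k
  proof -
    have "norm (\<Sum>\<^sub>\<infinity>p. triad s k p) \<le> norm (wavevec k) * norm (a s k) * conv (a s) k"
      by (rule norm_infsum_le[OF has_sum_infsum cs' norm_triad_le])
         (rule abs_summable_summable[OF inner])
    also have "\<dots> \<le> norm (wavevec k) * norm (a s k) * (l2norm (a s) * l2norm (a s))"
      by (intro mult_left_mono conv_le square_summable s) simp
    finally show ?thesis .
  qed
  have "(\<lambda>k. norm (wavevec k) * norm (a s k) * conv (a s) k) summable_on UNIV"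
  proof (rule summable_on_comparison_test)
    show "(\<lambda>k. norm (wavevec k) * norm (a s k) * (l2norm (a s) * l2norm (a s))) summable_on UNIV"
      by (rule summable_on_cmult_left[OF m])
    show "norm (wavevec k) * norm (a s k) * conv (a s) k \<le> norm (wavevec k) * norm (a s k) * (l2norm (a s) * l2norm (a s))" for k
      by (intro mult_left_mono conv_le square_summable s) simp
    show "0 \<le> norm (wavevec k) * norm (a s k) * conv (a s) k" for k
      unfolding conv_def by (intro mult_nonneg_nonneg infsum_nonneg) auto
  qed
  then have "(\<lambda>(k, p). norm (wavevec k) * norm (a s k) * (norm (a s p) * norm (a s (k - p)))) summable_on UNIV \<times> UNIV"
    by (rule summable_on_SigmaI[rotated]) (use cs' in auto)
  then have "(\<lambda>kp. norm (case kp of (k, p) \<Rightarrow> triad s k p)) summable_on UNIV \<times> UNIV"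
    by (rule summable_on_comparison_test) (auto simp: norm_triad_le)
  then have ps: "(\<lambda>(k, p). triad s k p) summable_on UNIV \<times> UNIV"
    by (rule abs_summable_summable)
  show "(\<lambda>k. \<Sum>\<^sub>\<infinity>p. triad s k p) summable_on UNIV"
    using summable_on_Sigma_banach[OF ps] by simp
  have e: "(\<Sum>\<^sub>\<infinity>k. \<Sum>\<^sub>\<infinity>p. triad s k p) = (\<Sum>\<^sub>\<infinity>(k, p)\<in>UNIV \<times> UNIV. triad s k p)"
    using infsum_Sigma'_banach[OF ps] by simp
  have "bij_betw (\<lambda>(k, p). (p - k, p :: int^3)) (UNIV \<times> UNIV) (UNIV \<times> UNIV)"
    by (rule bij_betwI[where g = "\<lambda>(k, p). (p - k, p)"]) auto
  from infsum_reindex_bij_betw[OF this, of "\<lambda>(k, p). triad s k p"]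
  have "(\<Sum>\<^sub>\<infinity>(k, p)\<in>UNIV \<times> UNIV. triad s k p) = (\<Sum>\<^sub>\<infinity>(k, p)\<in>UNIV \<times> UNIV. triad s (p - k) p)"
    by (simp add: case_prod_unfold)
  also have "\<dots> = (\<Sum>\<^sub>\<infinity>kp\<in>UNIV \<times> UNIV. - (case kp of (k, p) \<Rightarrow> triad s k p))"
    by (simp add: triad_antisymmetric[OF s] case_prod_unfold)
  also have "\<dots> = - (\<Sum>\<^sub>\<infinity>(k, p)\<in>UNIV \<times> UNIV. triad s k p)" by (rule infsum_uminus)
  finally show "(\<Sum>\<^sub>\<infinity>k. \<Sum>\<^sub>\<infinity>p. triad s k p) = 0" unfolding e by simp
qed

lemma cdot_conj: "0 \<le> s \<Longrightarrow> cdot (wavevec k) (a s (- k)) = 0"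
  using div_free[of s "- k"] by (simp add: cdot_linear)

lemma advection_energy:
  assumes s: "0 \<le> s"
  shows "(\<Sum>j\<in>UNIV. cnj (a s k $ j) * advection (a s) k (transverse k j)) = (\<Sum>\<^sub>\<infinity>p. triad s k p)"
proof -
  let ?f = "\<lambda>j p. cnj (a s k $ j) * (\<i> * cdot (wavevec k) (a s p) * cdot (transverse k j) (a s (k - p)))"
  have "((\<lambda>p. \<Sum>j\<in>UNIV. ?f j p) has_sum (\<Sum>j\<in>UNIV. cnj (a s k $ j) * advection (a s) k (transverse k j))) UNIV"
    unfolding advection_def
    by (intro has_sum_sum_finite has_sum_cmult_right has_sum_infsum
        convolution_summable(1)[OF convolution_bound(1)[OF square_summable square_summable]] s finite)
  moreover have "(\<Sum>j\<in>UNIV. ?f j p) = triad s k p" for p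
  proof -
    define c where "c = \<i> * cdot (wavevec k) (a s p)"
    define y where "y = a s (k - p)"
    define d where "d = cdot (wavevec k) y / complex_of_real ((norm (wavevec k))\<^sup>2)"
    have "cdot (transverse k j) y = y $ j - d * complex_of_real (wavevec k $ j)" for j
      by (simp add: transverse_def cdot_linear d_def)
    then have "(\<Sum>j\<in>UNIV. ?f j p) = (\<Sum>j\<in>UNIV. a s (- k) $ j * (c * (y $ j - d * complex_of_real (wavevec k $ j))))"
      by (simp add: c_def y_def reality)
    also have "\<dots> = c * bil y (a s (- k)) - c * d * cdot (wavevec k) (a s (- k))"
      unfolding bil_def cdot_def sum_distrib_left sum_subtractf[symmetric]
      by (intro sum.cong refl) (simp add: algebra_simps)
    finally show ?thesis using cdot_conj[OF s, of k] by (simp add: triad_def c_def y_def)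
  qed
  ultimately show ?thesis by (simp add: infsumI)
qed

lemma energy_derivative:
  assumes t: "0 \<le> t"
  shows "((\<lambda>s. (norm (a s k))\<^sup>2) has_real_derivative
     - 2 * damping k * (norm (a t k))\<^sup>2 - 2 * Re (\<Sum>\<^sub>\<infinity>p. triad t k p)) (at t within {0..})"
proof (cases "k = 0")
  case True
  have "((\<lambda>s. (norm (a s k))\<^sup>2) has_real_derivative 0) (at t within {0..})"
    by (rule has_field_derivative_transform_within[where f = "\<lambda>_. 0" and d = 1])
       (use t zero_mode True in auto)
  then show ?thesis using t True zero_mode by (simp add: triad_def cdot_linear)
next
  case False
  let ?A = "\<lambda>j. advection (a t) k (transverse k j)"
  let ?d = "\<lambda>j. - (complex_of_real (damping k) * a t k $ j + ?A j)"
  have "((\<lambda>s. a s k $ j) has_vector_derivative ?d j) (at t within {0..})" for j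
  proof -
    have c: "cdot (transverse k j) (a s k) = a s k $ j" if "0 \<le> s" for s
      by (rule cdot_transverse[OF div_free[OF that]])
    show ?thesis
      using mode_derivative[OF t False inner_transverse[OF False, of j]] unfolding c[OF t]
      by (rule has_vector_derivative_transform[rotated 2]) (use t c in auto)
  qed
  then have ReIm: "((\<lambda>s. Re (a s k $ j)) has_real_derivative Re (?d j)) (at t within {0..})"
     "((\<lambda>s. Im (a s k $ j)) has_real_derivative Im (?d j)) (at t within {0..})" for j
    unfolding has_vector_derivative_complex_iff by auto
  have n: "(norm z)\<^sup>2 = (\<Sum>j\<in>UNIV. (Re (z $ j))\<^sup>2 + (Im (z $ j))\<^sup>2)" for z :: "complex^3"
    by (simp add: norm_vec_def L2_set_def sum_nonneg cmod_power2)
  have "((\<lambda>s. \<Sum>j\<in>UNIV. (Re (a s k $ j))\<^sup>2 + (Im (a s k $ j))\<^sup>2) has_real_derivative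
     (\<Sum>j\<in>UNIV. 2 * Re (cnj (a t k $ j) * ?d j))) (at t within {0..})"
  proof (rule DERIV_sum)
    fix j
    show "((\<lambda>s. (Re (a s k $ j))\<^sup>2 + (Im (a s k $ j))\<^sup>2) has_real_derivative
       2 * Re (cnj (a t k $ j) * ?d j)) (at t within {0..})"
      by (rule DERIV_cong[OF DERIV_add[OF DERIV_power[OF ReIm(1)] DERIV_power[OF ReIm(2)]]])
         (simp add: algebra_simps)
  qed
  moreover have "(\<Sum>j\<in>UNIV. 2 * Re (cnj (a t k $ j) * ?d j)) =
      - 2 * damping k * (norm (a t k))\<^sup>2 - 2 * Re (\<Sum>j\<in>UNIV. cnj (a t k $ j) * ?A j)"
    unfolding n Re_sum sum_distrib_left sum_subtractf[symmetric]
    by (intro sum.cong refl) (simp add: algebra_simps power2_eq_square)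
  ultimately show ?thesis unfolding n advection_energy[OF t] by simp
qed

text \<open>Gronwall's inequality for the energy of finitely many modes, where \<open>e\<close> bounds the energy that
  they exchange with the others.\<close>

lemma truncated_energy_bound:
  assumes t: "0 < t0" "t0 \<le> T" and F: "finite F"
    and Q: "\<And>s. t0 \<le> s \<Longrightarrow> s \<le> T \<Longrightarrow> norm (\<Sum>k\<in>F. \<Sum>\<^sub>\<infinity>p. triad s k p) \<le> e"
  shows "(\<Sum>k\<in>F. (norm (a T k))\<^sup>2) \<le> exp (- 2 * \<mu> * (T - t0)) * (\<Sum>k\<in>F. (norm (a t0 k))\<^sup>2) + e / \<mu>"
proof -
  define E where "E s = (\<Sum>k\<in>F. (norm (a s k))\<^sup>2)" for s
  have e: "0 \<le> e" using order_trans[OF norm_ge_zero Q[of t0]] t by simp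
  \<comment> \<open>the derivative of \<open>E\<close> is at most \<open>- 2 \<mu> E + 2 e\<close>, and \<open>e / \<mu>\<close> is the equilibrium of this bound\<close>
  define G where "G s = exp (2 * \<mu> * s) * (E s - e / \<mu>)" for s
  have "G T \<le> G t0"
  proof (rule DERIV_nonpos_imp_nonincreasing[OF t(2)])
    fix s assume s: "t0 \<le> s" "s \<le> T"
    have at: "at s within {0..} = at s" using s t by (intro at_within_nhd[of _ "{0<..}"]) auto
    define D where "D = (\<Sum>k\<in>F. - 2 * damping k * (norm (a s k))\<^sup>2 - 2 * Re (\<Sum>\<^sub>\<infinity>p. triad s k p))"
    have dE: "(E has_real_derivative D) (at s)"
      unfolding E_def[abs_def] D_def using energy_derivative[of s] s t unfolding at by (intro DERIV_sum) auto
    have "D = - (\<Sum>k\<in>F. 2 * damping k * (norm (a s k))\<^sup>2) - 2 * Re (\<Sum>k\<in>F. \<Sum>\<^sub>\<infinity>p. triad s k p)"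
      by (simp add: D_def sum_subtractf sum_negf sum_distrib_left)
    also have "\<dots> \<le> - (2 * \<mu> * E s) + 2 * e"
    proof -
      have "2 * \<mu> * E s \<le> (\<Sum>k\<in>F. 2 * damping k * (norm (a s k))\<^sup>2)"
        unfolding E_def sum_distrib_left
      proof (intro sum_mono mult_right_mono)
        fix k :: "int^3"
        have "1 \<le> exp (2 * \<sigma> * norm (wavevec k))" using sigma by simp
        then show "2 * \<mu> \<le> 2 * damping k" using mu by simp
      qed simp
      moreover have "\<bar>Re (\<Sum>k\<in>F. \<Sum>\<^sub>\<infinity>p. triad s k p)\<bar> \<le> e"
        using order_trans[OF abs_Re_le_cmod Q[OF s]] .
      ultimately show ?thesis by linarith
    qed
    finally have D: "D \<le> - (2 * \<mu> * E s) + 2 * e" .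
    have "(G has_real_derivative exp (2 * \<mu> * s) * (2 * \<mu> * (E s - e / \<mu>) + D)) (at s)"
      unfolding G_def[abs_def] by (auto intro!: derivative_eq_intros dE simp: algebra_simps)
    moreover have "2 * \<mu> * (E s - e / \<mu>) + D \<le> 0" using D mu by (simp add: algebra_simps)
    then have "exp (2 * \<mu> * s) * (2 * \<mu> * (E s - e / \<mu>) + D) \<le> 0"
      by (simp add: mult_nonneg_nonpos)
    ultimately show "\<exists>y. DERIV G s :> y \<and> y \<le> 0" by blast
  qed
  then have "exp (- 2 * \<mu> * T) * G T \<le> exp (- 2 * \<mu> * T) * G t0" by (intro mult_left_mono) auto
  moreover have "exp (- 2 * \<mu> * T) * G T = E T - e / \<mu>"
    unfolding G_def mult.assoc[symmetric] mult_exp_exp by simp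
  moreover have "exp (- 2 * \<mu> * T) * G t0 = exp (- 2 * \<mu> * (T - t0)) * (E t0 - e / \<mu>)"
    unfolding G_def mult.assoc[symmetric] mult_exp_exp by (simp add: algebra_simps)
  moreover have "exp (- 2 * \<mu> * (T - t0)) * (E t0 - e / \<mu>) \<le> exp (- 2 * \<mu> * (T - t0)) * E t0"
    using e mu by (intro mult_left_mono) auto
  ultimately have "E T - e / \<mu> \<le> exp (- 2 * \<mu> * (T - t0)) * E t0" by linarith
  then show ?thesis by (simp add: E_def)
qed

text \<open>The exchange between the modes in \<open>F\<close> and the others tends to zero as \<open>F\<close> grows, uniformly on the
  time interval, because the full sum vanishes and the terms have a summable majorant that does not
  depend on time.\<close>

lemma energy_decay_interval:
  assumes t: "0 < t0" "t0 \<le> T"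
  shows "(l2norm (a T))\<^sup>2 \<le> exp (- 2 * \<mu> * (T - t0)) * (l2norm (a t0))\<^sup>2"
proof -
  obtain C where C: "C > 0" "\<And>s k. t0 \<le> s \<Longrightarrow> s \<le> T \<Longrightarrow> norm (a s k) \<le> C * exp (- \<sigma> * norm (wavevec k))"
    using decay_on_interval[OF t(1)] by blast
  obtain M where M: "M > 0" "\<And>s. 0 \<le> s \<Longrightarrow> s \<le> T \<Longrightarrow> l2norm (a s) \<le> M"
    using l2norm_bounded_on by blast
  define D where "D = 1 / (\<sigma> / 2) * C"
  \<comment> \<open>the majorant of the energy exchange of mode \<open>k\<close>; half of the rate \<open>\<sigma>\<close> has been spent on the factor
    \<open>|k|\<close>\<close>
  define m where "m k = D * exp (- (\<sigma> / 2) * norm (wavevec k)) * (M * M)" for k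
  have sD: "(\<lambda>k. D * exp (- (\<sigma> / 2) * norm (wavevec k))) summable_on UNIV"
    by (intro summable_on_cmult_right summable_lattice_exp) (use sigma in simp)
  then have sm: "m summable_on UNIV" unfolding m_def by (rule summable_on_cmult_left)
  have D0: "0 \<le> D" using C(1) sigma by (simp add: D_def)
  have ka: "norm (wavevec k) * norm (a s k) \<le> D * exp (- (\<sigma> / 2) * norm (wavevec k))"
    if s: "t0 \<le> s" "s \<le> T" for s k
  proof -
    let ?K = "norm (wavevec k)"
    have "?K * norm (a s k) \<le> ?K * (C * exp (- \<sigma> * ?K))" by (intro mult_left_mono C(2) s) simp
    also have "exp (- \<sigma> * ?K) = exp (- (\<sigma> / 2) * ?K) * exp (- (\<sigma> / 2) * ?K)"
      unfolding mult_exp_exp by (simp add: algebra_simps)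
    also have "?K * (C * (exp (- (\<sigma> / 2) * ?K) * exp (- (\<sigma> / 2) * ?K))) = (?K * exp (- (\<sigma> / 2) * ?K)) * C * exp (- (\<sigma> / 2) * ?K)"
      by (simp only: mult_ac)
    also have "\<dots> \<le> D * exp (- (\<sigma> / 2) * ?K)"
      unfolding D_def using mult_exp_minus_le[of "\<sigma> / 2" ?K] sigma C(1) by (intro mult_right_mono) auto
    finally show ?thesis .
  qed
  have sk: "(\<lambda>k. norm (wavevec k) * norm (a s k)) summable_on UNIV" if s: "t0 \<le> s" "s \<le> T" for s
    by (rule summable_on_comparison_test[OF sD ka[OF s]]) simp
  have Qm: "norm (\<Sum>\<^sub>\<infinity>p. triad s k p) \<le> m k" if s: "t0 \<le> s" "s \<le> T" for s k
  proof -
    have s0: "0 \<le> s" using s t by simp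
    have "norm (\<Sum>\<^sub>\<infinity>p. triad s k p) \<le> norm (wavevec k) * norm (a s k) * (l2norm (a s) * l2norm (a s))"
      by (rule triad_sums(3)[OF s0 sk[OF s]])
    also have "\<dots> \<le> m k"
      unfolding m_def using M D0 s s0 by (intro mult_mono ka[OF s]) auto
    finally show ?thesis .
  qed
  have tail: "(l2norm (a T))\<^sup>2 \<le> exp (- 2 * \<mu> * (T - t0)) * (l2norm (a t0))\<^sup>2 + e" if e: "e > 0" for e
  proof -
    have "\<forall>\<^sub>F F in finite_subsets_at_top UNIV. dist (sum m F) (infsum m UNIV) < e * \<mu>"
      using has_sum_infsum[OF sm] e mu unfolding has_sum_def by (intro tendstoD) auto
    then obtain F0 where F0: "finite F0" "\<And>F. finite F \<Longrightarrow> F0 \<subseteq> F \<Longrightarrow> dist (sum m F) (infsum m UNIV) < e * \<mu>"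
      unfolding eventually_finite_subsets_at_top by auto
    have fin: "(\<Sum>k\<in>F. (norm (a T k))\<^sup>2) \<le> exp (- 2 * \<mu> * (T - t0)) * (l2norm (a t0))\<^sup>2 + e" if F: "finite F" for F
    proof -
      let ?F = "F \<union> F0"
      have fF: "finite ?F" using F F0 by simp
      have Qb: "norm (\<Sum>k\<in>?F. \<Sum>\<^sub>\<infinity>p. triad s k p) \<le> e * \<mu>" if s: "t0 \<le> s" "s \<le> T" for s
      proof -
        have s0: "0 \<le> s" using s t by simp
        let ?Q = "\<lambda>k. \<Sum>\<^sub>\<infinity>p. triad s k p"
        have sQ: "?Q summable_on UNIV" by (rule triad_sums(1)[OF s0 sk[OF s]])
        have split: "infsum f UNIV = sum f ?F + infsum f (- ?F)"
          if "f summable_on UNIV" for f :: "int^3 \<Rightarrow> 'b::banach"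
        proof -
          have "infsum f (?F \<union> - ?F) = infsum f ?F + infsum f (- ?F)"
            by (intro infsum_Un_disjoint summable_on_subset_banach[OF that]) auto
          then show ?thesis using fF by (simp only: Compl_partition infsum_finite)
        qed
        have "(\<Sum>k\<in>?F. ?Q k) = - infsum ?Q (- ?F)"
          using split[OF sQ] triad_sums(2)[OF s0 sk[OF s]] by (simp add: eq_neg_iff_add_eq_0)
        then have "norm (\<Sum>k\<in>?F. ?Q k) = norm (infsum ?Q (- ?F))" by simp
        also have "\<dots> \<le> infsum m (- ?F)"
          by (rule norm_infsum_le[OF has_sum_infsum has_sum_infsum Qm[OF s]])
             (intro summable_on_subset_banach[OF sQ] summable_on_subset_banach[OF sm] subset_UNIV)+
        also have "infsum m (- ?F) = infsum m UNIV - sum m ?F" using split[OF sm] by simp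
        also have "\<dots> \<le> e * \<mu>" using F0(2)[OF fF] by (simp add: dist_real_def)
        finally show ?thesis .
      qed
      have "(\<Sum>k\<in>F. (norm (a T k))\<^sup>2) \<le> (\<Sum>k\<in>?F. (norm (a T k))\<^sup>2)"
        using fF by (intro sum_mono2) auto
      also have "\<dots> \<le> exp (- 2 * \<mu> * (T - t0)) * (\<Sum>k\<in>?F. (norm (a t0 k))\<^sup>2) + e * \<mu> / \<mu>"
        by (rule truncated_energy_bound[OF t fF Qb])
      also have "(\<Sum>k\<in>?F. (norm (a t0 k))\<^sup>2) \<le> (l2norm (a t0))\<^sup>2"
        using finite_sum_le_infsum[of "\<lambda>k. (norm (a t0 k))\<^sup>2" UNIV ?F] square_summable[of t0] fF t
        by (simp add: l2norm_def square_summable_def infsum_nonneg)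
      finally show ?thesis using mu by simp
    qed
    have "(l2norm (a T))\<^sup>2 = (\<Sum>\<^sub>\<infinity>k. (norm (a T k))\<^sup>2)" by (simp add: l2norm_def infsum_nonneg)
    also have "\<dots> \<le> exp (- 2 * \<mu> * (T - t0)) * (l2norm (a t0))\<^sup>2 + e"
      by (rule infsum_le_finite_sums[OF _ fin]) (use square_summable[of T] t in \<open>simp_all add: square_summable_def\<close>)
    finally show ?thesis .
  qed
  show ?thesis by (rule field_le_epsilon[OF tail])
qed

text \<open>The exponential decay of the coefficients is available only for positive times, so the starting
  time \<open>0\<close> is reached by continuity.\<close>

lemma energy_decay:
  assumes t: "0 \<le> t"
  shows "l2norm (a t) \<le> exp (- \<mu> * t) * l2norm (a 0)"
proof (cases "t = 0")
  case False
  then have t: "0 < t" using t by simp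
  have le: "l2norm (a t) \<le> exp (- \<mu> * (t - r)) * l2norm (a r)" if r: "0 < r" "r \<le> t" for r
  proof -
    have "(l2norm (a t))\<^sup>2 \<le> (exp (- \<mu> * (t - r)) * l2norm (a r))\<^sup>2"
    proof -
      have "(exp (- \<mu> * (t - r)))\<^sup>2 = exp (- 2 * \<mu> * (t - r))"
        unfolding power2_eq_square mult_exp_exp by (simp add: algebra_simps)
      then show ?thesis using energy_decay_interval[OF r] by (simp add: power_mult_distrib)
    qed
    then show ?thesis by (rule power2_le_imp_le) simp
  qed
  have "((\<lambda>r. exp (- \<mu> * (t - r)) * l2norm (a r)) \<longlongrightarrow> exp (- \<mu> * (t - 0)) * l2norm (a 0)) (at 0 within {0..})"
    using l2norm_continuous by (intro tendsto_intros) (auto simp: continuous_on_def)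
  then have "((\<lambda>r. exp (- \<mu> * (t - r)) * l2norm (a r)) \<longlongrightarrow> exp (- \<mu> * (t - 0)) * l2norm (a 0)) (at_right 0)"
    by (rule tendsto_within_subset) auto
  moreover have "\<forall>\<^sub>F r in at_right 0. l2norm (a t) \<le> exp (- \<mu> * (t - r)) * l2norm (a r)"
    using eventually_at_right_less[of 0] eventually_at_right_real[OF t]
    by eventually_elim (use le in auto)
  ultimately have "l2norm (a t) \<le> exp (- \<mu> * (t - 0)) * l2norm (a 0)"
    by (rule tendsto_lowerbound) simp
  then show ?thesis by simp
qed simp

end

section \<open>Doubling iteration and superexponential decay\<close>

text \<open>An explicit supersolution of the recursion \<open>C' = Q (2^n C / t + C^2)\<close>, which governs the constants
  in the iteration below. Squaring doubles the exponent of \<open>Z / t\<close>, the denominator \<open>4 Q\<close>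
  absorbs the factor \<open>Q\<close> of the quadratic term, and the growing coefficient \<open>2 ^ n / t\<close> of the
  linear term is dominated by \<open>(Z / t) ^ (2 ^ n)\<close>.\<close>

lemma doubling_recursion_bound:
  fixes Q M t Z :: real
  assumes Q: "Q \<ge> 1" and M: "M \<ge> 0" and t: "0 < t" "t \<le> 1" and Z: "Z = 4 * Q * (M + 1)"
  defines "C \<equiv> \<lambda>n::nat. (Z / t) ^ (2 ^ n) / (4 * Q)"
  shows "M \<le> C 0" and "Q * (2 ^ n / t * C n + (C n)\<^sup>2) \<le> C (Suc n)" and "C n > 0"
    and "C n \<le> (Z / t) ^ (2 ^ n)"
proof -
  have Q0: "Q > 0" using Q by simp
  have "4 * Q * 1 \<le> Z" unfolding Z using Q M by (intro mult_left_mono) auto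
  then have Z4: "4 * Q \<le> Z" "2 \<le> Z" "0 < Z" using Q by auto
  define X where "X = (Z / t) ^ (2 ^ n)"
  have X0: "X > 0" using Z4 t by (simp add: X_def)
  show "C n > 0" using Z4 t Q0 by (simp add: C_def)
  show "C n \<le> (Z / t) ^ (2 ^ n)"
    using X0 Q by (simp add: C_def flip: X_def) (simp add: divide_le_eq mult_le_cancel_left1)
  have "M * t \<le> M * 1" using t M by (intro mult_left_mono) auto
  then have "M \<le> (M + 1) / t" using t by (simp add: le_divide_eq)
  then show "M \<le> C 0" using Q0 by (simp add: C_def Z)
  have X: "4 * Q * 2 ^ n / t \<le> X"
  proof -
    have Zt: "1 \<le> Z / t" using Z4 t by (simp add: le_divide_eq)
    have "4 * Q * 2 ^ n / t \<le> Z * Z ^ n / t"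
      using Z4 t Q0 by (intro divide_right_mono mult_mono power_mono) auto
    also have "\<dots> \<le> Z / t * (Z / t) ^ n"
    proof -
      have "Z ^ n \<le> (Z / t) ^ n" using Z4 t by (intro power_mono) (auto simp: le_divide_eq mult_left_le)
      then have "Z / t * Z ^ n \<le> Z / t * (Z / t) ^ n" using Z4 t by (intro mult_left_mono) auto
      then show ?thesis by simp
    qed
    also have "\<dots> = (Z / t) ^ (Suc n)" by simp
    also have "\<dots> \<le> X" unfolding X_def using Zt by (intro power_increasing) (auto simp: Suc_le_eq)
    finally show ?thesis .
  qed
  have CS: "C (Suc n) = X * X / (4 * Q)"
  proof -
    have "(Z / t) ^ (2 ^ Suc n) = X * X"
      unfolding X_def power_add[symmetric] by (simp only: power_Suc mult_2)
    then show ?thesis unfolding C_def by simp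
  qed
  have Cn: "C n = X / (4 * Q)" unfolding C_def X_def ..
  have "Q * (2 ^ n / t * C n) = (4 * Q * 2 ^ n / t) * X / (16 * Q)"
    unfolding Cn using Q0 by (simp add: field_simps)
  also have "\<dots> \<le> X * X / (16 * Q)"
    using X X0 Q0 by (intro divide_right_mono mult_right_mono) auto
  finally have 1: "Q * (2 ^ n / t * C n) \<le> X * X / (16 * Q)" .
  have 2: "Q * (C n)\<^sup>2 = X * X / (16 * Q)"
    unfolding Cn using Q0 by (simp add: field_simps power2_eq_square)
  have "Q * (2 ^ n / t * C n + (C n)\<^sup>2) \<le> X * X / (16 * Q) + X * X / (16 * Q)"
    unfolding distrib_left 2 using 1 by simp
  also have "\<dots> \<le> C (Suc n)" unfolding CS using Q0 by (simp add: field_simps)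
  finally show "Q * (2 ^ n / t * C n + (C n)\<^sup>2) \<le> C (Suc n)" .
qed

text \<open>By the triangle inequality a convolution of exponentially decaying sequences decays at the same
  rate; a loss of \<open>\<sigma> / 2\<close> in the rate makes the sum over \<open>p\<close> converge.\<close>

lemma conv_exp_bound:
  assumes sg: "\<sigma> > 0" and x: "\<And>p. norm (x p) \<le> C * exp (- (real n * \<sigma>) * norm (wavevec p))" and n: "n \<ge> 1"
    and C: "C \<ge> 0"
  shows "conv x k \<le> C\<^sup>2 * (\<Sum>\<^sub>\<infinity>p. exp (- (\<sigma> / 2) * norm (wavevec p))) * exp (- (real n * \<sigma> - \<sigma> / 2) * norm (wavevec k))"
proof -
  let ?e = "\<lambda>p. exp (- (\<sigma> / 2) * norm (wavevec p))"
  let ?E = "exp (- (real n * \<sigma> - \<sigma> / 2) * norm (wavevec k))"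
  have se: "?e summable_on UNIV" by (rule summable_lattice_exp) (use sg in simp)
  have le: "norm (x p) * norm (x (k - p)) \<le> C\<^sup>2 * ?E * ?e p" for p
  proof -
    have "norm (x p) * norm (x (k - p)) \<le> (C * exp (- (real n * \<sigma>) * norm (wavevec p))) * (C * exp (- (real n * \<sigma>) * norm (wavevec (k - p))))"
      using C by (intro mult_mono x) auto
    also have "\<dots> = C\<^sup>2 * exp (- (real n * \<sigma>) * norm (wavevec p) + - (real n * \<sigma>) * norm (wavevec (k - p)))"
      unfolding exp_add power2_eq_square by (simp only: mult_ac)
    also have "\<dots> \<le> C\<^sup>2 * exp (- (real n * \<sigma> - \<sigma> / 2) * norm (wavevec k) + - (\<sigma> / 2) * norm (wavevec p))"
    proof (intro mult_left_mono, subst exp_le_cancel_iff)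
      have tri: "norm (wavevec k) \<le> norm (wavevec p) + norm (wavevec (k - p))"
        using norm_triangle_ineq[of "wavevec p" "wavevec (k - p)"] by simp
      have n2: "0 \<le> real n * \<sigma> - \<sigma> / 2"
      proof -
        have "1 * \<sigma> \<le> real n * \<sigma>" using n sg by (intro mult_right_mono) auto
        then show ?thesis using sg by simp
      qed
      have "(real n * \<sigma> - \<sigma> / 2) * norm (wavevec k) \<le> (real n * \<sigma> - \<sigma> / 2) * (norm (wavevec p) + norm (wavevec (k - p)))"
        using tri n2 by (intro mult_left_mono)
      moreover have "0 \<le> \<sigma> / 2 * norm (wavevec (k - p))" using sg by simp
      ultimately show "- (real n * \<sigma>) * norm (wavevec p) + - (real n * \<sigma>) * norm (wavevec (k - p))
          \<le> - (real n * \<sigma> - \<sigma> / 2) * norm (wavevec k) + - (\<sigma> / 2) * norm (wavevec p)"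
        by (simp add: algebra_simps)
    qed simp
    also have "\<dots> = C\<^sup>2 * ?E * ?e p" unfolding exp_add by (simp only: mult_ac)
    finally show ?thesis .
  qed
  have s2: "(\<lambda>p. C\<^sup>2 * ?E * ?e p) summable_on UNIV" by (rule summable_on_cmult_right[OF se])
  have "conv x k \<le> (\<Sum>\<^sub>\<infinity>p. C\<^sup>2 * ?E * ?e p)"
    unfolding conv_def
    by (intro infsum_mono summable_on_comparison_test[OF s2 le] s2 le) simp
  also have "\<dots> = C\<^sup>2 * ?E * (\<Sum>\<^sub>\<infinity>p. ?e p)" by (rule infsum_cmult_right[OF se])
  finally show ?thesis by (simp only: mult_ac)
qed

context mode_system
begin

lemma l2norm_le_initial: "0 \<le> t \<Longrightarrow> l2norm (a t) \<le> l2norm (a 0)"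
proof -
  assume t: "0 \<le> t"
  have "exp (- \<mu> * t) * l2norm (a 0) \<le> 1 * l2norm (a 0)"
    using t mu by (intro mult_right_mono) auto
  then show ?thesis using energy_decay[OF t] by simp
qed

text \<open>In each step the rate of exponential decay grows by \<open>\<sigma>\<close>: the damping gives \<open>2 \<sigma>\<close>, of which
  \<open>\<sigma> / 2\<close> pays for the convolution and \<open>\<sigma> / 2\<close> for the derivative. As the nonlinearity is quadratic,
  the constant is roughly squared.\<close>

lemma gevrey_iteration:
  obtains Z where "Z \<ge> 1"
    "\<And>n t s k. 0 < t \<Longrightarrow> t \<le> 1 \<Longrightarrow> t \<le> s \<Longrightarrow>
       norm (a s k) \<le> (Z / t) ^ (2 ^ n) * exp (- (real n * \<sigma>) * norm (wavevec k))"
proof -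
  define S where "S = (\<Sum>\<^sub>\<infinity>p. exp (- (\<sigma> / 2) * norm (wavevec p)))"
  have S1: "S \<ge> 1"
  proof -
    have "(\<Sum>p\<in>{0}. exp (- (\<sigma> / 2) * norm (wavevec p))) \<le> S"
      unfolding S_def by (rule finite_sum_le_infsum) (use sigma summable_lattice_exp[of "\<sigma> / 2"] in auto)
    then show ?thesis by simp
  qed
  \<comment> \<open>\<open>3 / \<mu>\<close> comes from the elementary step, \<open>2 S / \<sigma>\<close> from the convolution and the derivative; adding
    \<open>1\<close> ensures \<open>Q \<ge> 1\<close>\<close>
  define Q where "Q = 3 / \<mu> * (2 + 2 * S / \<sigma>) + 1"
  have Q1: "Q \<ge> 1" using mu sigma S1 by (simp add: Q_def)
  define M where "M = l2norm (a 0)"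
  have M0: "M \<ge> 0" by (simp add: M_def)
  define Z where "Z = 4 * Q * (M + 1)"
  have "norm (a s k) \<le> (Z / t) ^ (2 ^ n) * exp (- (real n * \<sigma>) * norm (wavevec k))"
    if t: "0 < t" "t \<le> 1" and ts: "t \<le> s" for n t s k
  proof -
    define C where "C n = (Z / t) ^ (2 ^ n) / (4 * Q)" for n :: nat
    note C = doubling_recursion_bound[OF Q1 M0 t Z_def, folded C_def]
    \<comment> \<open>step \<open>n\<close> waits for a time \<open>t / 2 ^ (n + 1)\<close>, so all steps together stay below \<open>t\<close>. The bound on
      \<open>conv\<close> is carried along because at the start it comes from the energy and not from decay of the
      modes.\<close>
    have claim: "t * (1 - 1 / 2 ^ n) \<le> r \<Longrightarrow>
        (\<forall>k. norm (a r k) \<le> C n * exp (- (real n * \<sigma>) * norm (wavevec k))) \<and>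
        (\<forall>k. conv (a r) k \<le> (C n)\<^sup>2 * S * exp (- (real n * \<sigma> - \<sigma> / 2) * norm (wavevec k)))" for n r
    proof (induction n arbitrary: r)
      case 0
      then have r: "0 \<le> r" by simp
      have l: "l2norm (a r) \<le> C 0" using l2norm_le_initial[OF r] C(1) by (simp add: M_def)
      have "norm (a r k) \<le> C 0" for k using norm_le_l2norm[OF square_summable[OF r], of k] l by linarith
      moreover have "conv (a r) k \<le> (C 0)\<^sup>2 * S * exp (- (0 - \<sigma> / 2) * norm (wavevec k))" for k
      proof -
        have "conv (a r) k \<le> l2norm (a r) * l2norm (a r)" by (rule conv_le[OF square_summable[OF r]])
        also have "\<dots> \<le> C 0 * C 0" using l C(3)[of 0] by (intro mult_mono) auto
        also have "\<dots> \<le> (C 0)\<^sup>2 * (S * exp (- (0 - \<sigma> / 2) * norm (wavevec k)))"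
        proof -
          have "1 * 1 \<le> S * exp (- (0 - \<sigma> / 2) * norm (wavevec k))"
            using S1 sigma by (intro mult_mono) auto
          then have "(C 0)\<^sup>2 * 1 \<le> (C 0)\<^sup>2 * (S * exp (- (0 - \<sigma> / 2) * norm (wavevec k)))"
            by (intro mult_left_mono) auto
          then show ?thesis by (simp add: power2_eq_square)
        qed
        finally show ?thesis by (simp add: mult.assoc)
      qed
      ultimately show ?case by simp
    next
      case (Suc n)
      define t1 where "t1 = r - t / 2 ^ Suc n"
      have gap: "t * (1 - 1 / 2 ^ n) + t / 2 ^ Suc n = t * (1 - 1 / 2 ^ Suc n)" by (simp add: field_simps)
      have t1: "t * (1 - 1 / 2 ^ n) \<le> t1" using Suc.prems gap by (simp add: t1_def)
      have "0 \<le> t * (1 - 1 / 2 ^ n)" using t by simp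
      then have t10: "0 \<le> t1" using t1 by simp
      have t1r: "t1 < r" "r - t1 = t / 2 ^ Suc n" using t by (simp_all add: t1_def)
      have r0: "0 \<le> r" using t10 t1r by simp
      have C0: "0 < C n" "0 < C (Suc n)" by (rule C(3))+
      have bound: "norm (a r k) \<le> C (Suc n) * exp (- (real (Suc n) * \<sigma>) * norm (wavevec k))" for k
      proof (cases "k = 0")
        case True
        then show ?thesis using zero_mode[OF r0] C0 by simp
      next
        case False
        let ?K = "norm (wavevec k)"
        let ?e = "\<lambda>c. exp (- c * ?K)"
        have "norm (a r k) \<le> 3 / damping k * (norm (a t1 k) / (r - t1) + ?K * ((C n)\<^sup>2 * S * ?e (real n * \<sigma> - \<sigma> / 2)))"
          by (rule mode_bound[OF False t10 t1r(1)]) (use Suc.IH t1 in auto)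
        also have "\<dots> \<le> 3 / damping k * (C n * ?e (real n * \<sigma>) / (t / 2 ^ Suc n) + ?K * ((C n)\<^sup>2 * S * ?e (real n * \<sigma> - \<sigma> / 2)))"
          unfolding t1r(2) using Suc.IH[OF t1] mu t by (intro mult_left_mono add_right_mono divide_right_mono) auto
        also have "\<dots> = 3 / \<mu> * (C n * (2 * 2 ^ n / t) * ?e \<sigma> + ?K * ?e (\<sigma> / 2) * ((C n)\<^sup>2 * S)) * ?e (real (Suc n) * \<sigma>)"
        proof -
          have alg: "3 / (\<mu> * E) * (c * y / (t / (2 * w)) + x * (b * z))
              = 3 / \<mu> * (c * (2 * w / t) * ((1 / E) * y) + x * b * ((1 / E) * z))"
            if "E > 0" "w > 0" for E w c x y z b :: real
            using t mu that by (simp add: field_simps)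
          have d: "1 / exp (2 * \<sigma> * ?K) = ?e (2 * \<sigma>)" by (simp add: exp_minus inverse_eq_divide)
          have e1: "?e (2 * \<sigma>) * ?e (real n * \<sigma>) = ?e \<sigma> * ?e (real (Suc n) * \<sigma>)"
            and e2: "?e (2 * \<sigma>) * ?e (real n * \<sigma> - \<sigma> / 2) = ?e (\<sigma> / 2) * ?e (real (Suc n) * \<sigma>)"
            unfolding mult_exp_exp by (simp_all add: algebra_simps)
          have "3 / damping k * (C n * ?e (real n * \<sigma>) / (t / 2 ^ Suc n) + ?K * ((C n)\<^sup>2 * S * ?e (real n * \<sigma> - \<sigma> / 2)))
             = 3 / \<mu> * (C n * (2 * 2 ^ n / t) * ((1 / exp (2 * \<sigma> * ?K)) * ?e (real n * \<sigma>)) + ?K * ((C n)\<^sup>2 * S) * ((1 / exp (2 * \<sigma> * ?K)) * ?e (real n * \<sigma> - \<sigma> / 2)))"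
            unfolding power_Suc by (rule alg) (use t in auto)
          also have "\<dots> = 3 / \<mu> * (C n * (2 * 2 ^ n / t) * (?e \<sigma> * ?e (real (Suc n) * \<sigma>)) + ?K * ((C n)\<^sup>2 * S) * (?e (\<sigma> / 2) * ?e (real (Suc n) * \<sigma>)))"
            unfolding d e1 e2 ..
          finally show ?thesis by (simp only: distrib_left distrib_right mult_ac)
        qed
        also have "\<dots> \<le> 3 / \<mu> * (C n * (2 * 2 ^ n / t) * 1 + 1 / (\<sigma> / 2) * ((C n)\<^sup>2 * S)) * ?e (real (Suc n) * \<sigma>)"
          using mult_exp_minus_le[of "\<sigma> / 2" ?K] sigma mu t C0 S1
          by (intro mult_right_mono mult_left_mono add_mono) auto
        also have "\<dots> \<le> C (Suc n) * ?e (real (Suc n) * \<sigma>)"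
        proof (rule mult_right_mono)
          let ?A = "2 ^ n / t * C n" and ?B = "(C n)\<^sup>2"
          have A0: "0 \<le> ?A" using t C0 by simp
          have "3 / \<mu> * (C n * (2 * 2 ^ n / t) * 1 + 1 / (\<sigma> / 2) * ((C n)\<^sup>2 * S)) = 3 / \<mu> * (2 * ?A + 2 * S / \<sigma> * ?B)"
            by (simp add: mult.commute)
          also have "\<dots> \<le> 3 / \<mu> * ((2 + 2 * S / \<sigma>) * ?A + (2 + 2 * S / \<sigma>) * ?B)"
            using A0 mu S1 sigma by (intro mult_left_mono add_mono mult_right_mono) auto
          also have "\<dots> = (Q - 1) * (?A + ?B)"
          proof -
            have "x * (c * A + c * B) = x * c * (A + B)" for x c A B :: real by (simp add: algebra_simps)
            moreover have "Q - 1 = 3 / \<mu> * (2 + 2 * S / \<sigma>)" by (simp add: Q_def)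
            ultimately show ?thesis by presburger
          qed
          also have "\<dots> \<le> Q * (?A + ?B)" using A0 by (intro mult_right_mono) auto
          also have "\<dots> \<le> C (Suc n)" by (rule C(2))
          finally show "3 / \<mu> * (C n * (2 * 2 ^ n / t) * 1 + 1 / (\<sigma> / 2) * ((C n)\<^sup>2 * S)) \<le> C (Suc n)" .
        qed simp
        finally show ?thesis .
      qed
      moreover have "conv (a r) k \<le> (C (Suc n))\<^sup>2 * S * exp (- (real (Suc n) * \<sigma> - \<sigma> / 2) * norm (wavevec k))" for k
        unfolding S_def by (rule conv_exp_bound[OF sigma bound]) (use C0 in auto)
      ultimately show ?case by blast
    qed
    have "t * (1 - 1 / 2 ^ n) \<le> t * 1" using t by (intro mult_left_mono) auto
    then have "norm (a s k) \<le> C n * exp (- (real n * \<sigma>) * norm (wavevec k))"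
      using claim[of n s] ts by simp
    also have "\<dots> \<le> (Z / t) ^ (2 ^ n) * exp (- (real n * \<sigma>) * norm (wavevec k))"
      by (intro mult_right_mono C(4)) simp
    finally show ?thesis .
  qed
  moreover have "Z \<ge> 1"
  proof -
    have "1 * 1 \<le> 4 * Q * (M + 1)" using Q1 M0 by (intro mult_mono) auto
    then show ?thesis by (simp add: Z_def)
  qed
  ultimately show ?thesis using that by blast
qed

end

text \<open>The number of steps that is nearly optimal for a frequency of length \<open>K\<close>. The level is chosen so
  that \<open>2 ^ n \<le> K / 2\<close>, which later produces the square root in the threshold for \<open>|k|\<close>.\<close>

lemma dyadic_level:
  fixes K :: real
  assumes "K \<ge> 2"
  obtains n :: nat where "2 ^ Suc n \<le> K" "ln K / ln 2 - 2 \<le> real n"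
proof -
  define m where "m = nat \<lfloor>log 2 K\<rfloor>"
  have l1: "1 \<le> log 2 K" using assms by (simp add: le_log_iff)
  have m: "real m \<le> log 2 K" "log 2 K < real m + 1" "m \<ge> 1"
    using l1 by (auto simp: m_def le_nat_iff le_floor_iff intro: order_trans)
  have "2 ^ m \<le> K" using m(1) assms by (simp add: le_log_iff powr_realpow)
  then have "2 ^ Suc (m - 1) \<le> K" using m(3) by simp
  moreover have "ln K / ln 2 - 2 \<le> real (m - 1)"
    using m(2,3) by (simp add: log_def of_nat_diff)
  ultimately show ?thesis using that by blast
qed

context mode_system
begin

text \<open>With \<open>n\<close> steps at the dyadic level of \<open>|k|\<close> the constant contributes at most \<open>(Z / t) ^ (|k| / 2)\<close>,
  while \<open>n\<close> is \<open>log 2 |k|\<close> up to a bounded error, which is absorbed into a larger \<open>Z\<close>.\<close>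

lemma superexponential_decay:
  obtains Z where "Z \<ge> 1"
    "\<And>t s k. 0 < t \<Longrightarrow> t \<le> 1 \<Longrightarrow> t \<le> s \<Longrightarrow> norm (wavevec k) \<ge> 2 \<Longrightarrow>
       norm (a s k) \<le> exp (norm (wavevec k) / 2 * ln (Z / t) - \<sigma> / ln 2 * norm (wavevec k) * ln (norm (wavevec k)))"
proof -
  obtain Z where Z: "Z \<ge> 1" "\<And>n t s k. 0 < t \<Longrightarrow> t \<le> 1 \<Longrightarrow> t \<le> s \<Longrightarrow>
       norm (a s k) \<le> (Z / t) ^ (2 ^ n) * exp (- (real n * \<sigma>) * norm (wavevec k))"
    using gevrey_iteration by blast
  have "norm (a s k) \<le> exp (norm (wavevec k) / 2 * ln (Z * exp (4 * \<sigma>) / t) - \<sigma> / ln 2 * norm (wavevec k) * ln (norm (wavevec k)))"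
    if t: "0 < t" "t \<le> 1" "t \<le> s" and K2: "norm (wavevec k) \<ge> 2" for t s k
  proof -
    define K where "K = norm (wavevec k)"
    obtain n where n: "2 ^ Suc n \<le> K" "ln K / ln 2 - 2 \<le> real n"
      using dyadic_level K2 unfolding K_def by blast
    have Zt: "1 \<le> Z / t" using Z(1) t by (simp add: le_divide_eq)
    have K: "K \<ge> 2" using K2 by (simp add: K_def)
    have "norm (a s k) \<le> (Z / t) ^ (2 ^ n) * exp (- (real n * \<sigma>) * K)"
      unfolding K_def by (rule Z(2)[OF t])
    also have "(Z / t) ^ (2 ^ n) = exp (2 ^ n * ln (Z / t))"
      using Zt by (simp add: exp_of_nat_mult[of "2 ^ n", simplified])
    also have "exp (2 ^ n * ln (Z / t)) * exp (- (real n * \<sigma>) * K) = exp (2 ^ n * ln (Z / t) - real n * \<sigma> * K)"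
      by (simp add: exp_diff exp_minus field_simps)
    also have "\<dots> \<le> exp (K / 2 * ln (Z / t) - (ln K / ln 2 - 2) * \<sigma> * K)"
    proof -
      have "2 ^ n * ln (Z / t) \<le> K / 2 * ln (Z / t)" using n(1) Zt by (intro mult_right_mono) auto
      moreover have "(ln K / ln 2 - 2) * \<sigma> * K \<le> real n * \<sigma> * K"
        using n(2) sigma K by (intro mult_right_mono) auto
      ultimately show ?thesis by simp
    qed
    also have "K / 2 * ln (Z / t) - (ln K / ln 2 - 2) * \<sigma> * K = K / 2 * (ln (Z / t) + 4 * \<sigma>) - \<sigma> / ln 2 * K * ln K"
      by (simp add: algebra_simps)
    also have "ln (Z / t) + 4 * \<sigma> = ln (Z * exp (4 * \<sigma>) / t)"
      using Z(1) t by (simp add: ln_mult ln_div)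
    finally show ?thesis unfolding K_def .
  qed
  moreover have "Z * exp (4 * \<sigma>) \<ge> 1"
  proof -
    have "1 * 1 \<le> Z * exp (4 * \<sigma>)" using Z(1) sigma by (intro mult_mono) auto
    then show ?thesis by simp
  qed
  ultimately show ?thesis using that by blast
qed

text \<open>For \<open>t \<ge> \<Lambda>\<close> the bound contains no large constant. For large \<open>|k|\<close> this is possible because the
  rate \<open>\<sigma> / b\<close> is smaller than the rate \<open>\<sigma> / ln 2\<close> that the iteration gives, and the difference
  beats the constant; the bounds reached at time one persist at all later times.
  For the finitely many other \<open>k\<close> it follows from the decay of the energy.\<close>

theorem uniform_superexponential_decay:
  assumes b: "ln 2 < b"
  obtains \<Lambda> where "\<Lambda> > 0"
    "\<And>t k. 0 < t \<Longrightarrow> k \<noteq> 0 \<Longrightarrow>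
      norm (a t k) \<le> exp (norm (wavevec k) * max 0 (ln (\<Lambda> / t) / 2) - \<sigma> / b * norm (wavevec k) * ln (norm (wavevec k)))"
proof -
  obtain Z where Z: "Z \<ge> 1"
    "\<And>t s k. 0 < t \<Longrightarrow> t \<le> 1 \<Longrightarrow> t \<le> s \<Longrightarrow> norm (wavevec k) \<ge> 2 \<Longrightarrow>
       norm (a s k) \<le> exp (norm (wavevec k) / 2 * ln (Z / t) - \<sigma> / ln 2 * norm (wavevec k) * ln (norm (wavevec k)))"
    using superexponential_decay by blast
  have l2: "(0::real) < ln 2" by simp
  have b0: "0 < b" using b l2 by linarith
  define g where "g = \<sigma> / ln 2 - \<sigma> / b"
  have g: "g > 0" using b b0 l2 sigma by (simp add: g_def frac_less2)
  \<comment> \<open>beyond \<open>R\<close> the surplus \<open>g\<close> in the rate compensates the constant \<open>Z\<close>\<close>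
  define R where "R = max 2 (exp (ln Z / 2 / g))"
  define M where "M = l2norm (a 0)"
  have M0: "0 \<le> M" by (simp add: M_def)
  \<comment> \<open>for \<open>|k| < R\<close> it is enough to reach \<open>exp (- e0)\<close>, which the energy does from the time \<open>T1\<close> on; before
    \<open>T1\<close> a large \<open>\<Lambda>\<close> makes the bound exceed the initial energy\<close>
  define e0 where "e0 = \<sigma> / b * R * ln R"
  define B where "B = ln (M + 1) + e0"
  have R2: "R \<ge> 2" by (simp add: R_def)
  have e00: "0 \<le> e0" using R2 sigma b0 by (simp add: e0_def)
  have B0: "0 \<le> B" using M0 e00 by (simp add: B_def)
  have eB: "exp (B - e0) = M + 1" using M0 by (simp add: B_def)
  define T1 where "T1 = max 1 (B / \<mu>)"
  have T1: "1 \<le> T1" "B / \<mu> \<le> T1" by (auto simp: T1_def)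
  define \<Lambda> where "\<Lambda> = max Z (T1 * exp (2 * B))"
  have L0: "\<Lambda> > 0" using Z(1) by (simp add: \<Lambda>_def)
  have "norm (a t k) \<le> exp (K * max 0 (ln (\<Lambda> / t) / 2) - \<sigma> / b * K * ln K)"
    if t: "0 < t" and k: "k \<noteq> 0" and K: "K = norm (wavevec k)" for t k K
  proof -
    have K1: "1 \<le> K" unfolding K by (rule norm_wavevec_ge_1[OF k])
    have lK: "0 \<le> ln K" using K1 by simp
    show ?thesis
    proof (cases "K \<ge> R")
      case True
      then have K2: "2 \<le> norm (wavevec k)" using R2 K by simp
      have sb: "\<sigma> / b * K * ln K \<le> \<sigma> / ln 2 * K * ln K"
        using g K1 lK by (intro mult_right_mono) (auto simp: g_def)
      show ?thesis
      proof (cases "t \<le> 1")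
        case True
        have "norm (a t k) \<le> exp (K / 2 * ln (Z / t) - \<sigma> / ln 2 * K * ln K)"
          unfolding K by (rule Z(2)[OF t True _ K2]) simp
        also have "\<dots> \<le> exp (K * max 0 (ln (\<Lambda> / t) / 2) - \<sigma> / b * K * ln K)"
        proof -
          have "Z / t \<le> \<Lambda> / t" using t by (intro divide_right_mono) (auto simp: \<Lambda>_def)
          then have "ln (Z / t) \<le> ln (\<Lambda> / t)" using Z(1) t L0 by (subst ln_le_cancel_iff) auto
          then have "K * (ln (Z / t) / 2) \<le> K * max 0 (ln (\<Lambda> / t) / 2)"
            using K1 by (intro mult_left_mono) auto
          then show ?thesis using sb by simp
        qed
        finally show ?thesis .
      next
        case False
        have "norm (a t k) \<le> exp (K / 2 * ln (Z / 1) - \<sigma> / ln 2 * K * ln K)"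
          unfolding K by (rule Z(2)[OF _ _ _ K2]) (use False in auto)
        also have "\<dots> \<le> exp (K * max 0 (ln (\<Lambda> / t) / 2) - \<sigma> / b * K * ln K)"
        proof -
          have "exp (ln Z / 2 / g) \<le> K" using True by (simp add: R_def)
          then have "ln Z / 2 / g \<le> ln K" using K1 by (subst ln_ge_iff) auto
          then have "ln Z / 2 \<le> g * ln K" using g by (simp add: divide_le_eq mult_ac)
          then have "K * (ln Z / 2) \<le> K * (g * ln K)" using K1 by (intro mult_left_mono) auto
          then have "K / 2 * ln Z - \<sigma> / ln 2 * K * ln K \<le> - (\<sigma> / b * K * ln K)"
            by (simp add: g_def algebra_simps)
          moreover have "0 \<le> K * max 0 (ln (\<Lambda> / t) / 2)" using K1 by simp
          ultimately show ?thesis by simp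
        qed
        finally show ?thesis .
      qed
    next
      case False
      have e: "\<sigma> / b * K * ln K \<le> e0"
        unfolding e0_def using False K1 lK sigma b0 by (intro mult_mono) auto
      have am: "norm (a t k) \<le> exp (- \<mu> * t) * M"
        using norm_le_l2norm[OF square_summable, of t k] energy_decay[of t] t unfolding M_def by linarith
      have "norm (a t k) \<le> exp (K * max 0 (ln (\<Lambda> / t) / 2) - e0)"
      proof (cases "T1 \<le> t")
        case True
        have "B \<le> \<mu> * T1" using T1(2) mu by (simp add: divide_le_eq mult.commute)
        also have "\<dots> \<le> \<mu> * t" using True mu by (intro mult_left_mono) auto
        finally have "B \<le> \<mu> * t" .
        then have "exp (- \<mu> * t) * M \<le> exp (- B) * (M + 1)" using M0 by (intro mult_mono) auto
        also have "\<dots> = exp (- e0)" unfolding eB[symmetric] mult_exp_exp by simp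
        also have "\<dots> \<le> exp (K * max 0 (ln (\<Lambda> / t) / 2) - e0)" using K1 by simp
        finally show ?thesis using am by simp
      next
        case False
        have "exp (- \<mu> * t) * M \<le> 1 * M" using t mu M0 by (intro mult_right_mono) auto
        then have "norm (a t k) \<le> exp (B - e0)" using am eB by simp
        also have "\<dots> \<le> exp (K * max 0 (ln (\<Lambda> / t) / 2) - e0)"
        proof -
          have "t * exp (2 * B) \<le> T1 * exp (2 * B)" using False by (intro mult_right_mono) auto
          also have "\<dots> \<le> \<Lambda>" by (simp add: \<Lambda>_def)
          finally have "exp (2 * B) \<le> \<Lambda> / t" using t by (simp add: le_divide_eq mult.commute)
          then have "2 * B \<le> ln (\<Lambda> / t)" using L0 t by (subst ln_ge_iff) auto
          then have "1 * B \<le> K * max 0 (ln (\<Lambda> / t) / 2)" using K1 B0 by (intro mult_mono) auto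
          then show ?thesis by simp
        qed
        finally show ?thesis .
      qed
      also have "\<dots> \<le> exp (K * max 0 (ln (\<Lambda> / t) / 2) - \<sigma> / b * K * ln K)" using e by simp
      finally show ?thesis .
    qed
  qed
  then show ?thesis using that L0 by blast
qed

lemma exponentially_weighted_summable:
  assumes t: "0 < t"
  shows "(\<lambda>k. exp (real n * norm (wavevec k)) * norm (a t k)) summable_on UNIV"
proof -
  obtain Z where Z: "\<And>n t s k. 0 < t \<Longrightarrow> t \<le> 1 \<Longrightarrow> t \<le> s \<Longrightarrow>
       norm (a s k) \<le> (Z / t) ^ (2 ^ n) * exp (- (real n * \<sigma>) * norm (wavevec k))"
    using gevrey_iteration by metis
  obtain N :: nat where N: "real n + 1 \<le> real N * \<sigma>"
    using reals_Archimedean3[OF sigma] less_imp_le by blast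
  define A where "A = (Z / min t 1) ^ (2 ^ N)"
  have bd: "norm (a t k) \<le> A * exp (- (real N * \<sigma>) * norm (wavevec k))" for k
    unfolding A_def by (rule Z) (use t in auto)
  have A0: "0 \<le> A" using order_trans[OF norm_ge_zero bd[of 0]] by simp
  have "(\<lambda>k. A * exp (- 1 * norm (wavevec k))) summable_on UNIV"
    by (intro summable_on_cmult_right summable_lattice_exp) simp
  then show ?thesis
  proof (rule summable_on_comparison_test)
    fix k
    have "exp (real n * norm (wavevec k)) * norm (a t k)
        \<le> exp (real n * norm (wavevec k)) * (A * exp (- (real N * \<sigma>) * norm (wavevec k)))"
      by (intro mult_left_mono bd) simp
    also have "\<dots> = A * exp ((real n - real N * \<sigma>) * norm (wavevec k))"
      by (simp add: exp_minus exp_diff left_diff_distrib field_simps)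
    also have "\<dots> \<le> A * exp (- 1 * norm (wavevec k))"
    proof -
      have "(real n - real N * \<sigma>) * norm (wavevec k) \<le> - 1 * norm (wavevec k)"
        using N by (intro mult_right_mono) auto
      then show ?thesis using A0 by (intro mult_left_mono) auto
    qed
    finally show "exp (real n * norm (wavevec k)) * norm (a t k) \<le> A * exp (- 1 * norm (wavevec k))" .
  qed simp
qed

end

section \<open>Entire extension\<close>

lemma norm_vec_smult: "norm (c *s (x :: complex^3)) = norm c * norm x"
  by (simp add: norm_vec_def norm_mult L2_set_right_distrib)

lemma bounded_linear_vec_smult_right: "bounded_linear (\<lambda>x :: complex^3. c *s x)"
  by (rule bounded_linear_intro[where K = "norm c"])
     (auto simp: vec_eq_iff algebra_simps norm_vec_smult)

lemma cdot_smult: "cdot v (c *s z) = c * cdot v z"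
  by (simp add: cdot_def sum_distrib_left mult.left_commute)

text \<open>The derivative is the series differentiated term by term; the second order Taylor remainder of
  each exponential is bounded by a quadratic term in \<open>h\<close> with summable coefficients.\<close>

lemma entire_fourier_series:
  fixes c :: "int^3 \<Rightarrow> complex^3"
  assumes sm: "\<And>n::nat. (\<lambda>k. exp (real n * norm (wavevec k)) * norm (c k)) summable_on UNIV"
  shows "entire3 (\<lambda>z. \<Sum>\<^sub>\<infinity>k. exp (\<i> * cdot (wavevec k) z) *s c k)"
  unfolding entire3_def
proof
  fix z :: "complex^3"
  define E where "E k z = exp (\<i> * cdot (wavevec k) z)" for k z
  define D where "D h = (\<Sum>\<^sub>\<infinity>k. (\<i> * cdot (wavevec k) h * E k z) *s c k)" for h
  \<comment> \<open>the rate \<open>norm z\<close> bounds the exponentials at \<open>z\<close>; the additional \<open>3\<close> pays for the two factors \<open>|k|\<close>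
    of the remainder and for the increment \<open>h\<close>\<close>
  define N where "N = nat \<lceil>norm z\<rceil> + 3"
  have N: "norm z + 3 \<le> real N" by (simp add: N_def)
  define B where "B = (\<Sum>\<^sub>\<infinity>k. exp (real N * norm (wavevec k)) * norm (c k))"
  have B0: "0 \<le> B" unfolding B_def by (intro infsum_nonneg) simp
  have series: "(\<lambda>k. w k *s c k) summable_on UNIV" "norm (\<Sum>\<^sub>\<infinity>k. w k *s c k) \<le> A * B"
    if w: "\<And>k. norm (w k) \<le> A * exp (real N * norm (wavevec k))" for w A
  proof -
    have hs: "((\<lambda>k. A * (exp (real N * norm (wavevec k)) * norm (c k))) has_sum A * B) UNIV"
      unfolding B_def by (intro has_sum_cmult_right has_sum_infsum sm)
    have le: "norm (w k *s c k) \<le> A * (exp (real N * norm (wavevec k)) * norm (c k))" for k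
      using mult_right_mono[OF w[of k], of "norm (c k)"] by (simp add: norm_vec_smult mult.assoc)
    have "(\<lambda>k. norm (w k *s c k)) summable_on UNIV"
      by (rule summable_on_comparison_test[OF has_sum_imp_summable[OF hs] le]) simp
    then show s: "(\<lambda>k. w k *s c k) summable_on UNIV" by (rule abs_summable_summable)
    show "norm (\<Sum>\<^sub>\<infinity>k. w k *s c k) \<le> A * B"
      by (rule norm_infsum_le[OF has_sum_infsum[OF s] hs le])
  qed
  have nE: "norm (E k y) \<le> exp (norm y * norm (wavevec k))" for k y
  proof -
    have "norm (E k y) \<le> exp (norm (\<i> * cdot (wavevec k) y))"
      unfolding E_def by (rule norm_exp)
    also have "\<dots> \<le> exp (norm y * norm (wavevec k))"
      using norm_cdot_le[of "wavevec k" y] by (simp add: norm_mult mult.commute)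
    finally show ?thesis .
  qed
  have kexp: "norm (wavevec k) \<le> exp (norm (wavevec k))" for k
    using exp_ge_add_one_self[of "norm (wavevec k)"] by linarith
  have EN: "norm (E k z) * exp (3 * norm (wavevec k)) \<le> exp (real N * norm (wavevec k))" for k
  proof -
    have "norm (E k z) * exp (3 * norm (wavevec k)) \<le> exp (norm z * norm (wavevec k)) * exp (3 * norm (wavevec k))"
      by (intro mult_right_mono nE) simp
    also have "\<dots> = exp ((norm z + 3) * norm (wavevec k))" unfolding mult_exp_exp by (simp add: distrib_right)
    also have "\<dots> \<le> exp (real N * norm (wavevec k))" using N by (simp add: mult_right_mono)
    finally show ?thesis .
  qed
  have wD: "norm (\<i> * cdot (wavevec k) h * E k z) \<le> norm h * exp (real N * norm (wavevec k))" for k h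
  proof -
    have "norm (\<i> * cdot (wavevec k) h * E k z) \<le> (norm (wavevec k) * norm h) * norm (E k z)"
      unfolding norm_mult norm_ii mult_1_left by (intro mult_right_mono norm_cdot_le) simp
    also have "\<dots> = norm h * (norm (E k z) * norm (wavevec k))" by (simp only: mult_ac)
    also have "\<dots> \<le> norm h * (norm (E k z) * exp (3 * norm (wavevec k)))"
      by (intro mult_left_mono order_trans[OF kexp]) auto
    also have "\<dots> \<le> norm h * exp (real N * norm (wavevec k))" by (intro mult_left_mono EN) simp
    finally show ?thesis .
  qed
  have scale: "D (r *s h) = r *s D h" for r h
  proof -
    have s: "(\<lambda>k. (\<i> * cdot (wavevec k) h * E k z) *s c k) summable_on UNIV" by (rule series(1)[OF wD])
    have "r *s D h = (\<Sum>\<^sub>\<infinity>k. r *s ((\<i> * cdot (wavevec k) h * E k z) *s c k))"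
      unfolding D_def by (rule infsumI[OF has_sum_bounded_linear[OF bounded_linear_vec_smult_right has_sum_infsum[OF s]], symmetric])
    then show ?thesis by (simp add: D_def cdot_smult mult_ac)
  qed
  have linD: "bounded_linear D"
  proof (rule bounded_linear_intro)
    show "D (x + y) = D x + D y" for x y
      unfolding D_def by (subst infsum_add[OF series(1)[OF wD] series(1)[OF wD], symmetric])
        (simp add: cdot_linear algebra_simps vector_sadd_rdistrib)
    show "D (r *\<^sub>R x) = r *\<^sub>R D x" for r x
    proof -
      have "r *\<^sub>R y = complex_of_real r *s y" for y :: "complex^3"
        by (simp add: vec_eq_iff scaleR_conv_of_real[where 'a = complex])
      then show ?thesis using scale by simp
    qed
    show "norm (D x) \<le> norm x * B" for x unfolding D_def by (rule series(2)[OF wD])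
  qed
  have rem: "norm ((\<Sum>\<^sub>\<infinity>k. E k (z + h) *s c k) - (\<Sum>\<^sub>\<infinity>k. E k z *s c k) - D h) \<le> (norm h)\<^sup>2 * B"
    if h: "norm h \<le> 1" for h
  proof -
    have w0: "norm (E k z) \<le> 1 * exp (real N * norm (wavevec k))" for k
    proof -
      have "norm (E k z) * 1 \<le> norm (E k z) * exp (3 * norm (wavevec k))" by (intro mult_left_mono) auto
      then show ?thesis using EN[of k] by simp
    qed
    define q where "q k = E k (z + h) - E k z - \<i> * cdot (wavevec k) h * E k z" for k
    have wq: "norm (q k) \<le> (norm h)\<^sup>2 * exp (real N * norm (wavevec k))" for k
    proof -
      let ?d = "\<i> * cdot (wavevec k) h"
      have nd: "norm ?d \<le> norm (wavevec k) * norm h" using norm_cdot_le[of "wavevec k" h] by (simp add: norm_mult)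
      have "q k = E k z * (exp ?d - (1 + ?d))"
        unfolding q_def E_def by (simp add: cdot_linear distrib_left exp_add algebra_simps)
      then have "norm (q k) = norm (E k z) * norm (exp ?d - (1 + ?d))" by (simp add: norm_mult)
      also have "norm (exp ?d - (1 + ?d)) \<le> exp \<bar>Re ?d\<bar> * (norm ?d)\<^sup>2"
        using Taylor_exp[of ?d 1] by (simp add: numeral_2_eq_2)
      also have "exp \<bar>Re ?d\<bar> * (norm ?d)\<^sup>2 \<le> exp (norm (wavevec k)) * (exp (norm (wavevec k)) * norm h)\<^sup>2"
      proof (intro mult_mono power_mono)
        have "\<bar>Re ?d\<bar> \<le> norm (wavevec k) * norm h" using abs_Re_le_cmod[of ?d] nd by linarith
        also have "\<dots> \<le> norm (wavevec k) * 1" by (intro mult_left_mono h) simp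
        finally show "exp \<bar>Re ?d\<bar> \<le> exp (norm (wavevec k))" by simp
        show "norm ?d \<le> exp (norm (wavevec k)) * norm h"
          by (rule order_trans[OF nd]) (intro mult_right_mono kexp norm_ge_zero)
      qed auto
      also have "exp (norm (wavevec k)) * (exp (norm (wavevec k)) * norm h)\<^sup>2 = exp (3 * norm (wavevec k)) * (norm h)\<^sup>2"
        by (simp add: power_mult_distrib power2_eq_square exp_add[symmetric] mult_exp_exp mult.assoc[symmetric])
      finally have "norm (q k) \<le> norm (E k z) * (exp (3 * norm (wavevec k)) * (norm h)\<^sup>2)"
        by (simp add: mult_left_mono)
      also have "\<dots> = (norm h)\<^sup>2 * (norm (E k z) * exp (3 * norm (wavevec k)))" by (simp only: mult_ac)
      also have "\<dots> \<le> (norm h)\<^sup>2 * exp (real N * norm (wavevec k))" by (intro mult_left_mono EN) simp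
      finally show ?thesis .
    qed
    have "(\<Sum>\<^sub>\<infinity>k. E k (z + h) *s c k) = (\<Sum>\<^sub>\<infinity>k. (E k z *s c k + (\<i> * cdot (wavevec k) h * E k z) *s c k) + q k *s c k)"
      unfolding vector_sadd_rdistrib[symmetric] q_def by (simp only: add_diff_cancel_left' diff_diff_eq add_diff_eq)
    also have "\<dots> = (\<Sum>\<^sub>\<infinity>k. E k z *s c k) + D h + (\<Sum>\<^sub>\<infinity>k. q k *s c k)"
      unfolding D_def
      by (subst infsum_add[OF summable_on_add[OF series(1)[OF w0] series(1)[OF wD]] series(1)[OF wq]],
          subst infsum_add[OF series(1)[OF w0] series(1)[OF wD]]) (rule refl)
    finally show ?thesis using series(2)[OF wq] by simp
  qed
  have "((\<lambda>z. \<Sum>\<^sub>\<infinity>k. E k z *s c k) has_derivative D) (at z)"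
    unfolding has_derivative_at
  proof (rule conjI[OF linD], rule Lim_null_comparison)
    show "\<forall>\<^sub>F h in at 0. norm (norm ((\<Sum>\<^sub>\<infinity>k. E k (z + h) *s c k) - (\<Sum>\<^sub>\<infinity>k. E k z *s c k) - D h) / norm h) \<le> norm h * B"
      unfolding eventually_at
    proof (intro exI[of _ 1] conjI ballI impI)
      fix h :: "complex^3" assume h: "h \<noteq> 0 \<and> dist h 0 < 1"
      then have "norm ((\<Sum>\<^sub>\<infinity>k. E k (z + h) *s c k) - (\<Sum>\<^sub>\<infinity>k. E k z *s c k) - D h) \<le> (norm h)\<^sup>2 * B"
        by (intro rem) simp
      then show "norm (norm ((\<Sum>\<^sub>\<infinity>k. E k (z + h) *s c k) - (\<Sum>\<^sub>\<infinity>k. E k z *s c k) - D h) / norm h) \<le> norm h * B"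
        using h by (simp add: divide_le_eq power2_eq_square mult_ac)
    qed simp
    show "((\<lambda>h. norm h * B) \<longlongrightarrow> 0) (at 0)"
      using tendsto_mult_right[OF tendsto_norm_zero[OF tendsto_ident_at], of B] by simp
  qed
  then show "\<exists>D. ((\<lambda>z. \<Sum>\<^sub>\<infinity>k. exp (\<i> * cdot (wavevec k) z) *s c k) has_derivative D) (at z) \<and>
      (\<forall>r v. D (r *s v) = r *s D v)"
    unfolding E_def[symmetric] using scale by blast
qed

lemma countable_lattice: "countable (UNIV :: (int^3) set)"
proof -
  have "(UNIV :: (int^3) set) \<subseteq> range (\<lambda>(a, b, c). vector [a, b, c])"
  proof
    fix k :: "int^3"
    have "k = vector [k $ 1, k $ 2, k $ 3]" by (simp add: vec_eq_iff forall_3 vector_3)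
    then show "k \<in> range (\<lambda>(a, b, c). vector [a, b, c])" by (auto intro: range_eqI[of _ _ "(k $ 1, k $ 2, k $ 3)"])
  qed
  then show ?thesis by (rule countable_subset) simp
qed

text \<open>The exceptional set is covered by countably many translates of a null set.\<close>

lemma AE_periodic:
  assumes ae: "AE x in torus. P x" and per: "\<And>x m. P (x + (2 * pi) *\<^sub>R wavevec m) = P x"
  shows "AE x in lebesgue. P x"
proof -
  have "AE x in lebesgue. x \<in> Omega \<longrightarrow> P x" using ae by (simp add: AE_restrict_space_iff)
  then obtain N where N: "N \<in> null_sets lebesgue" "{x. \<not> (x \<in> Omega \<longrightarrow> P x)} \<subseteq> N"
    by (auto simp: eventually_ae_filter)
  have neg: "negligible N" using N(1) by (simp add: negligible_iff_null_sets)
  have "negligible (\<Union>m. (+) ((2 * pi) *\<^sub>R wavevec m) ` N)"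
    by (intro negligible_countable_Union countable_image countable_lattice) (auto intro: negligible_translation neg)
  moreover have "{x. \<not> P x} \<subseteq> (\<Union>m. (+) ((2 * pi) *\<^sub>R wavevec m) ` N)"
  proof
    fix x assume "x \<in> {x. \<not> P x}"
    then have x: "\<not> P x" by simp
    define m :: "int^3" where "m = (\<chi> j. \<lfloor>x $ j / (2 * pi)\<rfloor>)"
    define y where "y = x - (2 * pi) *\<^sub>R wavevec m"
    have xy: "x = (2 * pi) *\<^sub>R wavevec m + y" by (simp add: y_def)
    have "\<not> P y" using x per[of y m] by (simp add: y_def)
    moreover have "y \<in> Omega"
      unfolding Omega_def mem_box_cart
    proof
      fix j
      have "of_int \<lfloor>x $ j / (2 * pi)\<rfloor> \<le> x $ j / (2 * pi)" "x $ j / (2 * pi) < of_int \<lfloor>x $ j / (2 * pi)\<rfloor> + 1" by linarith+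
      then have "2 * pi * of_int \<lfloor>x $ j / (2 * pi)\<rfloor> \<le> x $ j" "x $ j < 2 * pi * (of_int \<lfloor>x $ j / (2 * pi)\<rfloor> + 1)"
        using pos_le_divide_eq[of "2 * pi" "of_int \<lfloor>x $ j / (2 * pi)\<rfloor>" "x $ j"]
          pos_divide_less_eq[of "2 * pi" "x $ j" "of_int \<lfloor>x $ j / (2 * pi)\<rfloor> + 1"] pi_gt_zero
        by (simp_all only: mult.commute[of _ "2 * pi"])
      then show "(0::real^3) $ j \<le> y $ j \<and> y $ j \<le> (\<chi> i. 2 * pi) $ j"
        by (simp add: y_def m_def algebra_simps)
    qed
    ultimately have "y \<in> N" using N(2) by auto
    then show "x \<in> (\<Union>m. (+) ((2 * pi) *\<^sub>R wavevec m) ` N)" using xy by blast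
  qed
  ultimately have "negligible {x. \<not> P x}" by (rule negligible_subset)
  then show ?thesis by (intro AE_I'[of "{x. \<not> P x}"]) (auto simp: negligible_iff_null_sets)
qed

lemma extends_to_entire_if_summable:
  assumes f: "f \<in> L2_per"
    and sm: "\<And>n::nat. (\<lambda>k. exp (real n * norm (wavevec k)) * norm (fourier_coeff f k)) summable_on UNIV"
  shows "extends_to_entire f"
proof -
  define F where "F z = (\<Sum>\<^sub>\<infinity>k. exp (\<i> * cdot (wavevec k) z) *s fourier_coeff f k)" for z
  have entire: "entire3 F" unfolding F_def[abs_def] by (rule entire_fourier_series[OF sm])
  let ?cx = "\<lambda>x::real^3. \<chi> i. complex_of_real (x $ i)"
  have s0: "(\<lambda>k. norm (fourier_coeff f k)) summable_on UNIV" using sm[of 0] by simp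
  have wave: "exp (\<i> * cdot (wavevec k) (?cx x)) = wave k x" for k x
    by (simp add: wave_def cis_conv_exp cdot_def inner_vec_def)
  have Fj: "F (?cx x) $ j = (\<Sum>\<^sub>\<infinity>k. fourier_coeff f k $ j * wave k x)" for x j
  proof -
    have "(\<lambda>k. norm (wave k x *s fourier_coeff f k)) summable_on UNIV" using s0 by (simp add: norm_vec_smult)
    then have s: "(\<lambda>k. wave k x *s fourier_coeff f k) summable_on UNIV" by (rule abs_summable_summable)
    show ?thesis unfolding F_def wave
      using infsumI[OF has_sum_bounded_linear[OF bounded_linear_vec_nth has_sum_infsum[OF s]], of j]
      by (simp add: mult.commute)
  qed
  have "AE x in torus. \<forall>j\<in>UNIV. complex_of_real (f x $ j) = F (?cx x) $ j"
  proof (rule AE_finite_allI[OF finite])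
    fix j :: 3
    have "(\<lambda>k. norm (fourier_coeff f k $ j)) summable_on UNIV"
      using s0 by (rule summable_on_comparison_test) (auto simp: Finite_Cartesian_Product.norm_nth_le)
    then have "AE x in torus. complex_of_real (f x $ j) = (\<Sum>\<^sub>\<infinity>p. fourier_coeff f p $ j * wave p x)"
      using fourier_series_AE[OF L2_integrable[OF L2_component[OF f]]] by (simp add: fourier_coeff_nth)
    then show "AE x in torus. complex_of_real (f x $ j) = F (?cx x) $ j" by (simp only: Fj)
  qed
  then have "AE x in torus. F (?cx x) = (\<chi> j. complex_of_real (f x $ j))"
    by eventually_elim (simp add: vec_eq_iff)
  then have "AE x in lebesgue. F (?cx x) = (\<chi> j. complex_of_real (f x $ j))"
  proof (rule AE_periodic)
    fix x m
    have "F (?cx (x + (2 * pi) *\<^sub>R wavevec m)) = F (?cx x)"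
      unfolding vec_eq_iff Fj using periodic_wave by (simp add: periodic_def)
    moreover have "f (x + (2 * pi) *\<^sub>R wavevec m) = f x" using L2_perD(1)[OF f] by (simp add: periodic_def)
    ultimately show "(F (?cx (x + (2 * pi) *\<^sub>R wavevec m)) = (\<chi> j. complex_of_real (f (x + (2 * pi) *\<^sub>R wavevec m) $ j)))
        = (F (?cx x) = (\<chi> j. complex_of_real (f x $ j)))" by simp
  qed
  then show ?thesis unfolding extends_to_entire_def using entire by blast
qed

section \<open>Weak solutions are entire with superexponentially decaying coefficients\<close>

lemma ln_2_less_beta:
  assumes "\<kappa> > 3" "\<delta> > 0"
  shows "ln 2 < beta \<kappa> \<delta>"
proof -
  have q: "2 < (4 * \<kappa> - 5) / (2 * \<kappa> - 5)" using assms by (simp add: less_divide_eq)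
  have "1 * 2 < (1 + \<delta>) * ((4 * \<kappa> - 5) / (2 * \<kappa> - 5))"
    using assms q by (intro mult_strict_mono) auto
  then show ?thesis unfolding beta_def by (subst ln_less_cancel_iff) auto
qed

theorem corollary3p1:
  fixes \<mu> \<sigma> \<kappa> \<delta> L U :: real
    and u0 :: "real^3 \<Rightarrow> real^3"
    and u :: "real \<Rightarrow> real^3 \<Rightarrow> real^3"
  assumes "\<mu> > 0" and "\<sigma> > 0" and "\<kappa> > 3" and "\<delta> > 0" and "L > 0" and "U > 0"
    and "u0 \<in> H"
    and "weak_solution \<mu> \<sigma> u0 u"
  shows "(\<forall>t>0. extends_to_entire (u t)) \<and>
    (\<exists>\<Lambda>>0. \<forall>t>0. \<forall>\<epsilon>. 0 < \<epsilon> \<and> \<epsilon> < 1 \<longrightarrow>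
       (\<forall>k. k \<noteq> 0 \<and>
            norm (wavevec k) \<ge> sqrt (\<Lambda> * L / (U * t)) powr (beta \<kappa> \<delta> / (\<epsilon> * \<sigma>)) \<longrightarrow>
          norm (fourier_coeff (u t) k)
            \<le> exp (- (\<sigma> * (1 - \<epsilon>) / beta \<kappa> \<delta>) * norm (wavevec k) * ln (norm (wavevec k)))))"
proof -
  interpret mode_system \<mu> \<sigma> "\<lambda>t. fourier_coeff (u t)"
    by (rule weak_solution_mode_system[OF assms(1,2,8)])
  have uL: "u t \<in> L2_per" if "t > 0" for t
  proof -
    have "continuous_in_H t u" using assms(8) that by (simp add: weak_solution_def)
    then have "u t \<in> H" using that by (simp add: continuous_in_H_def)
    then show ?thesis by (rule H_L2)
  qed
  define b where "b = beta \<kappa> \<delta>"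
  have b: "ln 2 < b" unfolding b_def by (rule ln_2_less_beta[OF assms(3,4)])
  have b0: "b > 0" using b ln_gt_zero[of "2::real"] by linarith
  obtain \<Lambda> where \<Lambda>: "\<Lambda> > 0" "\<And>t k. 0 < t \<Longrightarrow> k \<noteq> 0 \<Longrightarrow>
      norm (fourier_coeff (u t) k) \<le> exp (norm (wavevec k) * max 0 (ln (\<Lambda> / t) / 2) - \<sigma> / b * norm (wavevec k) * ln (norm (wavevec k)))"
    using uniform_superexponential_decay[OF b] by blast
  have "norm (fourier_coeff (u t) k) \<le> exp (- (\<sigma> * (1 - \<epsilon>) / b) * norm (wavevec k) * ln (norm (wavevec k)))"
    if t: "t > 0" and \<epsilon>: "0 < \<epsilon>" and k: "k \<noteq> 0"
      and large: "norm (wavevec k) \<ge> sqrt (\<Lambda> / t) powr (b / (\<epsilon> * \<sigma>))" for t \<epsilon> k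
  proof -
    define K where "K = norm (wavevec k)"
    have K1: "1 \<le> K" unfolding K_def by (rule norm_wavevec_ge_1[OF k])
    have X: "sqrt (\<Lambda> / t) > 0" using \<Lambda>(1) t by simp
    \<comment> \<open>the threshold says that \<open>\<epsilon> \<sigma> / b * ln K\<close> dominates the logarithm of \<open>sqrt (\<Lambda> / t)\<close>, so the
      fraction \<open>\<epsilon>\<close> of the decay pays for the growing factor\<close>
    have "ln (sqrt (\<Lambda> / t) powr (b / (\<epsilon> * \<sigma>))) \<le> ln K"
      using large X K1 unfolding K_def by (subst ln_le_cancel_iff) auto
    then have "b / (\<epsilon> * \<sigma>) * ln (sqrt (\<Lambda> / t)) \<le> ln K" using X by (simp add: ln_powr)
    then have "\<epsilon> * \<sigma> / b * (b / (\<epsilon> * \<sigma>) * ln (sqrt (\<Lambda> / t))) \<le> \<epsilon> * \<sigma> / b * ln K"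
      using \<epsilon> assms(2) b0 by (intro mult_left_mono) auto
    then have "ln (\<Lambda> / t) / 2 \<le> \<epsilon> * \<sigma> / b * ln K"
      using \<epsilon> assms(2) b0 \<Lambda>(1) t by (simp add: ln_sqrt)
    moreover have "0 \<le> \<epsilon> * \<sigma> / b * ln K" using \<epsilon> assms(2) b0 K1 by simp
    ultimately have "K * max 0 (ln (\<Lambda> / t) / 2) \<le> K * (\<epsilon> * \<sigma> / b * ln K)"
      using K1 by (intro mult_left_mono) auto
    moreover have "K * (\<epsilon> * \<sigma> / b * ln K) - \<sigma> / b * K * ln K = - (\<sigma> * (1 - \<epsilon>) / b) * K * ln K"
      using b0 by (simp add: field_simps)
    ultimately have "K * max 0 (ln (\<Lambda> / t) / 2) - \<sigma> / b * K * ln K \<le> - (\<sigma> * (1 - \<epsilon>) / b) * K * ln K"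
      by linarith
    then show ?thesis using \<Lambda>(2)[OF t k] unfolding K_def[symmetric] by (meson exp_le_cancel_iff order_trans)
  qed
  moreover have "\<Lambda> * U / L * L / (U * t) = \<Lambda> / t" for t using assms(5,6) by simp
  moreover have "\<Lambda> * U / L > 0" using \<Lambda>(1) assms(5,6) by simp
  moreover have "extends_to_entire (u t)" if "t > 0" for t
    by (rule extends_to_entire_if_summable[OF uL[OF that] exponentially_weighted_summable[OF that]])
  ultimately show ?thesis unfolding b_def
    by (intro conjI allI impI exI[of _ "\<Lambda> * U / L"]) auto
qed

end
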